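(* If $\mathcal{M}$ is a II$_1$ factor with property $\Gamma$, then $\mathfrak{K}_2(\mathcal{M})=0$.
   Context: Tracial states are faithful and normal; $\tau$ denotes the tracial state of the II$_1$ factor. Property $\Gamma$ is that of Murray and von Neumann: for all $x_1,\ldots,x_n\in\mathcal{M}$ and $\epsilon>0$ there is a unitary $u\in\mathcal{M}$ with $\tau(u)=0$ and $\|ux_j-x_ju\|_2<\epsilon$ for all $j$. Let $\mathcal{M}_k(\mathbb{C})$ be the $k\times k$ complex matrices, $\tau_k=\frac1k Tr$, $\mathcal{U}(k)$ the unitary group, and $\|(A_1,\ldots,A_n)\|_2^2=\sum_j\tau_k(A_j^*A_j)$ on $\mathcal{M}_k(\mathbb{C})^n$; $\|\cdot\|$ is the operator norm. For $R,\epsilon>0$ and $m,k\in\mathbb{N}$, $\Gamma_R(x_1,\ldots,x_n;m,k,\epsilon)$ is the set of $(A_1,\ldots,A_n)\in\mathcal{M}_k(\mathbb{C})^n$ with $\|A_j\|\le R$ for all $j$ and $|\tau_k(A_{i_1}^{\eta_1}\cdots A_{i_q}^{\eta_q})-\tau(x_{i_1}^{\eta_1}\cdots x_{i_q}^{\eta_q})|<\epsilon$ for all $1\le q\le m$, $1\le i_1,\ldots,i_q\le n$, $\eta_1,\ldots,\eta_q\in\{1,*\}$. For $\omega>0$, the $\omega$-orbit-ball $\mathcal{U}(B_1,\ldots,B_n;\omega)$ is the set of $(A_1,\ldots,A_n)\in\mathcal{M}_k(\mathbb{C})^n$ for which there is $W\in\mathcal{U}(k)$ with $\|(A_1,\ldots,A_n)-(WB_1W^*,\ldots,WB_nW^*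 )\|_2<\omega$. The $\omega$-orbit covering number $\nu(\Gamma_R(x_1,\ldots,x_n;m,k,\epsilon),\omega)$ is the minimal number of $\omega$-orbit-balls with centers in $\Gamma_R(x_1,\ldots,x_n;m,k,\epsilon)$ that cover this set (by convention $\nu(\emptyset,\omega)=1$, so that the quantities below are $\ge0$ for $0<\omega<1$). Define $$\mathfrak{K}(x_1,\ldots,x_n;\omega,R)=\inf_{m\in\mathbb{N},\epsilon>0}\limsup_{k\to\infty}\frac{\log\nu(\Gamma_R(x_1,\ldots,x_n;m,k,\epsilon),\omega)}{-k^2\log\omega},$$ $\mathfrak{K}(x_1,\ldots,x_n;\omega)=\sup_{R>0}\mathfrak{K}(x_1,\ldots,x_n;\omega,R)$, and $\mathfrak{K}_2(x_1,\ldots,x_n)=\sup_{0<\omega<1}\mathfrak{K}(x_1,\ldots,x_n;\omega)$. For a finitely generated von Neumann algebra $\mathcal{M}$ with tracial state $\tau$, the upper free orbit-dimension $\mathfrak{K}_2(\mathcal{M})$ is the supremum of $\mathfrak{K}_2(x_1,\ldots,x_n)$ over all finite families $x_1,\ldots,x_n$ that generate $\mathcal{M}$ as a von Neumann algebra. Since $\mathfrak{K}_2$ is defined only for finitely generated algebras, any algebra to which it is applied is understood to be finitely generated. *)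

theory Defs
  imports
    "HOL-Analysis.Analysis"
    "Jordan_Normal_Form.Schur_Decomposition"
begin

section \<open>Complex Hilbert spaces and bounded operators\<close>

text \<open>The inner product is linear in the first argument.\<close>

class complex_hilbert_space = banach +
  fixes scaleC :: "complex \<Rightarrow> 'a \<Rightarrow> 'a"
    and cinner :: "'a \<Rightarrow> 'a \<Rightarrow> complex"
  assumes scaleC_add_right: "scaleC c (x + y) = scaleC c x + scaleC c y"
    and scaleC_add_left: "scaleC (c + d) x = scaleC c x + scaleC d x"
    and scaleC_scaleC: "scaleC c (scaleC d x) = scaleC (c * d) x"
    and scaleR_scaleC: "scaleR r x = scaleC (complex_of_real r) x"
    and cinner_commute: "cinner x y = cnj (cinner y x)"
    and cinner_add_left: "cinner (x + y) z = cinner x z + cinner y z"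
    and cinner_scaleC_left: "cinner (scaleC c x) y = c * cinner x y"
    and norm_eq_sqrt_cinner: "norm x = sqrt (Re (cinner x x))"

text \<open>
  The type \<open>'h \<Rightarrow>\<^sub>L 'h\<close> consists of the bounded real-linear operators;
  \<open>bounded_ops\<close> is its subset of complex-linear ones, that is \<open>B(H)\<close>.
\<close>

definition bounded_ops :: "('h::complex_hilbert_space \<Rightarrow>\<^sub>L 'h) set" where
  "bounded_ops = {a. \<forall>c x. blinfun_apply a (scaleC c x) = scaleC c (blinfun_apply a x)}"

definition scalar_op :: "complex \<Rightarrow> ('h::complex_hilbert_space \<Rightarrow>\<^sub>L 'h)" where
  "scalar_op c = Blinfun (scaleC c)"

text \<open>Used only on \<open>bounded_ops\<close>, where the adjoint exists and is unique.\<close>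

definition op_adj :: "('h::complex_hilbert_space \<Rightarrow>\<^sub>L 'h) \<Rightarrow> ('h \<Rightarrow>\<^sub>L 'h)" where
  "op_adj a = (THE b. \<forall>x y. cinner (blinfun_apply a x) y = cinner x (blinfun_apply b y))"

section \<open>Von Neumann algebras\<close>

definition commutant ::
    "('h::complex_hilbert_space \<Rightarrow>\<^sub>L 'h) set \<Rightarrow> ('h \<Rightarrow>\<^sub>L 'h) set" where
  "commutant S = {a \<in> bounded_ops. \<forall>s\<in>S. a o\<^sub>L s = s o\<^sub>L a}"

definition von_neumann_algebra :: "('h::complex_hilbert_space \<Rightarrow>\<^sub>L 'h) set \<Rightarrow> bool" where
  "von_neumann_algebra M \<longleftrightarrow>
     M \<subseteq> bounded_ops \<and> (\<forall>a\<in>M. op_adj a \<in> M) \<and> commutant (commutant M) = M"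

definition vn_generated ::
    "('h::complex_hilbert_space \<Rightarrow>\<^sub>L 'h) set \<Rightarrow> ('h \<Rightarrow>\<^sub>L 'h) set" where
  "vn_generated S = \<Inter>{N. von_neumann_algebra N \<and> S \<subseteq> N}"

definition generates_vn ::
    "('h::complex_hilbert_space \<Rightarrow>\<^sub>L 'h) list \<Rightarrow> ('h \<Rightarrow>\<^sub>L 'h) set \<Rightarrow> bool" where
  "generates_vn xs M \<longleftrightarrow> set xs \<subseteq> M \<and> vn_generated (set xs) = M"

definition finitely_generated_vn :: "('h::complex_hilbert_space \<Rightarrow>\<^sub>L 'h) set \<Rightarrow> bool" where
  "finitely_generated_vn M \<longleftrightarrow> (\<exists>xs. generates_vn xs M)"

definition vn_factor :: "('h::complex_hilbert_space \<Rightarrow>\<^sub>L 'h) set \<Rightarrow> bool" where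
  "vn_factor M \<longleftrightarrow>
     von_neumann_algebra M \<and> id_blinfun \<noteq> (0 :: 'h \<Rightarrow>\<^sub>L 'h) \<and>
     M \<inter> commutant M = range scalar_op"

definition projections ::
    "('h::complex_hilbert_space \<Rightarrow>\<^sub>L 'h) set \<Rightarrow> ('h \<Rightarrow>\<^sub>L 'h) set" where
  "projections M = {p \<in> M. op_adj p = p \<and> p o\<^sub>L p = p}"

text \<open>For projections, \<open>q \<le> p\<close> means \<open>p q = q\<close>.\<close>

definition minimal_projection ::
    "('h::complex_hilbert_space \<Rightarrow>\<^sub>L 'h) set \<Rightarrow> ('h \<Rightarrow>\<^sub>L 'h) \<Rightarrow> bool" where
  "minimal_projection M p \<longleftrightarrow>
     p \<in> projections M \<and> p \<noteq> 0 \<and>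
     (\<forall>q\<in>projections M. p o\<^sub>L q = q \<longrightarrow> q = 0 \<or> q = p)"

definition equivalent_projections ::
    "('h::complex_hilbert_space \<Rightarrow>\<^sub>L 'h) set \<Rightarrow> ('h \<Rightarrow>\<^sub>L 'h) \<Rightarrow> ('h \<Rightarrow>\<^sub>L 'h) \<Rightarrow> bool" where
  "equivalent_projections M p q \<longleftrightarrow>
     (\<exists>v\<in>M. op_adj v o\<^sub>L v = p \<and> v o\<^sub>L op_adj v = q)"

definition finite_projection ::
    "('h::complex_hilbert_space \<Rightarrow>\<^sub>L 'h) set \<Rightarrow> ('h \<Rightarrow>\<^sub>L 'h) \<Rightarrow> bool" where
  "finite_projection M p \<longleftrightarrow>
     p \<in> projections M \<and>
     (\<forall>q\<in>projections M. p o\<^sub>L q = q \<longrightarrow> equivalent_projections M p q \<longrightarrow> q = p)"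

definition II1_factor :: "('h::complex_hilbert_space \<Rightarrow>\<^sub>L 'h) set \<Rightarrow> bool" where
  "II1_factor M \<longleftrightarrow>
     vn_factor M \<and> (\<nexists>p. minimal_projection M p) \<and> finite_projection M id_blinfun"

section \<open>Tracial states and property \<open>\<Gamma>\<close>\<close>

definition ultraweak_functionals ::
    "(('h::complex_hilbert_space \<Rightarrow>\<^sub>L 'h) \<Rightarrow> complex) set" where
  "ultraweak_functionals =
     {\<lambda>a. \<Sum>n. cinner (blinfun_apply a (\<xi> n)) (\<eta> n) | \<xi> \<eta> :: nat \<Rightarrow> 'h.
        summable (\<lambda>n. (norm (\<xi> n))\<^sup>2) \<and> summable (\<lambda>n. (norm (\<eta> n))\<^sup>2)}"

definition ultraweak_topology ::
    "('h::complex_hilbert_space \<Rightarrow>\<^sub>L 'h) set \<Rightarrow> ('h \<Rightarrow>\<^sub>L 'h) topology" where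
  "ultraweak_topology M =
     topology_generated_by {{a \<in> M. f a \<in> U} | f U. f \<in> ultraweak_functionals \<and> open U}"

text \<open>
  A tracial state is a positive unital trace on \<open>M\<close>, faithful and normal. Normality is
  continuity for the ultraweak (\<open>\<sigma>\<close>-weak) topology. Values outside \<open>M\<close> are irrelevant.
\<close>

definition tracial_state ::
    "('h::complex_hilbert_space \<Rightarrow>\<^sub>L 'h) set \<Rightarrow> (('h \<Rightarrow>\<^sub>L 'h) \<Rightarrow> complex) \<Rightarrow> bool" where
  "tracial_state M \<tau> \<longleftrightarrow>
     (\<forall>a\<in>M. \<forall>b\<in>M. \<tau> (a + b) = \<tau> a + \<tau> b) \<and>
     (\<forall>c. \<forall>a\<in>M. \<tau> (scalar_op c o\<^sub>L a) = c * \<tau> a) \<and>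
     (\<forall>a\<in>M. Im (\<tau> (op_adj a o\<^sub>L a)) = 0 \<and> Re (\<tau> (op_adj a o\<^sub>L a)) \<ge> 0) \<and>
     \<tau> id_blinfun = 1 \<and>
     (\<forall>a\<in>M. \<forall>b\<in>M. \<tau> (a o\<^sub>L b) = \<tau> (b o\<^sub>L a)) \<and>
     (\<forall>a\<in>M. \<tau> (op_adj a o\<^sub>L a) = 0 \<longrightarrow> a = 0) \<and>
     continuous_map (ultraweak_topology M) euclidean \<tau>"

definition norm2 ::
    "(('h::complex_hilbert_space \<Rightarrow>\<^sub>L 'h) \<Rightarrow> complex) \<Rightarrow> ('h \<Rightarrow>\<^sub>L 'h) \<Rightarrow> real" where
  "norm2 \<tau> a = sqrt (Re (\<tau> (op_adj a o\<^sub>L a)))"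

definition unitaries ::
    "('h::complex_hilbert_space \<Rightarrow>\<^sub>L 'h) set \<Rightarrow> ('h \<Rightarrow>\<^sub>L 'h) set" where
  "unitaries M = {u \<in> M. op_adj u o\<^sub>L u = id_blinfun \<and> u o\<^sub>L op_adj u = id_blinfun}"

definition property_Gamma ::
    "('h::complex_hilbert_space \<Rightarrow>\<^sub>L 'h) set \<Rightarrow> (('h \<Rightarrow>\<^sub>L 'h) \<Rightarrow> complex) \<Rightarrow> bool" where
  "property_Gamma M \<tau> \<longleftrightarrow>
     (\<forall>xs \<epsilon>. set xs \<subseteq> M \<and> \<epsilon> > 0 \<longrightarrow>
        (\<exists>u\<in>unitaries M. \<tau> u = 0 \<and> (\<forall>x\<in>set xs. norm2 \<tau> ((u o\<^sub>L x) - (x o\<^sub>L u)) < \<epsilon>)))"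

section \<open>Matrix microstates\<close>

text \<open>An \<open>n\<close>-tuple of matrices is a list of length \<open>n\<close>.\<close>

definition tau_mat :: "nat \<Rightarrow> complex mat \<Rightarrow> complex" where
  "tau_mat k A = (\<Sum>i<k. A $$ (i, i)) / of_nat k"

definition vec_norm2 :: "complex vec \<Rightarrow> real" where
  "vec_norm2 v = sqrt (Re (v \<bullet>c v))"

definition mat_opnorm :: "nat \<Rightarrow> complex mat \<Rightarrow> real" where
  "mat_opnorm k A = (SUP v\<in>{v \<in> carrier_vec k. vec_norm2 v \<le> 1}. vec_norm2 (A *\<^sub>v v))"

definition unitary_group :: "nat \<Rightarrow> complex mat set" where
  "unitary_group k =
     {W \<in> carrier_mat k k. mat_adjoint W * W = 1\<^sub>m k \<and> W * mat_adjoint W = 1\<^sub>m k}"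

definition tuple_norm2 :: "nat \<Rightarrow> complex mat list \<Rightarrow> real" where
  "tuple_norm2 k As = sqrt (\<Sum>A\<leftarrow>As. Re (tau_mat k (mat_adjoint A * A)))"

text \<open>
  The list \<open>[(i\<^sub>1, b\<^sub>1), \<dots>, (i\<^sub>q, b\<^sub>q)]\<close> encodes the *-monomial with letters number
  \<open>i\<^sub>1, \<dots>, i\<^sub>q\<close> (counted from 0), the \<open>j\<close>-th one carrying a star iff \<open>b\<^sub>j\<close> holds.
\<close>

definition star_words :: "nat \<Rightarrow> nat \<Rightarrow> (nat \<times> bool) list set" where
  "star_words n m = {w. 1 \<le> length w \<and> length w \<le> m \<and> (\<forall>(i, b)\<in>set w. i < n)}"

definition op_word ::
    "('h::complex_hilbert_space \<Rightarrow>\<^sub>L 'h) list \<Rightarrow> (nat \<times> bool) list \<Rightarrow> ('h \<Rightarrow>\<^sub>L 'h)" where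
  "op_word xs w =
     foldr (\<lambda>(i, b) a. (if b then op_adj (xs ! i) else xs ! i) o\<^sub>L a) w id_blinfun"

definition mat_word :: "nat \<Rightarrow> complex mat list \<Rightarrow> (nat \<times> bool) list \<Rightarrow> complex mat" where
  "mat_word k As w =
     foldr (\<lambda>(i, b) A. (if b then mat_adjoint (As ! i) else As ! i) * A) w (1\<^sub>m k)"

definition mat_tuples :: "nat \<Rightarrow> nat \<Rightarrow> complex mat list set" where
  "mat_tuples k n = {As. length As = n \<and> set As \<subseteq> carrier_mat k k}"

definition microstates ::
    "(('h::complex_hilbert_space \<Rightarrow>\<^sub>L 'h) \<Rightarrow> complex) \<Rightarrow> ('h \<Rightarrow>\<^sub>L 'h) list \<Rightarrow> real \<Rightarrow>
     nat \<Rightarrow> nat \<Rightarrow> real \<Rightarrow> complex mat list set" where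
  "microstates \<tau> xs R m k \<epsilon> =
     {As \<in> mat_tuples k (length xs).
        (\<forall>A\<in>set As. mat_opnorm k A \<le> R) \<and>
        (\<forall>w\<in>star_words (length xs) m.
           cmod (tau_mat k (mat_word k As w) - \<tau> (op_word xs w)) < \<epsilon>)}"

definition orbit_ball :: "nat \<Rightarrow> complex mat list \<Rightarrow> real \<Rightarrow> complex mat list set" where
  "orbit_ball k Bs \<omega> =
     {As \<in> mat_tuples k (length Bs).
        \<exists>W\<in>unitary_group k.
          tuple_norm2 k (map2 (\<lambda>A B. A - W * B * mat_adjoint W) As Bs) < \<omega>}"

text \<open>
  For \<open>\<omega> > 0\<close> the minimum exists when \<open>G\<close> is bounded, in particular for microstate
  sets, because bounded sets of \<open>k \<times> k\<close> matrix tuples are totally bounded.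
\<close>

definition orbit_covering_number :: "nat \<Rightarrow> complex mat list set \<Rightarrow> real \<Rightarrow> nat" where
  "orbit_covering_number k G \<omega> =
     (if G = {} then 1
      else (LEAST N. \<exists>C. finite C \<and> card C = N \<and> C \<subseteq> G \<and> G \<subseteq> (\<Union>Bs\<in>C. orbit_ball k Bs \<omega>)))"

section \<open>Upper free orbit-dimension\<close>

definition orbit_dim_R ::
    "(('h::complex_hilbert_space \<Rightarrow>\<^sub>L 'h) \<Rightarrow> complex) \<Rightarrow> ('h \<Rightarrow>\<^sub>L 'h) list \<Rightarrow>
     real \<Rightarrow> real \<Rightarrow> ereal" where
  "orbit_dim_R \<tau> xs \<omega> R =
     (INF (m, \<epsilon>)\<in>{1..} \<times> {0<..}.
        limsup (\<lambda>k. ereal (ln (real (orbit_covering_number k (microstates \<tau> xs R m k \<epsilon>) \<omega>))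
                            / (- ((real k)\<^sup>2 * ln \<omega>)))))"

definition orbit_dim ::
    "(('h::complex_hilbert_space \<Rightarrow>\<^sub>L 'h) \<Rightarrow> complex) \<Rightarrow> ('h \<Rightarrow>\<^sub>L 'h) list \<Rightarrow>
     real \<Rightarrow> ereal" where
  "orbit_dim \<tau> xs \<omega> = (SUP R\<in>{0<..}. orbit_dim_R \<tau> xs \<omega> R)"

definition K2_tuple ::
    "(('h::complex_hilbert_space \<Rightarrow>\<^sub>L 'h) \<Rightarrow> complex) \<Rightarrow> ('h \<Rightarrow>\<^sub>L 'h) list \<Rightarrow> ereal" where
  "K2_tuple \<tau> xs = (SUP \<omega>\<in>{0<..<1}. orbit_dim \<tau> xs \<omega>)"

text \<open>Meaningful only for finitely generated \<open>M\<close>: otherwise the supremum is over the empty set.\<close>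

definition K2_algebra ::
    "('h::complex_hilbert_space \<Rightarrow>\<^sub>L 'h) set \<Rightarrow> (('h \<Rightarrow>\<^sub>L 'h) \<Rightarrow> complex) \<Rightarrow> ereal" where
  "K2_algebra M \<tau> = (SUP xs\<in>{xs. generates_vn xs M}. K2_tuple \<tau> xs)"

end

theory Submission
  imports Defs "Jordan_Normal_Form.Spectral_Radius"
begin

text \<open>
  In a factor, almost central elements are asymptotically independent of any fixed element.
  Adding up real parts of the trace-zero unitaries provided by property \<open>\<Gamma>\<close>, one therefore finds a
  self-adjoint \<open>*\<close>-polynomial \<open>H\<close> in the generators that almost commutes with them and whose moments
  are close to those of a sum of many independent centered variables; in particular its
  distribution gives little mass to pairs of values at distance less than 1. All this is
  visible in moments, so for a microstate \<open>A\<close> the hermitian matrix \<open>H(A)\<close> almost commutes with \<open>A\<close>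
  and its eigenvalues satisfy \<open>|d\<^sub>i - d\<^sub>j| < 1\<close> for at most \<open>\<eta> k\<^sup>2\<close> pairs. In an eigenbasis of
  \<open>H(A)\<close>, the tuple \<open>A\<close> is then close to one supported on about \<open>3 \<eta> k\<^sup>2\<close> positions. There are at
  most \<open>k\<^sup>k\<close> patterns of positions and \<open>exp(C \<eta> k\<^sup>2)\<close> rounded tuples for each, so the logarithm of
  the covering number is at most \<open>k log k + C \<eta> k\<^sup>2\<close> with \<open>\<eta>\<close> arbitrarily small.
\<close>

section \<open>Hilbert spaces\<close>

text \<open>A single element from property \<Gamma> is too concentrated: a trace-zero unitary may
  have only a few spectral values, and then a fixed share of all pairs of eigenvalues coincides. A
  sum of s asymptotically independent real parts has spread of order sqrt s, and its characteristic
  function is at most (1 - t^2/8)^s for |t| \<le> 1, so the share of close pairs falls below any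
  \<eta>. The unitaries are not polynomials in the generators. Their substitutes must be bounded in
  norm by a constant known beforehand, since closeness in the 2-norm controls higher moments only
  together with a norm bound; the map 2t/(1 + t^2) serves this purpose. The choices are made in the
  order \<omega>, \<eta>, s, the number and tolerance of the moments, H, and last the parameters m
  and \<epsilon> of the microstates. So nothing is lost if the degree and norm of H are huge: the
  coefficient of \<eta> k^2 depends only on \<omega>, on the number of generators and on their
  2-norms. In particular it is the same for every cutoff R.\<close>

lemma cinner_add_right: "cinner x (y + z) = cinner x y + cinner x (z::'h::complex_hilbert_space)"
  by (metis cinner_add_left cinner_commute complex_cnj_add)

lemma cinner_scaleC_right: "cinner x (scaleC c y) = cnj c * cinner x (y::'h::complex_hilbert_space)"
  by (metis cinner_scaleC_left cinner_commute complex_cnj_mult complex_cnj_cnj)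

lemma cinner_zero_left [simp]: "cinner 0 (y::'h::complex_hilbert_space) = 0"
  using cinner_add_left[of 0 0 y] by simp

lemma cinner_zero_right [simp]: "cinner (y::'h::complex_hilbert_space) 0 = 0"
  using cinner_add_right[of y 0 0] by simp

lemma cinner_minus_left: "cinner (- x) (y::'h::complex_hilbert_space) = - cinner x y"
  using cinner_add_left[of x "-x" y] by (simp add: eq_neg_iff_add_eq_0 add.commute)

lemma cinner_minus_right: "cinner x (- (y::'h::complex_hilbert_space)) = - cinner x y"
  using cinner_add_right[of x y "-y"] by (simp add: eq_neg_iff_add_eq_0 add.commute)

lemma cinner_diff_left: "cinner (x - z) (y::'h::complex_hilbert_space) = cinner x y - cinner z y"
  using cinner_add_left[of x "-z" y] by (simp add: cinner_minus_left)

lemma cinner_diff_right: "cinner x (y - (z::'h::complex_hilbert_space)) = cinner x y - cinner x z"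
  using cinner_add_right[of x y "-z"] by (simp add: cinner_minus_right)

lemmas cinner_simps = cinner_add_left cinner_add_right cinner_diff_left cinner_diff_right
  cinner_minus_left cinner_minus_right cinner_scaleC_left cinner_scaleC_right

lemma Im_cinner_self [simp]: "Im (cinner x (x::'h::complex_hilbert_space)) = 0"
  using arg_cong[OF cinner_commute[of x x], of Im] by simp

lemma Re_cinner_self: "Re (cinner x (x::'h::complex_hilbert_space)) = (norm x)\<^sup>2"
proof -
  have "0 \<le> sqrt (Re (cinner x x))"
    using norm_ge_zero[of x] unfolding norm_eq_sqrt_cinner .
  thus ?thesis by (simp add: norm_eq_sqrt_cinner)
qed

lemma cinner_self: "cinner x (x::'h::complex_hilbert_space) = complex_of_real ((norm x)\<^sup>2)"
  by (simp add: complex_eq_iff Re_cinner_self)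

lemma Re_cinner_commute: "Re (cinner x y) = Re (cinner y (x::'h::complex_hilbert_space))"
  using arg_cong[OF cinner_commute[of x y], of Re] by simp

lemma cinner_scaleR_left: "cinner (r *\<^sub>R x) (y::'h::complex_hilbert_space) = complex_of_real r * cinner x y"
  by (simp add: scaleR_scaleC cinner_scaleC_left)

lemma cinner_scaleR_right: "cinner x (r *\<^sub>R (y::'h::complex_hilbert_space)) = complex_of_real r * cinner x y"
  by (simp add: scaleR_scaleC cinner_scaleC_right)

lemma norm_diff_sq: "(norm (x - (y::'h::complex_hilbert_space)))\<^sup>2 = (norm x)\<^sup>2 - 2 * Re (cinner x y) + (norm y)\<^sup>2"
  by (simp add: Re_cinner_self[symmetric] cinner_simps Re_cinner_commute[of y x])

lemma norm_add_sq: "(norm (x + (y::'h::complex_hilbert_space)))\<^sup>2 = (norm x)\<^sup>2 + 2 * Re (cinner x y) + (norm y)\<^sup>2"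
  by (simp add: Re_cinner_self[symmetric] cinner_simps Re_cinner_commute[of y x])

lemma parallelogram:
  "(norm (x + y))\<^sup>2 + (norm (x - (y::'h::complex_hilbert_space)))\<^sup>2 = 2 * (norm x)\<^sup>2 + 2 * (norm y)\<^sup>2"
  by (simp add: norm_diff_sq norm_add_sq)

lemma norm_scaleC: "norm (scaleC c (x::'h::complex_hilbert_space)) = cmod c * norm x"
proof -
  have "cinner (scaleC c x) (scaleC c x) = (c * cnj c) * cinner x x"
    by (simp add: cinner_simps)
  hence "complex_of_real ((norm (scaleC c x))\<^sup>2) = complex_of_real ((cmod c)\<^sup>2 * (norm x)\<^sup>2)"
    by (simp only: cinner_self complex_norm_square[symmetric] of_real_mult)
  hence "(norm (scaleC c x))\<^sup>2 = (cmod c * norm x)\<^sup>2"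
    unfolding power_mult_distrib using of_real_eq_iff by blast
  thus ?thesis by (simp add: power2_eq_iff_nonneg)
qed

lemma cinner_cauchy_schwarz: "cmod (cinner x (y::'h::complex_hilbert_space)) \<le> norm x * norm y"
proof (cases "norm y = 0")
  case True
  thus ?thesis by simp
next
  case False
  hence ny: "norm y > 0" by simp
  define c where "c = cinner x y / complex_of_real ((norm y)\<^sup>2)"
  have "0 \<le> (norm (x - scaleC c y))\<^sup>2" by simp
  also have "\<dots> = (norm x)\<^sup>2 - 2 * Re (cnj c * cinner x y) + (cmod c * norm y)\<^sup>2"
    by (simp add: norm_diff_sq norm_scaleC cinner_simps)
  also have "cnj c * cinner x y = complex_of_real ((cmod (cinner x y))\<^sup>2 / (norm y)\<^sup>2)"
    unfolding c_def using complex_norm_square[of "cinner x y"] by (simp add: mult.commute)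
  also have "(cmod c * norm y)\<^sup>2 = (cmod (cinner x y))\<^sup>2 / (norm y)\<^sup>2"
    unfolding c_def using ny
    by (simp add: norm_divide power_mult_distrib power_divide norm_power norm_mult field_simps power2_eq_square)
  finally have "(cmod (cinner x y))\<^sup>2 / (norm y)\<^sup>2 \<le> (norm x)\<^sup>2"
    by simp
  hence "(cmod (cinner x y))\<^sup>2 \<le> (norm x * norm y)\<^sup>2"
    using ny by (simp add: field_simps power_mult_distrib)
  thus ?thesis by (rule power2_le_imp_le) simp
qed

lemma cinner_eq_zeroI: "(\<And>y. cinner x y = 0) \<Longrightarrow> x = (0::'h::complex_hilbert_space)"
  using cinner_self[of x] by (metis norm_eq_zero of_real_eq_0_iff zero_eq_power2)

lemma cinner_ext: "(\<And>y. cinner x y = cinner x' y) \<Longrightarrow> x = (x'::'h::complex_hilbert_space)"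
  using cinner_eq_zeroI[of "x - x'"] by (simp add: cinner_simps)

lemma cinner_ext_right: "(\<And>y. cinner y x = cinner y x') \<Longrightarrow> x = (x'::'h::complex_hilbert_space)"
  by (rule cinner_ext) (metis cinner_commute)

lemma bounded_linear_scaleC: "bounded_linear (scaleC c :: 'h::complex_hilbert_space \<Rightarrow> 'h)"
  by (rule bounded_linear_intro[of _ "cmod c"])
     (simp_all add: scaleC_add_right scaleR_scaleC scaleC_scaleC norm_scaleC mult.commute)

lemmas scaleC_diff_right = linear_diff[OF bounded_linear.linear[OF bounded_linear_scaleC]]
lemmas scaleC_minus_right = linear_neg[OF bounded_linear.linear[OF bounded_linear_scaleC]]

section \<open>Closed subspaces, orthogonal projection and the Riesz representation\<close>

definition csubspace :: "'h::complex_hilbert_space set \<Rightarrow> bool" where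
  "csubspace V \<longleftrightarrow> 0 \<in> V \<and> (\<forall>x\<in>V. \<forall>y\<in>V. x + y \<in> V) \<and> (\<forall>c. \<forall>x\<in>V. scaleC c x \<in> V)"

lemma csubspace_diff: "csubspace V \<Longrightarrow> x \<in> V \<Longrightarrow> y \<in> V \<Longrightarrow> x - y \<in> V"
  unfolding csubspace_def
  by (metis (no_types, lifting) scaleR_scaleC scaleR_minus1_left diff_conv_add_uminus)

lemma csubspace_closure:
  assumes "csubspace V" shows "csubspace (closure V)"
  unfolding csubspace_def
proof (intro conjI ballI allI)
  show "0 \<in> closure V" using assms closure_subset unfolding csubspace_def by blast
next
  fix x y assume "x \<in> closure V" "y \<in> closure V"
  then obtain f g where f: "\<And>n. f n \<in> V" "f \<longlonglongrightarrow> x" and g: "\<And>n. g n \<in> V" "g \<longlonglongrightarrow> y"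
    unfolding closure_sequential by blast
  have "(\<lambda>n. f n + g n) \<longlonglongrightarrow> x + y" "\<And>n. f n + g n \<in> V"
    using f g assms unfolding csubspace_def by (auto intro: tendsto_add)
  thus "x + y \<in> closure V" unfolding closure_sequential by (intro exI[of _ "\<lambda>n. f n + g n"]) auto
next
  fix c x assume "x \<in> closure V"
  then obtain f where f: "\<And>n. f n \<in> V" "f \<longlonglongrightarrow> x"
    unfolding closure_sequential by blast
  have "(\<lambda>n. scaleC c (f n)) \<longlonglongrightarrow> scaleC c x" "\<And>n. scaleC c (f n) \<in> V"
    using f assms bounded_linear.tendsto[OF bounded_linear_scaleC] unfolding csubspace_def by auto
  thus "scaleC c x \<in> closure V" unfolding closure_sequential by (intro exI[of _ "\<lambda>n. scaleC c (f n)"]) auto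
qed

lemma distance_attained:
  fixes V :: "'h::complex_hilbert_space set"
  assumes V: "csubspace V" "closed V"
  shows "\<exists>y\<in>V. \<forall>v\<in>V. norm (x - y) \<le> norm (x - v)"
proof -
  define d where "d = (INF v\<in>V. norm (x - v))"
  have ne: "V \<noteq> {}" using V unfolding csubspace_def by blast
  have bdd: "bdd_below ((\<lambda>v. norm (x - v)) ` V)" by (auto intro!: bdd_belowI2[of _ 0])
  have d0: "0 \<le> d" unfolding d_def using ne by (intro cINF_greatest) auto
  have dle: "d \<le> norm (x - v)" if "v \<in> V" for v
    unfolding d_def using that bdd by (intro cINF_lower)
  have "\<exists>v\<in>V. norm (x - v) < d + 1 / Suc n" for n
    using cINF_less_iff[OF ne bdd, of "d + 1 / Suc n"] unfolding d_def by auto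
  then obtain v where v: "\<And>n. v n \<in> V" "\<And>n. norm (x - v n) < d + 1 / Suc n" by metis
  have lim: "(\<lambda>n. norm (x - v n)) \<longlonglongrightarrow> d"
  proof (rule tendsto_sandwich[OF _ _ tendsto_const])
    show "(\<lambda>n. d + 1 / Suc n) \<longlonglongrightarrow> d"
      using tendsto_add[OF tendsto_const LIMSEQ_inverse_real_of_nat, of d] by (simp add: inverse_eq_divide)
  qed (use dle v in \<open>auto intro!: always_eventually less_imp_le\<close>)
  \<comment> \<open>The midpoint of \<open>v m\<close> and \<open>v n\<close> lies in
    \<open>V\<close>, so its distance to \<open>x\<close> is at least \<open>d\<close>; the
    parallelogram law turns this into the Cauchy property.\<close>
  have key: "(norm (v m - v n))\<^sup>2 \<le> 2 * (norm (x - v m))\<^sup>2 + 2 * (norm (x - v n))\<^sup>2 - 4 * d\<^sup>2" for m n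
  proof -
    define w where "w = (1/2) *\<^sub>R (v m + v n)"
    have "w \<in> V" using v V unfolding csubspace_def w_def by (simp add: scaleR_scaleC)
    hence "d \<le> norm (x - w)" by (rule dle)
    moreover have "(x - v m) + (x - v n) = 2 *\<^sub>R (x - w)"
      unfolding w_def by (simp add: scaleR_2 algebra_simps)
    hence "norm ((x - v m) + (x - v n)) = 2 * norm (x - w)" by simp
    ultimately have "4 * d\<^sup>2 \<le> (norm ((x - v m) + (x - v n)))\<^sup>2"
      using d0 power_mono[of d "norm (x - w)" 2] by (simp add: power_mult_distrib)
    moreover have "(x - v m) - (x - v n) = v n - v m" by simp
    ultimately show ?thesis using parallelogram[of "x - v m" "x - v n"] by (simp add: norm_minus_commute)
  qed
  have "Cauchy v"
  proof (rule CauchyI)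
    fix e :: real assume e: "e > 0"
    have "(\<lambda>n. (norm (x - v n))\<^sup>2) \<longlonglongrightarrow> d\<^sup>2" using lim by (intro tendsto_intros)
    hence "eventually (\<lambda>n. (norm (x - v n))\<^sup>2 < d\<^sup>2 + e\<^sup>2 / 4) sequentially"
      by (rule order_tendstoD) (use e in auto)
    then obtain N where N: "\<And>n. n \<ge> N \<Longrightarrow> (norm (x - v n))\<^sup>2 < d\<^sup>2 + e\<^sup>2 / 4"
      unfolding eventually_sequentially by blast
    have "norm (v m - v n) < e" if "m \<ge> N" "n \<ge> N" for m n
    proof -
      have "(norm (v m - v n))\<^sup>2 < e\<^sup>2" using key[of m n] N[OF that(1)] N[OF that(2)] by simp
      thus ?thesis using e by (simp add: power_less_imp_less_base)
    qed
    thus "\<exists>M. \<forall>m\<ge>M. \<forall>n\<ge>M. norm (v m - v n) < e" by blast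
  qed
  then obtain y where y: "v \<longlonglongrightarrow> y" using Cauchy_convergent convergent_def by blast
  have "y \<in> V" using V(2) v(1) y by (metis closed_sequentially)
  moreover have "norm (x - y) = d"
    using y by (intro LIMSEQ_unique[OF _ lim]) (intro tendsto_intros)
  ultimately show ?thesis using dle by auto
qed

theorem orthogonal_projection_exists:
  fixes V :: "'h::complex_hilbert_space set"
  assumes V: "csubspace V" "closed V"
  shows "\<exists>y\<in>V. \<forall>v\<in>V. cinner (x - y) v = 0"
proof -
  obtain y where y: "y \<in> V" "\<And>v. v \<in> V \<Longrightarrow> norm (x - y) \<le> norm (x - v)"
    using distance_attained[OF V] by blast
  have "cinner (x - y) v = 0" if "v \<in> V" for v
  proof (cases "v = 0")
    case False
    \<comment> \<open>The multiple of \<open>v\<close> closest to \<open>x - y\<close>. By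
      minimality of \<open>y\<close>, subtracting it gains nothing, which forces the numerator to
      vanish.\<close>
    define c where "c = cinner (x - y) v / complex_of_real ((norm v)\<^sup>2)"
    have "y + scaleC c v \<in> V" using V y that unfolding csubspace_def by blast
    hence "norm (x - y) \<le> norm (x - (y + scaleC c v))" by (rule y)
    hence "(norm (x - y))\<^sup>2 \<le> (norm ((x - y) - scaleC c v))\<^sup>2"
      by (simp add: diff_diff_eq power_mono)
    also have "\<dots> = (norm (x - y))\<^sup>2 - 2 * Re (cnj c * cinner (x - y) v) + (cmod c * norm v)\<^sup>2"
      by (simp add: norm_diff_sq[of "x - y"] norm_scaleC cinner_simps)
    also have "cnj c * cinner (x - y) v = complex_of_real ((cmod (cinner (x - y) v))\<^sup>2 / (norm v)\<^sup>2)"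
      unfolding c_def using complex_norm_square[of "cinner (x - y) v"] by (simp add: mult.commute)
    also have "(cmod c * norm v)\<^sup>2 = (cmod (cinner (x - y) v))\<^sup>2 / (norm v)\<^sup>2"
      unfolding c_def using False
      by (simp add: norm_divide power_mult_distrib power_divide norm_power norm_mult field_simps power2_eq_square)
    finally have "(cmod (cinner (x - y) v))\<^sup>2 / (norm v)\<^sup>2 \<le> 0" by simp
    thus ?thesis using False by (simp add: divide_le_0_iff)
  qed simp
  thus ?thesis using y by blast
qed

theorem riesz_representation:
  fixes f :: "'h::complex_hilbert_space \<Rightarrow> complex"
  assumes f: "bounded_linear f" and fc: "\<And>c x. f (scaleC c x) = c * f x"
  shows "\<exists>z. \<forall>x. f x = cinner x z"
proof (cases "\<forall>x. f x = 0")
  case True thus ?thesis by (intro exI[of _ 0]) simp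
next
  case False
  then obtain x where x: "f x \<noteq> 0" by blast
  interpret bounded_linear f by fact
  define V where "V = {v. f v = 0}"
  have V: "csubspace V" unfolding V_def csubspace_def by (simp add: zero add fc)
  have "closed V" unfolding V_def
    by (intro closed_Collect_eq continuous_on_const linear_continuous_on bounded_linear_axioms)
  then obtain y where y: "y \<in> V" "\<And>v. v \<in> V \<Longrightarrow> cinner (x - y) v = 0"
    using orthogonal_projection_exists[OF V] by metis
  define w where "w = x - y"
  have fw: "f w = f x" using y(1) unfolding w_def V_def by (simp add: diff)
  hence w0: "w \<noteq> 0" using x by (auto simp: zero)
  define z where "z = scaleC (cnj (f w / complex_of_real ((norm w)\<^sup>2))) w"
  have "f u = cinner u z" for u
  proof -
    have "u - scaleC (f u / f w) w \<in> V" unfolding V_def using x fw by (simp add: diff fc)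
    from y(2)[OF this] have "cinner w (u - scaleC (f u / f w) w) = 0" unfolding w_def .
    hence "cinner (u - scaleC (f u / f w) w) w = 0" by (metis cinner_commute complex_cnj_zero)
    hence "cinner u w = (f u / f w) * complex_of_real ((norm w)\<^sup>2)"
      by (simp add: cinner_simps cinner_self)
    thus ?thesis unfolding z_def using w0 x fw by (simp add: cinner_simps)
  qed
  thus ?thesis by blast
qed

lemma bounded_ops_scaleC: "a \<in> bounded_ops \<Longrightarrow> blinfun_apply a (scaleC c x) = scaleC c (blinfun_apply a x)"
  unfolding bounded_ops_def by simp

text \<open>Riesz is applied for fixed \<open>x\<close> to \<open>cnj (B x y)\<close>, which is
  linear in \<open>y\<close>. It gives the adjoint, and later turns a weak limit of matrix
  coefficients into an operator.\<close>

theorem sesquilinear_form_representation: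
  fixes B :: "'h::complex_hilbert_space \<Rightarrow> 'h \<Rightarrow> complex"
  assumes add1: "\<And>x x' y. B (x + x') y = B x y + B x' y"
    and sc1: "\<And>c x y. B (scaleC c x) y = c * B x y"
    and add2: "\<And>x y y'. B x (y + y') = B x y + B x y'"
    and sc2: "\<And>c x y. B x (scaleC c y) = cnj c * B x y"
    and bd: "\<And>x y. cmod (B x y) \<le> C * norm x * norm y"
  shows "\<exists>z\<in>bounded_ops. \<forall>x y. B x y = cinner (blinfun_apply z x) y"
proof -
  have "\<exists>z. \<forall>y. cnj (B x y) = cinner y z" for x
  proof (rule riesz_representation)
    show "bounded_linear (\<lambda>y. cnj (B x y))"
    proof (rule bounded_linear_intro[of _ "C * norm x"])
      fix y show "cmod (cnj (B x y)) \<le> norm y * (C * norm x)"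
        using bd[of x y] by (simp add: mult_ac)
    qed (simp_all add: add2 scaleR_scaleC[where 'a='h] sc2 scaleR_conv_of_real)
  qed (simp add: sc2)
  then obtain F where F: "\<And>x y. cnj (B x y) = cinner y (F x)" by metis
  have F': "B x y = cinner (F x) y" for x y
    using F[of x y] by (metis cinner_commute complex_cnj_cnj)
  have bl: "bounded_linear F"
  proof (rule bounded_linear_intro[of _ C])
    show "F (x + y) = F x + F y" for x y
      by (rule cinner_ext) (simp add: F'[symmetric] add1 cinner_simps)
    show "F (r *\<^sub>R x) = r *\<^sub>R F x" for r x
      by (rule cinner_ext) (simp add: F'[symmetric] sc1 cinner_simps scaleR_scaleC)
    show "norm (F x) \<le> norm x * C" for x
    proof (cases "F x = 0")
      case True
      \<comment> \<open>\<open>C\<close> is not assumed nonnegative; for nonzero \<open>x\<close>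
        the bound at \<open>(x, x)\<close> shows that it is.\<close>
      have "cmod (B x x) \<le> C * norm x * norm x" by (rule bd)
      hence "0 \<le> (norm x * C) * norm x" using norm_ge_zero[of "B x x"] by (simp add: mult_ac del: norm_ge_zero)
      thus ?thesis using True by (cases "x = 0") (auto simp: zero_le_mult_iff)
    next
      case False
      have "(norm (F x))\<^sup>2 = cmod (B x (F x))" by (simp only: F' cinner_self norm_of_real) simp
      also have "\<dots> \<le> C * norm x * norm (F x)" by (rule bd)
      finally show ?thesis using False by (simp add: power2_eq_square mult_ac)
    qed
  qed
  have sc: "F (scaleC c x) = scaleC c (F x)" for c x
    by (rule cinner_ext) (simp add: F'[symmetric] sc1 cinner_simps)
  show ?thesis
    by (rule bexI[of _ "Blinfun F"]) (auto simp: bounded_ops_def bounded_linear_Blinfun_apply[OF bl] F' sc)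
qed


section \<open>The algebra of bounded operators\<close>

lemma adjoint_exists:
  fixes a :: "'h::complex_hilbert_space \<Rightarrow>\<^sub>L 'h"
  assumes "a \<in> bounded_ops"
  shows "\<exists>b\<in>bounded_ops. \<forall>x y. cinner (blinfun_apply a x) y = cinner x (blinfun_apply b y)"
proof -
  have "\<exists>b\<in>bounded_ops. \<forall>x y. cinner x (blinfun_apply a y) = cinner (blinfun_apply b x) y"
  proof (rule sesquilinear_form_representation)
    fix x y
    have "cmod (cinner x (blinfun_apply a y)) \<le> norm x * (norm a * norm y)"
      by (rule order_trans[OF cinner_cauchy_schwarz mult_left_mono[OF norm_blinfun norm_ge_zero]])
    thus "cmod (cinner x (blinfun_apply a y)) \<le> norm a * norm x * norm y" by (simp add: mult_ac)
  qed (simp_all add: cinner_simps blinfun.add_right bounded_ops_scaleC[OF assms])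
  thus ?thesis by (metis cinner_commute)
qed

lemma op_adj_eqI:
  fixes a b :: "'h::complex_hilbert_space \<Rightarrow>\<^sub>L 'h"
  assumes "\<And>x y. cinner (blinfun_apply a x) y = cinner x (blinfun_apply b y)"
  shows "op_adj a = b"
  unfolding op_adj_def
proof (rule the_equality)
  fix b' assume "\<forall>x y. cinner (blinfun_apply a x) y = cinner x (blinfun_apply b' y)"
  with assms have "blinfun_apply b' y = blinfun_apply b y" for y
    by (intro cinner_ext_right) metis
  thus "b' = b" by (rule blinfun_eqI)
qed (use assms in blast)

lemma op_adj_bounded_ops: "a \<in> bounded_ops \<Longrightarrow> op_adj a \<in> bounded_ops"
  by (metis adjoint_exists op_adj_eqI)

lemma cinner_op_adj:
  "a \<in> bounded_ops \<Longrightarrow> cinner (blinfun_apply a x) y = cinner x (blinfun_apply (op_adj a) y)"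
  by (metis adjoint_exists op_adj_eqI)

lemma scalar_op_apply: "blinfun_apply (scalar_op c) x = scaleC c (x::'h::complex_hilbert_space)"
  unfolding scalar_op_def by (simp add: bounded_linear_Blinfun_apply bounded_linear_scaleC)

lemma scalar_op_bounded_ops: "scalar_op c \<in> (bounded_ops::('h::complex_hilbert_space \<Rightarrow>\<^sub>L 'h) set)"
  unfolding bounded_ops_def by (simp add: scalar_op_apply scaleC_scaleC mult.commute)

section \<open>The star-algebra of bounded operators as a type\<close>

typedef (overloaded) 'h bop = "bounded_ops :: ('h::complex_hilbert_space \<Rightarrow>\<^sub>L 'h) set"
  morphisms op_of Bop
  by (rule exI[of _ "scalar_op 1"]) (rule scalar_op_bounded_ops)

setup_lifting type_definition_bop

text \<open>As elements of a type in the ring classes, operators can be manipulated with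
  \<open>algebra_simps\<close>, \<open>sum\<close> and powers. Complex scalars appear as
  multiplication by the central elements \<open>scal c\<close>.\<close>

instantiation bop :: (complex_hilbert_space) real_normed_algebra
begin

lift_definition zero_bop :: "'a bop" is 0
  by (simp add: bounded_ops_def scalar_op_apply)
     (metis scaleR_scaleC scaleC_scaleC scaleR_zero_right mult.commute mult_zero_left scaleR_zero_left)

lift_definition plus_bop :: "'a bop \<Rightarrow> 'a bop \<Rightarrow> 'a bop" is "(+)"
  by (simp add: bounded_ops_def blinfun.add_left scaleC_add_right)

lift_definition uminus_bop :: "'a bop \<Rightarrow> 'a bop" is uminus
  by (simp add: bounded_ops_def blinfun.minus_left scaleC_minus_right)

lift_definition minus_bop :: "'a bop \<Rightarrow> 'a bop \<Rightarrow> 'a bop" is "(-)"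
  by (simp add: bounded_ops_def blinfun.diff_left scaleC_diff_right)

lift_definition scaleR_bop :: "real \<Rightarrow> 'a bop \<Rightarrow> 'a bop" is "scaleR"
  by (simp add: bounded_ops_def blinfun.scaleR_left scaleR_scaleC scaleC_scaleC mult.commute)

lift_definition norm_bop :: "'a bop \<Rightarrow> real" is norm .

lift_definition times_bop :: "'a bop \<Rightarrow> 'a bop \<Rightarrow> 'a bop" is "(o\<^sub>L)"
  by (simp add: bounded_ops_def)

definition dist_bop :: "'a bop \<Rightarrow> 'a bop \<Rightarrow> real" where "dist_bop a b = norm (a - b)"
definition sgn_bop :: "'a bop \<Rightarrow> 'a bop" where "sgn_bop a = inverse (norm a) *\<^sub>R a"
definition uniformity_bop :: "('a bop \<times> 'a bop) filter" where
  "uniformity_bop = (INF e\<in>{0<..}. principal {(x, y). dist x y < e})"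
definition open_bop :: "'a bop set \<Rightarrow> bool" where
  "open_bop U \<longleftrightarrow> (\<forall>x\<in>U. eventually (\<lambda>(x', y). x' = x \<longrightarrow> y \<in> U) uniformity)"

instance
proof
  fix a b c :: "'a bop" and r s :: real
  show "dist a b = norm (a - b)" by (rule dist_bop_def)
  show "sgn a = inverse (norm a) *\<^sub>R a" by (rule sgn_bop_def)
  show "(uniformity :: ('a bop \<times> 'a bop) filter) = (INF e\<in>{0<..}. principal {(x, y). dist x y < e})"
    by (rule uniformity_bop_def)
  show "open U \<longleftrightarrow> (\<forall>x\<in>U. eventually (\<lambda>(x', y). x' = x \<longrightarrow> y \<in> U) uniformity)" for U :: "'a bop set"
    by (rule open_bop_def)
  show "a + b + c = a + (b + c)" by transfer (rule add.assoc)
  show "a + b = b + a" by transfer (rule add.commute)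
  show "0 + a = a" by transfer simp
  show "- a + a = 0" by transfer simp
  show "a - b = a + - b" by transfer simp
  show "r *\<^sub>R (a + b) = r *\<^sub>R a + r *\<^sub>R b" by transfer (rule scaleR_add_right)
  show "(r + s) *\<^sub>R a = r *\<^sub>R a + s *\<^sub>R a" by transfer (rule scaleR_add_left)
  show "r *\<^sub>R s *\<^sub>R a = (r * s) *\<^sub>R a" by transfer simp
  show "1 *\<^sub>R a = a" by transfer simp
  show "norm a = 0 \<longleftrightarrow> a = 0" by transfer simp
  show "norm (a + b) \<le> norm a + norm b" by transfer (rule norm_triangle_ineq)
  show "norm (r *\<^sub>R a) = \<bar>r\<bar> * norm a" by transfer simp
  show "a * b * c = a * (b * c)" by transfer (rule blinfun_eqI, simp)
  show "(a + b) * c = a * c + b * c" by transfer (rule blinfun_eqI, simp add: blinfun.add_left)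
  show "a * (b + c) = a * b + a * c" by transfer (rule blinfun_eqI, simp add: blinfun.add_left blinfun.add_right)
  show "r *\<^sub>R a * b = r *\<^sub>R (a * b)" by transfer (rule blinfun_eqI, simp add: blinfun.scaleR_left)
  show "a * r *\<^sub>R b = r *\<^sub>R (a * b)"
    by transfer (rule blinfun_eqI, simp add: blinfun.scaleR_left blinfun.scaleR_right)
  show "norm (a * b) \<le> norm a * norm b" by transfer (rule norm_blinfun_compose)
qed

end

text \<open>The Hilbert space may be zero, and then \<open>1 = 0\<close>. The unital ring classes
  demand \<open>0 \<noteq> 1\<close>, so the unit is introduced through monoids, and only
  \<open>norm 1 \<le> 1\<close> is available.\<close>

instantiation bop :: (complex_hilbert_space) monoid_mult
begin

lift_definition one_bop :: "'a bop" is id_blinfun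
  by (simp add: bounded_ops_def)

instance
proof
  fix a :: "'a bop"
  show "1 * a = a" by transfer (rule blinfun_eqI, simp)
  show "a * 1 = a" by transfer (rule blinfun_eqI, simp)
qed

end

lift_definition app :: "'h::complex_hilbert_space bop \<Rightarrow> 'h \<Rightarrow> 'h" is blinfun_apply .
lift_definition adj :: "'h::complex_hilbert_space bop \<Rightarrow> 'h bop" is op_adj
  by (rule op_adj_bounded_ops)
lift_definition scal :: "complex \<Rightarrow> 'h::complex_hilbert_space bop" is scalar_op
  by (rule scalar_op_bounded_ops)

lemma app_add [simp]: "app (a + b) x = app a x + app b x"
  by transfer (simp add: blinfun.add_left)
lemma app_diff [simp]: "app (a - b) x = app a x - app b x"
  by transfer (simp add: blinfun.diff_left)
lemma app_minus [simp]: "app (- a) x = - app a x"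
  by transfer (simp add: blinfun.minus_left)
lemma app_zero [simp]: "app 0 x = 0"
  by transfer simp
lemma app_mult [simp]: "app (a * b) x = app a (app b x)"
  by transfer simp
lemma app_one [simp]: "app 1 x = x"
  by transfer simp
lemma app_scal [simp]: "app (scal c) x = scaleC c x"
  by transfer (rule scalar_op_apply)
lemma app_scaleR [simp]: "app (r *\<^sub>R a) x = r *\<^sub>R app a x"
  by transfer (simp add: blinfun.scaleR_left)
lemma app_add_right: "app a (x + y) = app a x + app a y"
  by transfer (simp add: blinfun.add_right)
lemma app_diff_right: "app a (x - y) = app a x - app a y"
  by transfer (simp add: blinfun.diff_right)
lemma app_zero_right [simp]: "app a 0 = 0"
  by transfer simp
lemma app_scaleC_right: "app a (scaleC c x) = scaleC c (app a x)"
  by transfer (rule bounded_ops_scaleC)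
lemma bounded_linear_app: "bounded_linear (app a)"
  by transfer (rule blinfun.bounded_linear_right)
lemma norm_app: "norm (app a x) \<le> norm a * norm x"
  by transfer (rule norm_blinfun)

lemma bop_eqI: "(\<And>x. app a x = app b x) \<Longrightarrow> a = b"
  by transfer (rule blinfun_eqI)

lemma bop_eqI_cinner: "(\<And>x y. cinner (app a x) y = cinner (app b x) y) \<Longrightarrow> a = b"
  by (rule bop_eqI) (rule cinner_ext)

lemma norm_bop_leI: "0 \<le> C \<Longrightarrow> (\<And>x. norm (app a x) \<le> C * norm x) \<Longrightarrow> norm a \<le> C"
  by transfer (rule norm_blinfun_bound)

lemma bop_of_form:
  fixes B :: "'h::complex_hilbert_space \<Rightarrow> 'h \<Rightarrow> complex"
  assumes "\<And>x x' y. B (x + x') y = B x y + B x' y"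
    and "\<And>c x y. B (scaleC c x) y = c * B x y"
    and "\<And>x y y'. B x (y + y') = B x y + B x y'"
    and "\<And>c x y. B x (scaleC c y) = cnj c * B x y"
    and "\<And>x y. cmod (B x y) \<le> C * norm x * norm y"
  shows "\<exists>z. \<forall>x y. B x y = cinner (app z x) y"
proof -
  obtain z where z: "z \<in> bounded_ops" "\<And>x y. B x y = cinner (blinfun_apply z x) y"
    using sesquilinear_form_representation[of B C] assms by blast
  thus ?thesis by (intro exI[of _ "Bop z"]) (simp add: app.rep_eq Bop_inverse)
qed

lemma bop_of_linear:
  fixes F :: "'h::complex_hilbert_space \<Rightarrow> 'h"
  assumes "\<And>x y. F (x + y) = F x + F y" "\<And>c x. F (scaleC c x) = scaleC c (F x)"
    "\<And>x. norm (F x) \<le> C * norm x"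
  shows "\<exists>z. \<forall>x. F x = app z x"
proof -
  have bl: "bounded_linear F"
    by (rule bounded_linear_intro[of _ C]) (use assms in \<open>auto simp: scaleR_scaleC mult.commute\<close>)
  show ?thesis
    by (intro exI[of _ "Bop (Blinfun F)"])
       (simp add: app.rep_eq Bop_inverse bounded_ops_def bounded_linear_Blinfun_apply[OF bl] assms)
qed

lemma cinner_adj: "cinner (app a x) y = cinner x (app (adj a) y)"
  by transfer (rule cinner_op_adj)

lemma adj_eqI: "(\<And>x y. cinner (app a x) y = cinner x (app b y)) \<Longrightarrow> adj a = b"
  by transfer (rule op_adj_eqI)

lemma cinner_adj': "cinner x (app a y) = cinner (app (adj a) x) y"
  by (metis cinner_adj cinner_commute)

lemma adj_adj [simp]: "adj (adj a) = a"
  by (rule adj_eqI) (simp add: cinner_adj')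
lemma adj_mult: "adj (a * b) = adj b * adj a"
  by (rule adj_eqI) (simp add: cinner_adj)
lemma adj_add: "adj (a + b) = adj a + adj b"
  by (rule adj_eqI) (simp add: cinner_adj cinner_simps)
lemma adj_diff: "adj (a - b) = adj a - adj b"
  by (rule adj_eqI) (simp add: cinner_adj cinner_simps)
lemma adj_minus: "adj (- a) = - adj a"
  by (rule adj_eqI) (simp add: cinner_adj cinner_simps)
lemma adj_zero [simp]: "adj 0 = 0"
  by (rule adj_eqI) simp
lemma adj_one [simp]: "adj 1 = 1"
  by (rule adj_eqI) simp
lemma adj_scal [simp]: "adj (scal c) = scal (cnj c)"
  by (rule adj_eqI) (simp add: cinner_simps)
lemma adj_scaleR [simp]: "adj (r *\<^sub>R a) = r *\<^sub>R adj a"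
  by (rule adj_eqI) (simp add: cinner_adj cinner_scaleR_left cinner_scaleR_right)
lemma adj_power: "adj (a ^ n) = adj a ^ n"
  by (induction n) (simp_all add: adj_mult power_commutes)

lemma norm_adj_le: "norm (adj a) \<le> norm a"
proof (rule norm_bop_leI)
  fix x
  have "(norm (app (adj a) x))\<^sup>2 = cmod (cinner (app a (app (adj a) x)) x)"
    by (simp only: cinner_adj cinner_self norm_of_real) simp
  also have "\<dots> \<le> norm (app a (app (adj a) x)) * norm x" by (rule cinner_cauchy_schwarz)
  also have "\<dots> \<le> norm a * norm (app (adj a) x) * norm x"
    by (intro mult_right_mono norm_app) simp
  finally show "norm (app (adj a) x) \<le> norm a * norm x"
    by (cases "norm (app (adj a) x) = 0") (simp_all add: power2_eq_square mult_ac)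
qed simp

lemma norm_adj [simp]: "norm (adj a) = norm a"
  using norm_adj_le[of a] norm_adj_le[of "adj a"] by simp

lemma norm_one_bop_le: "norm (1::'h::complex_hilbert_space bop) \<le> 1"
  by (rule norm_bop_leI) auto

lemma norm_power_bop_le: "norm a \<le> K \<Longrightarrow> norm ((a::'h::complex_hilbert_space bop) ^ n) \<le> K ^ n"
proof (induction n)
  case 0 show ?case by (simp add: norm_one_bop_le)
next
  case (Suc n)
  have "norm (a ^ Suc n) \<le> norm a * norm (a ^ n)" by (simp add: norm_mult_ineq)
  also have "\<dots> \<le> K * K ^ n" using Suc norm_ge_zero[of a] by (intro mult_mono) (auto intro: order_trans[OF norm_ge_zero Suc.prems])
  finally show ?case by simp
qed

lemma scal_commute: "a * scal c = scal c * a"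
  by (rule bop_eqI) (simp add: app_scaleC_right)
lemma scal_mult: "scal c * scal d = scal (c * d)"
  by (rule bop_eqI) (simp add: scaleC_scaleC)
lemma scal_mult_left: "scal c * (scal d * a) = scal (c * d) * a"
  by (simp add: scal_mult flip: mult.assoc)
lemma mult_scal_left: "a * (scal c * b) = scal c * (a * b)"
  by (metis mult.assoc scal_commute)
lemma scal_add: "scal (c + d) = scal c + scal d"
  by (rule bop_eqI) (simp add: scaleC_add_left)
lemma scal_one [simp]: "scal 1 = 1"
  by (rule bop_eqI) (metis app_scal app_one scaleR_scaleC of_real_1 scaleR_one)
lemma scal_of_real: "scal (complex_of_real r) = r *\<^sub>R 1"
  by (rule bop_eqI) (simp add: scaleR_scaleC)
lemma scal_of_real_mult: "scal (complex_of_real r) * a = r *\<^sub>R a"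
  by (simp add: scal_of_real)
lemma scal_zero [simp]: "scal 0 = 0"
  using scal_of_real[of 0] by simp
lemma scal_minus: "scal (- c) = - scal c"
  using scal_add[of c "-c"] by (simp add: eq_neg_iff_add_eq_0 add.commute)
lemma scal_minus_one [simp]: "scal (- 1) = - 1"
  by (simp add: scal_minus)

section \<open>Commutants and bicommutants\<close>

definition bcomm :: "'h::complex_hilbert_space bop set \<Rightarrow> 'h bop set" where
  "bcomm S = {a. \<forall>s\<in>S. a * s = s * a}"

lemma bounded_ops_op_of: "s \<in> bounded_ops \<Longrightarrow> \<exists>t. s = op_of t"
  by (rule exI[of _ "Bop s"]) (simp add: Bop_inverse)

lemma commutant_eq_bcomm:
  assumes "N \<subseteq> bounded_ops"
  shows "commutant N = op_of ` bcomm {a. op_of a \<in> N}"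
proof (intro equalityI subsetI)
  fix a assume a: "a \<in> commutant N"
  hence "a \<in> bounded_ops" unfolding commutant_def by blast
  then obtain b where b: "a = op_of b" using bounded_ops_op_of by blast
  have "b * s = s * b" if "op_of s \<in> N" for s
  proof -
    have "op_of (b * s) = op_of (s * b)"
      using a that unfolding b commutant_def by (simp add: times_bop.rep_eq)
    thus ?thesis by (simp add: op_of_inject)
  qed
  thus "a \<in> op_of ` bcomm {a. op_of a \<in> N}" unfolding bcomm_def b by blast
next
  fix a assume "a \<in> op_of ` bcomm {a. op_of a \<in> N}"
  then obtain b where b: "a = op_of b" "\<And>s. op_of s \<in> N \<Longrightarrow> b * s = s * b"
    unfolding bcomm_def by blast
  have "a o\<^sub>L s = s o\<^sub>L a" if s: "s \<in> N" for s
  proof -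
    obtain t where t: "s = op_of t" using bounded_ops_op_of s assms by blast
    hence "b * t = t * b" using b(2) s by simp
    hence "op_of (b * t) = op_of (t * b)" by simp
    thus ?thesis by (simp add: times_bop.rep_eq b(1) t)
  qed
  thus "a \<in> commutant N" unfolding commutant_def using b(1) op_of by blast
qed

lemma bcomm_bcomm_bcomm: "bcomm (bcomm (bcomm S)) = bcomm S"
proof -
  have sub: "T \<subseteq> bcomm (bcomm T)" for T :: "'a bop set" unfolding bcomm_def by auto
  have anti: "bcomm T \<subseteq> bcomm U" if "U \<subseteq> T" for T U :: "'a bop set"
    using that unfolding bcomm_def by blast
  show ?thesis using sub[of "bcomm S"] anti[OF sub[of S]] by blast
qed

lemma op_of_mem_image: "op_of a \<in> op_of ` S \<longleftrightarrow> a \<in> S"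
  by (auto simp: op_of_inject)

lemma bcomm_adj:
  assumes "\<And>a. a \<in> S \<Longrightarrow> adj a \<in> S" "a \<in> bcomm S"
  shows "adj a \<in> bcomm S"
  unfolding bcomm_def
proof (intro CollectI ballI)
  fix s assume "s \<in> S"
  hence "a * adj s = adj s * a" using assms unfolding bcomm_def by blast
  thus "adj a * s = s * adj a" by (metis adj_mult adj_adj)
qed

text \<open>Since \<open>vn_generated\<close> is an intersection, this places the von Neumann
  algebra generated by a tuple inside the bicommutant of its star polynomials.\<close>

lemma von_neumann_algebra_bcomm:
  fixes S :: "'h::complex_hilbert_space bop set"
  assumes "\<And>a. a \<in> S \<Longrightarrow> adj a \<in> S"
  shows "von_neumann_algebra (op_of ` bcomm (bcomm S))"
proof -
  have sub: "op_of ` T \<subseteq> bounded_ops" for T :: "'h bop set" using op_of by blast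
  have "bcomm (bcomm (bcomm (bcomm S))) = bcomm (bcomm S)" by (simp add: bcomm_bcomm_bcomm)
  moreover have "\<forall>a\<in>op_of ` bcomm (bcomm S). op_adj a \<in> op_of ` bcomm (bcomm S)"
    by (auto simp: op_of_mem_image simp flip: adj.rep_eq intro!: bcomm_adj assms)
  ultimately show ?thesis
    unfolding von_neumann_algebra_def using sub
    by (simp add: commutant_eq_bcomm op_of_mem_image)
qed

lemma vn_algebra_bops:
  fixes M :: "('h::complex_hilbert_space \<Rightarrow>\<^sub>L 'h) set"
  assumes "von_neumann_algebra M"
  defines "B \<equiv> {a. op_of a \<in> M}"
  shows "bcomm (bcomm B) = B" "\<And>a. a \<in> B \<Longrightarrow> adj a \<in> B" "M = op_of ` B" "M \<inter> commutant M = op_of ` (B \<inter> bcomm B)"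
proof -
  have MB: "M \<subseteq> bounded_ops" using assms(1) unfolding von_neumann_algebra_def by blast
  thus eq: "M = op_of ` B" unfolding B_def using bounded_ops_op_of by blast
  have sub: "op_of ` T \<subseteq> bounded_ops" for T :: "'h bop set" using op_of by blast
  have "commutant M = op_of ` bcomm B" using commutant_eq_bcomm[OF MB] unfolding B_def .
  hence "commutant (commutant M) = op_of ` bcomm (bcomm B)"
    using sub by (simp add: commutant_eq_bcomm op_of_mem_image)
  hence "op_of ` bcomm (bcomm B) = op_of ` B" using assms(1) eq unfolding von_neumann_algebra_def by simp
  thus "bcomm (bcomm B) = B" by (metis inj_image_eq_iff inj_onI op_of_inject)
  show "adj a \<in> B" if "a \<in> B" for a
    using that assms(1) unfolding B_def von_neumann_algebra_def by (simp add: adj.rep_eq)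
  show "M \<inter> commutant M = op_of ` (B \<inter> bcomm B)"
    using eq \<open>commutant M = op_of ` bcomm B\<close> by (auto simp: op_of_inject)
qed


section \<open>Square-summable sequences in a Hilbert space\<close>

definition sqsum :: "(nat \<Rightarrow> 'h::real_normed_vector) \<Rightarrow> bool" where
  "sqsum f \<longleftrightarrow> summable (\<lambda>n. (norm (f n))\<^sup>2)"

definition l2norm :: "(nat \<Rightarrow> 'h::real_normed_vector) \<Rightarrow> real" where
  "l2norm f = sqrt (\<Sum>n. (norm (f n))\<^sup>2)"

lemma L2_set_le_l2norm:
  assumes "sqsum f" shows "L2_set (\<lambda>n. norm (f n)) {..<N} \<le> l2norm f"
  unfolding L2_set_def l2norm_def
  using assms by (intro real_sqrt_le_mono sum_le_suminf) (auto simp: sqsum_def)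

lemma sqsum_boundI:
  assumes "\<And>N. L2_set (\<lambda>n. norm (f n)) {..<N} \<le> C"
  shows "sqsum f" "l2norm f \<le> C"
proof -
  have C: "0 \<le> C" using assms[of 0] by (simp add: L2_set_def)
  have b: "(\<Sum>n<N. (norm (f n))\<^sup>2) \<le> C\<^sup>2" for N
    using assms[of N] C unfolding L2_set_def by (simp add: real_sqrt_le_iff real_le_lsqrt sqrt_le_D)
  show s: "sqsum f" unfolding sqsum_def
    by (rule summableI_nonneg_bounded[of _ "C\<^sup>2"]) (use b in auto)
  have "(\<Sum>n. (norm (f n))\<^sup>2) \<le> C\<^sup>2"
    by (rule suminf_le_const) (use s b in \<open>auto simp: sqsum_def\<close>)
  thus "l2norm f \<le> C" unfolding l2norm_def using C by (simp add: real_le_lsqrt)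
qed

lemma sqsum_add:
  assumes "sqsum f" "sqsum g"
  shows "sqsum (\<lambda>n. f n + g n)" "l2norm (\<lambda>n. f n + g n) \<le> l2norm f + l2norm g"
proof -
  have "L2_set (\<lambda>n. norm (f n + g n)) {..<N} \<le> l2norm f + l2norm g" for N
  proof -
    have "L2_set (\<lambda>n. norm (f n + g n)) {..<N} \<le> L2_set (\<lambda>n. norm (f n) + norm (g n)) {..<N}"
      by (rule L2_set_mono) (auto simp: norm_triangle_ineq)
    also have "\<dots> \<le> L2_set (\<lambda>n. norm (f n)) {..<N} + L2_set (\<lambda>n. norm (g n)) {..<N}"
      by (rule L2_set_triangle_ineq)
    also have "\<dots> \<le> l2norm f + l2norm g" using assms by (intro add_mono L2_set_le_l2norm)
    finally show ?thesis .
  qed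
  thus "sqsum (\<lambda>n. f n + g n)" "l2norm (\<lambda>n. f n + g n) \<le> l2norm f + l2norm g"
    by (rule sqsum_boundI)+
qed

lemma sqsum_bounded:
  assumes "sqsum f" "\<And>n. norm (g n) \<le> K * norm (f n)" "0 \<le> K"
  shows "sqsum g" "l2norm g \<le> K * l2norm f"
proof -
  have "L2_set (\<lambda>n. norm (g n)) {..<N} \<le> K * l2norm f" for N
  proof -
    have "L2_set (\<lambda>n. norm (g n)) {..<N} \<le> L2_set (\<lambda>n. K * norm (f n)) {..<N}"
      by (rule L2_set_mono) (use assms in auto)
    also have "\<dots> = K * L2_set (\<lambda>n. norm (f n)) {..<N}" 
      using assms(3) by (rule L2_set_right_distrib[symmetric])
    also have "\<dots> \<le> K * l2norm f" using assms by (intro mult_left_mono L2_set_le_l2norm)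
    finally show ?thesis .
  qed
  thus "sqsum g" "l2norm g \<le> K * l2norm f" by (rule sqsum_boundI)+
qed

lemma sqsum_uminus: "sqsum f \<Longrightarrow> sqsum (\<lambda>n. - f n)"
  by (simp add: sqsum_def)

lemma sqsum_zero: "sqsum (\<lambda>n. 0)"
  by (simp add: sqsum_def)

lemma sqsum_diff: "sqsum f \<Longrightarrow> sqsum g \<Longrightarrow> sqsum (\<lambda>n. f n - g n)"
  using sqsum_add(1)[OF _ sqsum_uminus, of f g] by simp

lemma summable_norm_mult:
  assumes "sqsum f" "sqsum g" shows "summable (\<lambda>n. norm (f n) * norm (g n))"
proof (rule summable_comparison_test)
  show "summable (\<lambda>n. (norm (f n))\<^sup>2 + (norm (g n))\<^sup>2)"
    using assms unfolding sqsum_def by (rule summable_add)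
  have "norm (f n) * norm (g n) \<le> (norm (f n))\<^sup>2 + (norm (g n))\<^sup>2" for n
    using sum_squares_bound[of "norm (f n)" "norm (g n)"] mult_nonneg_nonneg[OF norm_ge_zero norm_ge_zero, of "f n" "g n"]
    by linarith
  thus "\<exists>N. \<forall>n\<ge>N. norm (norm (f n) * norm (g n)) \<le> (norm (f n))\<^sup>2 + (norm (g n))\<^sup>2" by simp
qed

lemma summable_cinner:
  assumes "sqsum f" "sqsum (g::nat \<Rightarrow> 'h::complex_hilbert_space)" shows "summable (\<lambda>n. cinner (f n) (g n))"
  by (rule summable_comparison_test[OF _ summable_norm_mult[OF assms]]) (simp add: cinner_cauchy_schwarz)

text \<open>The tensor product of \<open>'h\<close> with l2(N). An ultraweakly continuous functional
  is a single matrix coefficient of the operator amplified to this space, so normality becomes a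
  statement about vectors.\<close>

typedef (overloaded) 'h ell2 = "{f :: nat \<Rightarrow> 'h::complex_hilbert_space. sqsum f}"
  morphisms nth2 Ell2
  by (rule exI[of _ "\<lambda>n. 0"]) (simp add: sqsum_zero)

setup_lifting type_definition_ell2

lemma sqsum_nth2: "sqsum (nth2 f)" using nth2[of f] by simp

instantiation ell2 :: (complex_hilbert_space) real_normed_vector
begin

lift_definition zero_ell2 :: "'a ell2" is "\<lambda>n. 0" by (rule sqsum_zero)
lift_definition plus_ell2 :: "'a ell2 \<Rightarrow> 'a ell2 \<Rightarrow> 'a ell2" is "\<lambda>f g n. f n + g n" by (rule sqsum_add)
lift_definition uminus_ell2 :: "'a ell2 \<Rightarrow> 'a ell2" is "\<lambda>f n. - f n" by (rule sqsum_uminus)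
lift_definition minus_ell2 :: "'a ell2 \<Rightarrow> 'a ell2 \<Rightarrow> 'a ell2" is "\<lambda>f g n. f n - g n" by (rule sqsum_diff)
lift_definition scaleR_ell2 :: "real \<Rightarrow> 'a ell2 \<Rightarrow> 'a ell2" is "\<lambda>r f n. r *\<^sub>R f n"
  by (rule sqsum_bounded) auto
lift_definition norm_ell2 :: "'a ell2 \<Rightarrow> real" is l2norm .

definition dist_ell2 :: "'a ell2 \<Rightarrow> 'a ell2 \<Rightarrow> real" where "dist_ell2 a b = norm (a - b)"
definition sgn_ell2 :: "'a ell2 \<Rightarrow> 'a ell2" where "sgn_ell2 a = inverse (norm a) *\<^sub>R a"
definition uniformity_ell2 :: "('a ell2 \<times> 'a ell2) filter" where
  "uniformity_ell2 = (INF e\<in>{0<..}. principal {(x, y). dist x y < e})"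
definition open_ell2 :: "'a ell2 set \<Rightarrow> bool" where
  "open_ell2 U \<longleftrightarrow> (\<forall>x\<in>U. eventually (\<lambda>(x', y). x' = x \<longrightarrow> y \<in> U) uniformity)"

instance
proof
  fix a b c :: "'a ell2" and r s :: real
  show "dist a b = norm (a - b)" by (rule dist_ell2_def)
  show "sgn a = inverse (norm a) *\<^sub>R a" by (rule sgn_ell2_def)
  show "(uniformity :: ('a ell2 \<times> 'a ell2) filter) = (INF e\<in>{0<..}. principal {(x, y). dist x y < e})"
    by (rule uniformity_ell2_def)
  show "open U \<longleftrightarrow> (\<forall>x\<in>U. eventually (\<lambda>(x', y). x' = x \<longrightarrow> y \<in> U) uniformity)" for U :: "'a ell2 set"
    by (rule open_ell2_def)
  show "a + b + c = a + (b + c)" by transfer (simp add: add.assoc)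
  show "a + b = b + a" by transfer (simp add: add.commute)
  show "0 + a = a" by transfer simp
  show "- a + a = 0" by transfer simp
  show "a - b = a + - b" by transfer simp
  show "r *\<^sub>R (a + b) = r *\<^sub>R a + r *\<^sub>R b" by transfer (simp add: scaleR_add_right)
  show "(r + s) *\<^sub>R a = r *\<^sub>R a + s *\<^sub>R a" by transfer (simp add: scaleR_add_left)
  show "r *\<^sub>R s *\<^sub>R a = (r * s) *\<^sub>R a" by transfer simp
  show "1 *\<^sub>R a = a" by transfer simp
  show "norm a = 0 \<longleftrightarrow> a = 0"
    by transfer (auto simp: l2norm_def sqsum_def suminf_eq_zero_iff fun_eq_iff)
  show "norm (a + b) \<le> norm a + norm b" by transfer (rule sqsum_add)
  show "norm (r *\<^sub>R a) = \<bar>r\<bar> * norm a"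
    by transfer (simp add: l2norm_def sqsum_def power_mult_distrib suminf_mult real_sqrt_mult)
qed

end

lemma nth2_add [simp]: "nth2 (f + g) n = nth2 f n + nth2 g n" by transfer simp
lemma nth2_diff [simp]: "nth2 (f - g) n = nth2 f n - nth2 g n" by transfer simp
lemma nth2_zero [simp]: "nth2 0 n = 0" by transfer simp
lemma ell2_eqI: "(\<And>n. nth2 f n = nth2 g n) \<Longrightarrow> f = g" by transfer auto

lemma norm_nth2_le: "norm (nth2 f n) \<le> norm f"
proof -
  have "norm (nth2 f n) \<le> L2_set (\<lambda>n. norm (nth2 f n)) {..<Suc n}"
    by (rule member_le_L2_set) auto
  also have "\<dots> \<le> norm f" unfolding norm_ell2.rep_eq by (rule L2_set_le_l2norm[OF sqsum_nth2])
  finally show ?thesis .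
qed

instance ell2 :: (complex_hilbert_space) banach
proof
  fix X :: "nat \<Rightarrow> 'a ell2" assume X: "Cauchy X"
  have "Cauchy (\<lambda>m. nth2 (X m) i)" for i
  proof (rule CauchyI)
    fix e :: real assume "e > 0"
    with X obtain M where M: "\<And>m n. m \<ge> M \<Longrightarrow> n \<ge> M \<Longrightarrow> norm (X m - X n) < e" by (metis CauchyD)
    have "norm (nth2 (X m) i - nth2 (X n) i) < e" if "m \<ge> M" "n \<ge> M" for m n
      using norm_nth2_le[of "X m - X n" i] M[OF that] by simp
    thus "\<exists>M. \<forall>m\<ge>M. \<forall>n\<ge>M. norm (nth2 (X m) i - nth2 (X n) i) < e" by blast
  qed
  hence "\<exists>l. (\<lambda>m. nth2 (X m) i) \<longlonglongrightarrow> l" for i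
    using Cauchy_convergent convergent_def by blast
  then obtain l where l: "\<And>i. (\<lambda>m. nth2 (X m) i) \<longlonglongrightarrow> l i" by metis
  \<comment> \<open>Coordinatewise convergence passes to the limit only in finite partial sums; the
    bound \<open>e\<close> is uniform in \<open>N\<close>.\<close>
  have key: "L2_set (\<lambda>i. norm (nth2 (X m) i - l i)) {..<N} \<le> e"
    if M: "\<And>m n. m \<ge> M \<Longrightarrow> n \<ge> M \<Longrightarrow> norm (X m - X n) < e" and m: "m \<ge> M" for M m N e
  proof (rule LIMSEQ_le_const2)
    show "(\<lambda>n. L2_set (\<lambda>i. norm (nth2 (X m) i - nth2 (X n) i)) {..<N}) \<longlonglongrightarrow>
        L2_set (\<lambda>i. norm (nth2 (X m) i - l i)) {..<N}"
      unfolding L2_set_def by (intro tendsto_intros l)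
    have "L2_set (\<lambda>i. norm (nth2 (X m) i - nth2 (X n) i)) {..<N} \<le> e" if "n \<ge> M" for n
    proof -
      have "L2_set (\<lambda>i. norm (nth2 (X m - X n) i)) {..<N} \<le> norm (X m - X n)"
        unfolding norm_ell2.rep_eq by (rule L2_set_le_l2norm[OF sqsum_nth2])
      thus ?thesis using M[OF m that] by simp
    qed
    thus "\<exists>M. \<forall>n\<ge>M. L2_set (\<lambda>i. norm (nth2 (X m) i - nth2 (X n) i)) {..<N} \<le> e" by blast
  qed
  obtain M1 where M1: "\<And>m n. m \<ge> M1 \<Longrightarrow> n \<ge> M1 \<Longrightarrow> norm (X m - X n) < 1" using CauchyD[OF X, of 1] by auto
  have "sqsum (\<lambda>i. nth2 (X M1) i - l i)"
    by (rule sqsum_boundI(1)) (rule key[OF M1 order_refl])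
  from sqsum_diff[OF sqsum_nth2[of "X M1"] this] have ls: "sqsum l" by simp
  define L where "L = Ell2 l"
  have L: "nth2 L i = l i" for i unfolding L_def using ls by (simp add: Ell2_inverse)
  have "X \<longlonglongrightarrow> L"
  proof (rule LIMSEQ_I)
    fix e :: real assume "e > 0"
    hence "e / 2 > 0" by simp
    with X obtain M where M: "\<And>m n. m \<ge> M \<Longrightarrow> n \<ge> M \<Longrightarrow> norm (X m - X n) < e / 2" by (metis CauchyD)
    have "norm (X m - L) < e" if "m \<ge> M" for m
    proof -
      have "l2norm (\<lambda>i. nth2 (X m) i - l i) \<le> e / 2"
        by (rule sqsum_boundI(2)) (rule key[OF M that])
      moreover have "nth2 (X m - L) = (\<lambda>i. nth2 (X m) i - l i)" by (simp add: fun_eq_iff L)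
      ultimately have "norm (X m - L) \<le> e / 2" by (simp add: norm_ell2.rep_eq)
      thus ?thesis using \<open>e > 0\<close> by simp
    qed
    thus "\<exists>M. \<forall>m\<ge>M. norm (X m - L) < e" by blast
  qed
  thus "convergent X" unfolding convergent_def by blast
qed

instantiation ell2 :: (complex_hilbert_space) complex_hilbert_space
begin

lift_definition scaleC_ell2 :: "complex \<Rightarrow> 'a ell2 \<Rightarrow> 'a ell2" is "\<lambda>c f n. scaleC c (f n)"
  by (rule sqsum_bounded) (auto simp: norm_scaleC)
lift_definition cinner_ell2 :: "'a ell2 \<Rightarrow> 'a ell2 \<Rightarrow> complex" is "\<lambda>f g. \<Sum>n. cinner (f n) (g n)" .

instance
proof
  fix x y z :: "'a ell2" and c d :: complex and r :: real
  show "scaleC c (x + y) = scaleC c x + scaleC c y" by transfer (simp add: scaleC_add_right)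
  show "scaleC (c + d) x = scaleC c x + scaleC d x" by transfer (simp add: scaleC_add_left)
  show "scaleC c (scaleC d x) = scaleC (c * d) x" by transfer (simp add: scaleC_scaleC)
  show "r *\<^sub>R x = scaleC (complex_of_real r) x" by transfer (simp add: scaleR_scaleC)
  show "cinner x y = cnj (cinner y x)"
  proof transfer
    fix x y :: "nat \<Rightarrow> 'a" assume "sqsum x" "sqsum y"
    hence "(\<lambda>n. cinner (y n) (x n)) sums (\<Sum>n. cinner (y n) (x n))"
      by (intro summable_sums summable_cinner)
    hence "(\<lambda>n. cnj (cinner (y n) (x n))) sums cnj (\<Sum>n. cinner (y n) (x n))"
      by (simp add: sums_cnj)
    thus "(\<Sum>n. cinner (x n) (y n)) = cnj (\<Sum>n. cinner (y n) (x n))"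
      by (simp add: cinner_commute[symmetric] sums_iff)
  qed
  show "cinner (x + y) z = cinner x z + cinner y z"
    by transfer (simp add: cinner_add_left suminf_add summable_cinner)
  show "cinner (scaleC c x) y = c * cinner x y"
    by transfer (simp add: cinner_scaleC_left suminf_mult summable_cinner)
  show "norm x = sqrt (Re (cinner x x))"
    by transfer (simp add: Re_suminf summable_cinner Re_cinner_self l2norm_def)
qed

end

lemma nth2_scaleC [simp]: "nth2 (scaleC c f) n = scaleC c (nth2 f n)" by transfer simp

lift_definition inj2 :: "nat \<Rightarrow> 'h::complex_hilbert_space \<Rightarrow> 'h ell2" is
  "\<lambda>n x i. if i = n then x else 0"
  unfolding sqsum_def by (rule summable_finite[of "{_}"]) (auto split: if_splits)

lemma nth2_inj2: "nth2 (inj2 n x) i = (if i = n then x else 0)" by transfer simp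

lemma cinner_inj2: "cinner (inj2 n x) f = cinner x (nth2 f n)"
proof transfer
  fix n x and f :: "nat \<Rightarrow> 'a"
  have "(\<lambda>i. cinner (if i = n then x else 0) (f i)) sums (\<Sum>i\<in>{n}. cinner (if i = n then x else 0) (f i))"
    by (rule sums_finite) auto
  thus "(\<Sum>i. cinner (if i = n then x else 0) (f i)) = cinner x (f n)" by (simp add: sums_iff)
qed

lemma norm_inj2: "norm (inj2 n x) = norm x"
  using cinner_inj2[of n x "inj2 n x"] by (simp add: norm_eq_sqrt_cinner nth2_inj2)

section \<open>Amplified operators and the density half of the bicommutant theorem\<close>

lemma amplification_exists:
  "\<exists>b. \<forall>f n. nth2 (app b f) n = app a (nth2 f n)"
proof -
  define F where "F f = Ell2 (\<lambda>n. app a (nth2 f n))" for f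
  have s: "sqsum (\<lambda>n. app a (nth2 f n))" "l2norm (\<lambda>n. app a (nth2 f n)) \<le> norm a * norm f" for f
    unfolding norm_ell2.rep_eq using sqsum_bounded[OF sqsum_nth2, of "\<lambda>n. app a (nth2 f n)" "norm a" f] norm_app[of a]
    by auto
  have F: "nth2 (F f) n = app a (nth2 f n)" for f n unfolding F_def using s by (simp add: Ell2_inverse)
  have "\<exists>b. \<forall>f. F f = app b f"
  proof (rule bop_of_linear)
    show "F (x + y) = F x + F y" for x y by (rule ell2_eqI) (simp add: F app_add_right)
    show "F (scaleC c x) = scaleC c (F x)" for c x by (rule ell2_eqI) (simp add: F app_scaleC_right)
    have "nth2 (F x) = (\<lambda>n. app a (nth2 x n))" for x by (simp add: fun_eq_iff F)
    thus "norm (F x) \<le> norm a * norm x" for x using s(2)[of x] by (simp add: norm_ell2.rep_eq)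
  qed
  thus ?thesis using F by metis
qed

text \<open>The operator usually written a tensor 1.\<close>

definition amp :: "'h::complex_hilbert_space bop \<Rightarrow> 'h ell2 bop" where
  "amp a = (SOME b. \<forall>f n. nth2 (app b f) n = app a (nth2 f n))"

lemma nth2_amp [simp]: "nth2 (app (amp a) f) n = app a (nth2 f n)"
  using someI_ex[OF amplification_exists[of a]] unfolding amp_def by blast

lemma amp_inj2: "app (amp a) (inj2 n x) = inj2 n (app a x)"
  by (rule ell2_eqI) (simp add: nth2_inj2)

lemma adj_amp: "adj (amp a) = amp (adj a)"
proof (rule bop_eqI_cinner)
  fix f g
  have "app (adj (amp a)) f = app (amp (adj a)) f" for f
  proof (rule ell2_eqI, rule cinner_ext_right)
    fix n x
    show "cinner x (nth2 (app (adj (amp a)) f) n) = cinner x (nth2 (app (amp (adj a)) f) n)"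
      by (simp add: cinner_inj2[symmetric] cinner_adj[symmetric] amp_inj2)
  qed
  thus "cinner (app (adj (amp a)) f) g = cinner (app (amp (adj a)) f) g" by simp
qed

text \<open>Linearity comes from the uniqueness in the last clause. That clause is also how
  \<open>P\<close> is later shown to commute with an operator: a candidate for the value of
  \<open>P\<close> only has to lie in \<open>V\<close> with residual orthogonal to
  \<open>V\<close>.\<close>

lemma projection_exists:
  fixes V :: "'h::complex_hilbert_space set"
  assumes V: "csubspace V" "closed V"
  shows "\<exists>P. (\<forall>x. app P x \<in> V) \<and> (\<forall>x. \<forall>v\<in>V. cinner (x - app P x) v = 0) \<and>
    (\<forall>x y. y \<in> V \<longrightarrow> (\<forall>v\<in>V. cinner (x - y) v = 0) \<longrightarrow> y = app P x)"
proof -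
  obtain F where F: "\<And>x. F x \<in> V" "\<And>x v. v \<in> V \<Longrightarrow> cinner (x - F x) v = 0"
    using orthogonal_projection_exists[OF V] by metis
  have uniq: "y = F x" if "y \<in> V" "\<And>v. v \<in> V \<Longrightarrow> cinner (x - y) v = 0" for x y
  proof -
    have yV: "y - F x \<in> V" using that F V csubspace_diff by blast
    have "cinner (y - F x) (y - F x) = cinner (x - F x) (y - F x) - cinner (x - y) (y - F x)"
      by (simp add: cinner_diff_left)
    also have "\<dots> = 0" using F(2)[OF yV] that(2)[OF yV] by simp
    finally show ?thesis by (simp add: cinner_self)
  qed
  have "\<exists>P. \<forall>x. F x = app P x"
  proof (rule bop_of_linear[of _ 1])
    show "F (x + y) = F x + F y" for x y
    proof (rule uniq[symmetric])
      show "F x + F y \<in> V" using F V unfolding csubspace_def by blast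
      fix v assume "v \<in> V"
      thus "cinner (x + y - (F x + F y)) v = 0" using F(2)[of v x] F(2)[of v y] by (simp add: cinner_simps)
    qed
    show "F (scaleC c x) = scaleC c (F x)" for c x
    proof (rule uniq[symmetric])
      show "scaleC c (F x) \<in> V" using F V unfolding csubspace_def by blast
      fix v assume "v \<in> V"
      thus "cinner (scaleC c x - scaleC c (F x)) v = 0" using F(2)[of v x] by (simp add: cinner_simps)
    qed
    show "norm (F x) \<le> 1 * norm x" for x
    proof -
      have "(norm x)\<^sup>2 = (norm (F x + (x - F x)))\<^sup>2" by simp
      also have "\<dots> = (norm (F x))\<^sup>2 + (norm (x - F x))\<^sup>2"
        unfolding norm_add_sq using F(2)[OF F(1)[of x], of x] by (simp add: Re_cinner_commute[of "F x"])
      finally have "(norm (F x))\<^sup>2 \<le> (norm x)\<^sup>2" by simp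
      thus ?thesis using power2_le_imp_le by fastforce
    qed
  qed
  then obtain P where P: "F x = app P x" for x by blast
  show ?thesis using F uniq unfolding P by blast
qed

definition star_algebra :: "'h::complex_hilbert_space bop set \<Rightarrow> bool" where
  "star_algebra A \<longleftrightarrow> 1 \<in> A \<and> (\<forall>a\<in>A. \<forall>b\<in>A. a + b \<in> A) \<and> (\<forall>a\<in>A. \<forall>b\<in>A. a * b \<in> A) \<and>
     (\<forall>c. \<forall>a\<in>A. scal c * a \<in> A) \<and> (\<forall>a\<in>A. adj a \<in> A)"

text \<open>
  The projection onto the closure of \<open>{(p \<zeta>\<^sub>n)\<^sub>n | p \<in> A}\<close> commutes with the amplification of
  \<open>A\<close>, hence its matrix entries commute with \<open>A\<close> and therefore with the bicommutant.
\<close>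

theorem bicommutant_density:
  fixes A :: "'h::complex_hilbert_space bop set"
  assumes A: "star_algebra A" and u: "u \<in> bcomm (bcomm A)" and e: "e > 0"
  shows "\<exists>p\<in>A. norm (app (amp u) z - app (amp p) z) < e"
proof -
  define V0 where "V0 = {app (amp p) z | p. p \<in> A}"
  define V where "V = closure V0"
  have "csubspace V0"
    unfolding csubspace_def
  proof (intro conjI ballI allI)
    have "scal 0 * 1 \<in> A" using A unfolding star_algebra_def by blast
    hence "app (amp 0) z \<in> V0" unfolding V0_def by auto
    moreover have "app (amp 0) z = 0" by (rule ell2_eqI) simp
    ultimately show "0 \<in> V0" by simp
  next
    fix x y assume "x \<in> V0" "y \<in> V0"
    then obtain p q where pq: "p \<in> A" "q \<in> A" "x = app (amp p) z" "y = app (amp q) z" unfolding V0_def by blast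
    have "x + y = app (amp (p + q)) z" unfolding pq by (rule ell2_eqI) simp
    moreover have "p + q \<in> A" using A pq unfolding star_algebra_def by blast
    ultimately show "x + y \<in> V0" unfolding V0_def by blast
  next
    fix c x assume "x \<in> V0"
    then obtain p where p: "p \<in> A" "x = app (amp p) z" unfolding V0_def by blast
    have "scaleC c x = app (amp (scal c * p)) z" unfolding p by (rule ell2_eqI) simp
    moreover have "scal c * p \<in> A" using A p unfolding star_algebra_def by blast
    ultimately show "scaleC c x \<in> V0" unfolding V0_def by blast
  qed
  hence V: "csubspace V" "closed V" unfolding V_def by (simp_all add: csubspace_closure)
  have inv: "app (amp p) v \<in> V" if "p \<in> A" "v \<in> V" for p v
  proof -
    have "app (amp p) ` V0 \<subseteq> V0"
    proof
      fix w assume "w \<in> app (amp p) ` V0"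
      then obtain q where q: "q \<in> A" "w = app (amp p) (app (amp q) z)" unfolding V0_def by blast
      have "w = app (amp (p * q)) z" unfolding q by (rule ell2_eqI) simp
      thus "w \<in> V0" using A q that unfolding V0_def star_algebra_def by blast
    qed
    moreover have "app (amp p) ` closure V0 \<subseteq> closure (app (amp p) ` V0)"
      by (rule closure_bounded_linear_image_subset[OF bounded_linear_app])
    ultimately show ?thesis using that closure_mono unfolding V_def by blast
  qed
  obtain P where P: "\<And>x. app P x \<in> V" "\<And>x v. v \<in> V \<Longrightarrow> cinner (x - app P x) v = 0"
    "\<And>x y. y \<in> V \<Longrightarrow> (\<And>v. v \<in> V \<Longrightarrow> cinner (x - y) v = 0) \<Longrightarrow> y = app P x"
    using projection_exists[OF V] by metis
  have comm: "app (amp p) (app P x) = app P (app (amp p) x)" if "p \<in> A" for p x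
  proof (rule P(3))
    show "app (amp p) (app P x) \<in> V" by (rule inv[OF that P(1)])
    fix v assume "v \<in> V"
    have "app (amp (adj p)) v \<in> V" using A that \<open>v \<in> V\<close> unfolding star_algebra_def by (blast intro: inv)
    hence "cinner (app (amp p) (x - app P x)) v = 0" by (simp add: cinner_adj adj_amp P(2))
    thus "cinner (app (amp p) x - app (amp p) (app P x)) v = 0" by (simp add: app_diff_right)
  qed
  have entry: "app u (nth2 (app P (inj2 n x)) m) = nth2 (app P (inj2 n (app u x))) m" for m n x
  proof -
    have "\<exists>E. \<forall>x. nth2 (app P (inj2 n x)) m = app E x"
    proof (rule bop_of_linear)
      fix x y :: 'h and c
      have "inj2 n (x + y) = inj2 n x + inj2 n y" "inj2 n (scaleC c x) = scaleC c (inj2 n x)"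
        by (rule ell2_eqI; simp add: nth2_inj2; metis add.right_neutral scaleC_add_right add_cancel_right_right)+
      thus "nth2 (app P (inj2 n (x + y))) m = nth2 (app P (inj2 n x)) m + nth2 (app P (inj2 n y)) m"
        "nth2 (app P (inj2 n (scaleC c x))) m = scaleC c (nth2 (app P (inj2 n x)) m)"
        by (simp_all add: app_add_right app_scaleC_right)
      show "norm (nth2 (app P (inj2 n x)) m) \<le> norm P * norm x"
        using norm_nth2_le[of "app P (inj2 n x)" m] norm_app[of P "inj2 n x"] by (simp add: norm_inj2)
    qed
    then obtain E where E: "nth2 (app P (inj2 n x)) m = app E x" for x by blast
    have "E * p = p * E" if "p \<in> A" for p
    proof (rule bop_eqI)
      fix x
      have "app E (app p x) = nth2 (app P (app (amp p) (inj2 n x))) m" by (simp add: E[symmetric] amp_inj2)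
      also have "\<dots> = app p (app E x)" by (simp add: comm[OF that, symmetric] E)
      finally show "app (E * p) x = app (p * E) x" by simp
    qed
    hence "E \<in> bcomm A" unfolding bcomm_def by blast
    hence "u * E = E * u" using u unfolding bcomm_def by blast
    thus ?thesis unfolding E by (metis app_mult)
  qed
  define D where "D = amp u * P - P * amp u"
  have D: "app D (inj2 n x) = 0" for n x
    unfolding D_def by (rule ell2_eqI) (simp add: entry amp_inj2)
  \<comment> \<open>Passing to the adjoint turns the vanishing of \<open>D\<close> on the vectors
    \<open>inj2 n x\<close> into the vanishing of every coordinate, in place of a density
    argument.\<close>
  have "app (adj D) g = 0" for g
  proof (rule ell2_eqI, rule cinner_ext_right)
    fix n x show "cinner x (nth2 (app (adj D) g) n) = cinner x (nth2 0 n)"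
      by (simp add: cinner_inj2[symmetric] cinner_adj[symmetric] D)
  qed
  hence "adj D = 0" by (intro bop_eqI) simp
  hence "D = 0" by (metis adj_adj adj_zero)
  hence uP: "app (amp u) (app P z) = app P (app (amp u) z)" unfolding D_def by (metis app_mult right_minus_eq)
  \<comment> \<open>As \<open>1 \<in> A\<close>, the vector \<open>z\<close> lies in
    \<open>V\<close> and is fixed by \<open>P\<close>. Hence u z = u P z = P u z lies in
    \<open>V\<close> as well.\<close>
  have "app (amp 1) z = z" by (rule ell2_eqI) simp
  hence "z \<in> V0" using A unfolding V0_def star_algebra_def by (metis (mono_tags, lifting) mem_Collect_eq)
  hence "z \<in> V" unfolding V_def using closure_subset by blast
  hence "z = app P z" by (intro P(3)) simp_all
  hence "app (amp u) z \<in> V" using uP P(1) by metis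
  then obtain w where "w \<in> V0" "dist w (app (amp u) z) < e"
    unfolding V_def closure_approachable using e by blast
  thus ?thesis unfolding V0_def by (auto simp: dist_norm norm_minus_commute)
qed


section \<open>Tracial algebras\<close>

text \<open>Positivity of the form at \<open>x - t *\<^sub>R app y x\<close> bounds a quadratic
  polynomial in \<open>t\<close> from below by 0; \<open>t = 1 / k\<close> minimises its upper
  estimate.\<close>

lemma positive_operator_norm_le:
  assumes adj: "adj y = y" and k: "k > 0"
    and nonneg: "\<And>x. 0 \<le> Re (cinner (app y x) x)" and le: "\<And>x. Re (cinner (app y x) x) \<le> k * (norm x)\<^sup>2"
  shows "norm y \<le> k"
proof (rule norm_bop_leI)
  fix x
  define w where "w = app y x"
  define s where "s = (norm w)\<^sup>2"
  have s: "Re (cinner (app y x) w) = s" "Re (cinner (app y w) x) = s"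
    unfolding s_def w_def by (simp_all add: Re_cinner_self) (metis Re_cinner_self adj cinner_adj)
  define t where "t = 1 / k"
  have t0: "0 \<le> t" unfolding t_def using k by simp
  have "0 \<le> Re (cinner (app y (x - t *\<^sub>R w)) (x - t *\<^sub>R w))" by (rule nonneg)
  also have "\<dots> = Re (cinner (app y x) x) - 2 * t * s + t\<^sup>2 * Re (cinner (app y w) w)"
    by (simp add: app_diff_right linear_scale[OF bounded_linear.linear[OF bounded_linear_app]]
      cinner_simps cinner_scaleR_left cinner_scaleR_right s power2_eq_square algebra_simps)
  also have "\<dots> \<le> k * (norm x)\<^sup>2 - 2 * t * s + t\<^sup>2 * (k * s)"
    using le[of x] le[of w] t0 unfolding s_def by (intro add_mono diff_mono mult_left_mono) auto
  also have "\<dots> = k * (norm x)\<^sup>2 - s / k"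
    using k unfolding t_def by (simp add: field_simps power2_eq_square)
  finally have "s \<le> (k * norm x)\<^sup>2" using k by (simp add: field_simps power2_eq_square)
  thus "norm (app y x) \<le> k * norm x"
    unfolding s_def w_def using k power2_le_imp_le by (metis less_imp_le mult_nonneg_nonneg norm_ge_zero)
qed (use k in simp)

lemma power_telescope:
  fixes y :: "'h::complex_hilbert_space bop"
  shows "(\<Sum>i<n. y ^ i) * (1 - y) = 1 - y ^ n"
  by (induction n) (simp_all add: distrib_right, simp add: right_diff_distrib power_commutes)

text \<open>Under 2^j-th roots the constant \<open>K\<close> disappears as \<open>j\<close> grows.
  Exponents 2^j are those produced by the repeated squaring in \<open>n2_mult_le\<close>.\<close>

lemma power_double_exp_bound:
  fixes x y :: real
  assumes "0 \<le> x" "0 \<le> y" "\<And>j. x ^ (2 ^ j) \<le> K * y ^ (2 ^ j)"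
  shows "x \<le> y"
proof (rule ccontr)
  assume "\<not> x \<le> y" hence xy: "y < x" by simp
  show False
  proof (cases "y = 0")
    case True thus False using assms(3)[of 0] xy by simp
  next
    case False
    hence y: "y > 0" using assms by simp
    obtain n where n: "K < (x / y) ^ n" using real_arch_pow[of "x / y" K] xy y by auto
    have "(x / y) ^ n \<le> (x / y) ^ (2 ^ n)"
      using xy y by (intro power_increasing) (auto simp: less_imp_le)
    also have "\<dots> \<le> K" using assms(3)[of n] y by (simp add: power_divide field_simps)
    finally show False using n by simp
  qed
qed

lemma ell2_dense:
  assumes V: "csubspace V" "closed V" and inj: "\<And>n x. inj2 n x \<in> V"
  shows "y \<in> V"
proof -
  obtain w where w: "w \<in> V" "\<And>v. v \<in> V \<Longrightarrow> cinner (y - w) v = 0"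
    using orthogonal_projection_exists[OF V] by metis
  have "cinner (inj2 n x) (y - w) = 0" for n x using w(2)[OF inj] by (metis cinner_commute complex_cnj_zero)
  hence "y - w = 0" by (intro ell2_eqI cinner_ext_right) (simp add: cinner_inj2)
  thus ?thesis using w by simp
qed

lemma norm_amp_le: "norm (amp a) \<le> norm a"
proof (rule norm_bop_leI)
  fix f
  have "l2norm (nth2 (app (amp a) f)) \<le> norm a * l2norm (nth2 f)"
    by (rule sqsum_bounded[OF sqsum_nth2]) (simp_all add: norm_app)
  thus "norm (app (amp a) f) \<le> norm a * norm f" by (simp add: norm_ell2.rep_eq)
qed simp

lemma amp_diff: "amp (a - b) = amp a - amp b"
  by (rule bop_eqI, rule ell2_eqI) simp
lemma amp_mult: "amp (a * b) = amp a * amp b"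
  by (rule bop_eqI, rule ell2_eqI) simp

lemma sum_interleave:
  fixes f :: "nat \<Rightarrow> real"
  shows "(\<Sum>n<2*N. if even n then f (n div 2) else g (n div 2)) = (\<Sum>n<N. f n + g n)"
  by (induction N) (simp_all add: lessThan_Suc)

text \<open>Interleaving coordinates embeds two copies of \<open>ell2\<close> into one, compatibly
  with \<open>amp a\<close>. So \<open>bicommutant_density\<close>, which approximates at one
  vector, serves finitely many.\<close>

lemma ell2_merge:
  fixes x y :: "'h::complex_hilbert_space ell2"
  shows "\<exists>z. \<forall>a. norm (app (amp a) x) \<le> norm (app (amp a) z) \<and> norm (app (amp a) y) \<le> norm (app (amp a) z)"
proof -
  define h where "h = (\<lambda>n. if even n then nth2 x (n div 2) else nth2 y (n div 2))"
  have h: "(\<Sum>n<2*N. F (h n)) = (\<Sum>n<N. F (nth2 x n) + F (nth2 y n))" for N and F :: "'h \<Rightarrow> real"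
    unfolding sum_interleave[symmetric] h_def by (intro sum.cong) auto
  have hs: "sqsum h"
    unfolding sqsum_def
  proof (rule summableI_nonneg_bounded)
    fix N
    have "(\<Sum>n<N. (norm (h n))\<^sup>2) \<le> (\<Sum>n<2*N. (norm (h n))\<^sup>2)" by (intro sum_mono2) auto
    also have "\<dots> = (\<Sum>n<N. (norm (nth2 x n))\<^sup>2) + (\<Sum>n<N. (norm (nth2 y n))\<^sup>2)"
      unfolding h[of "\<lambda>v. (norm v)\<^sup>2"] by (rule sum.distrib)
    also have "\<dots> \<le> (\<Sum>n. (norm (nth2 x n))\<^sup>2) + (\<Sum>n. (norm (nth2 y n))\<^sup>2)"
      using sqsum_nth2[of x] sqsum_nth2[of y] unfolding sqsum_def by (intro add_mono sum_le_suminf) auto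
    finally show "(\<Sum>n<N. (norm (h n))\<^sup>2) \<le> \<dots>" .
  qed auto
  define z where "z = Ell2 h"
  have z: "nth2 z = h" unfolding z_def using hs by (simp add: Ell2_inverse)
  have "norm (app (amp a) x) \<le> norm (app (amp a) z) \<and> norm (app (amp a) y) \<le> norm (app (amp a) z)" for a
  proof -
    have "L2_set (\<lambda>n. norm (nth2 (app (amp a) v) n)) {..<N} \<le> norm (app (amp a) z)" if "v = x \<or> v = y" for N v
    proof -
      have "L2_set (\<lambda>n. norm (nth2 (app (amp a) v) n)) {..<N} \<le> L2_set (\<lambda>n. norm (nth2 (app (amp a) z) n)) {..<2*N}"
        unfolding L2_set_def nth2_amp z h[of "\<lambda>v. (norm (app a v))\<^sup>2"]
        by (intro real_sqrt_le_mono sum_mono) (use that in auto)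
      also have "\<dots> \<le> norm (app (amp a) z)"
        unfolding norm_ell2.rep_eq by (rule L2_set_le_l2norm[OF sqsum_nth2])
      finally show ?thesis .
    qed
    thus ?thesis by (auto simp: norm_ell2.rep_eq intro!: sqsum_boundI(2))
  qed
  thus ?thesis by blast
qed

lemma ell2_merge_list:
  "\<exists>z. \<forall>a. \<forall>x\<in>set xs. norm (app (amp a) x) \<le> norm (app (amp a) z)"
proof (induction xs)
  case (Cons x xs)
  then obtain z where z: "\<forall>a. \<forall>x\<in>set xs. norm (app (amp a) x) \<le> norm (app (amp a) z)" by blast
  obtain z' where z': "\<forall>a. norm (app (amp a) x) \<le> norm (app (amp a) z') \<and> norm (app (amp a) z) \<le> norm (app (amp a) z')"
    using ell2_merge[of x z] by blast
  show ?case by (rule exI[of _ z']) (use z z' in \<open>auto intro: order_trans\<close>)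
qed simp

lemma adj_scal_mult: "adj (scal c * a) = scal (cnj c) * adj a"
  by (rule bop_eqI) (simp add: adj_mult app_scaleC_right)

text \<open>\<open>tr_normal\<close> is ultraweak continuity at 0: \<open>L\<close> lists the pairs
  of vectors whose coefficients of \<open>amp a\<close> describe a basic neighbourhood. The factor
  condition and property \<Gamma> enter as hypotheses of the results that use them.\<close>

locale tracial_algebra =
  fixes M :: "'h::complex_hilbert_space bop set" and tr :: "'h bop \<Rightarrow> complex"
  assumes star: "star_algebra M" and bicommutant: "bcomm (bcomm M) = M"
    and tr_add: "a \<in> M \<Longrightarrow> b \<in> M \<Longrightarrow> tr (a + b) = tr a + tr b"
    and tr_scal: "a \<in> M \<Longrightarrow> tr (scal c * a) = c * tr a"
    and tr_pos: "a \<in> M \<Longrightarrow> Im (tr (adj a * a)) = 0 \<and> 0 \<le> Re (tr (adj a * a))"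
    and tr_one: "tr 1 = 1"
    and tr_commute: "a \<in> M \<Longrightarrow> b \<in> M \<Longrightarrow> tr (a * b) = tr (b * a)"
    and tr_faithful: "a \<in> M \<Longrightarrow> tr (adj a * a) = 0 \<Longrightarrow> a = 0"
    and tr_normal: "e > 0 \<Longrightarrow> \<exists>L d. d > 0 \<and>
      (\<forall>a\<in>M. (\<forall>(x, y)\<in>set L. cmod (cinner (app (amp a) x) y) < d) \<longrightarrow> cmod (tr a) < e)"
begin

section \<open>The trace and the 2-norm\<close>

lemma one_M [simp, intro]: "1 \<in> M" using star unfolding star_algebra_def by blast
lemma add_M [simp, intro]: "a \<in> M \<Longrightarrow> b \<in> M \<Longrightarrow> a + b \<in> M" using star unfolding star_algebra_def by blast
lemma mult_M [simp, intro]: "a \<in> M \<Longrightarrow> b \<in> M \<Longrightarrow> a * b \<in> M" using star unfolding star_algebra_def by blast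
lemma scal_mult_M [simp, intro]: "a \<in> M \<Longrightarrow> scal c * a \<in> M" using star unfolding star_algebra_def by blast
lemma adj_M [simp, intro]: "a \<in> M \<Longrightarrow> adj a \<in> M" using star unfolding star_algebra_def by blast
lemma scal_M [simp, intro]: "scal c \<in> M" using scal_mult_M[OF one_M] by simp
lemma zero_M [simp, intro]: "0 \<in> M" using scal_M[of 0] by simp
lemma minus_M [simp, intro]: "a \<in> M \<Longrightarrow> - a \<in> M" using scal_mult_M[of a "-1"] by simp
lemma diff_M [simp, intro]: "a \<in> M \<Longrightarrow> b \<in> M \<Longrightarrow> a - b \<in> M" using add_M[of a "-b"] by simp
lemma scaleR_M [simp, intro]: "a \<in> M \<Longrightarrow> r *\<^sub>R a \<in> M" using scal_mult_M[of a "complex_of_real r"] by (simp add: scal_of_real_mult)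
lemma power_M [simp, intro]: "a \<in> M \<Longrightarrow> a ^ n \<in> M" by (induction n) auto
lemma sum_M [simp, intro]: "(\<And>i. i \<in> I \<Longrightarrow> f i \<in> M) \<Longrightarrow> sum f I \<in> M"
  by (induction I rule: infinite_finite_induct) auto

lemma tr_zero [simp]: "tr 0 = 0" using tr_scal[OF one_M, of 0] by simp
lemma tr_minus: "a \<in> M \<Longrightarrow> tr (- a) = - tr a" using tr_scal[of a "-1"] by simp
lemma tr_diff: "a \<in> M \<Longrightarrow> b \<in> M \<Longrightarrow> tr (a - b) = tr a - tr b"
  using tr_add[of a "-b"] by (simp add: tr_minus)
lemma tr_scaleR: "a \<in> M \<Longrightarrow> tr (r *\<^sub>R a) = complex_of_real r * tr a"
  using tr_scal[of a "complex_of_real r"] by (simp add: scal_of_real_mult)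
lemma tr_sum: "(\<And>i. i \<in> I \<Longrightarrow> f i \<in> M) \<Longrightarrow> tr (sum f I) = (\<Sum>i\<in>I. tr (f i))"
  by (induction I rule: infinite_finite_induct) (auto simp: tr_add)

definition n2 :: "'h bop \<Rightarrow> real" where "n2 a = sqrt (Re (tr (adj a * a)))"

lemma n2_nonneg [simp]: "a \<in> M \<Longrightarrow> 0 \<le> n2 a" unfolding n2_def using tr_pos by simp

lemma tr_adj_self: "a \<in> M \<Longrightarrow> tr (adj a * a) = complex_of_real ((n2 a)\<^sup>2)"
  unfolding n2_def using tr_pos[of a] by (simp add: complex_eq_iff)

lemma n2_eq_0: "a \<in> M \<Longrightarrow> n2 a = 0 \<Longrightarrow> a = 0"
  using tr_faithful[of a] tr_adj_self[of a] by simp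

text \<open>Polarization with the positive elements \<open>(1 + a)\<^sup>*(1 + a)\<close> and \<open>(1 + ia)\<^sup>*(1 + ia)\<close>.\<close>

lemma tr_adj: assumes a: "a \<in> M" shows "tr (adj a) = cnj (tr a)"
proof -
  have sq: "tr (adj (1 + b) * (1 + b)) = 1 + tr b + tr (adj b) + tr (adj b * b)" if "b \<in> M" for b
    using that by (simp add: adj_add distrib_left distrib_right tr_add tr_one)
  have im: "Im (tr b) + Im (tr (adj b)) = 0" if "b \<in> M" for b
    using arg_cong[OF sq[OF that], of Im] tr_pos[of b] tr_pos[of "1 + b"] that by simp
  have "Re (tr a) - Re (tr (adj a)) = 0"
    using im[of "scal \<i> * a"] a by (simp add: adj_scal_mult tr_scal)
  thus ?thesis using im[OF a] by (simp add: complex_eq_iff)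
qed

lemma n2_adj [simp]: "a \<in> M \<Longrightarrow> n2 (adj a) = n2 a"
  unfolding n2_def by (simp add: tr_commute)

lemma n2_scal: assumes "a \<in> M" shows "n2 (scal c * a) = cmod c * n2 a"
proof -
  have "adj (scal c * a) * (scal c * a) = scal (cnj c * c) * (adj a * a)"
    by (rule bop_eqI) (simp add: adj_mult app_scaleC_right scaleC_scaleC mult.commute)
  hence "tr (adj (scal c * a) * (scal c * a)) = complex_of_real ((cmod c)\<^sup>2 * (n2 a)\<^sup>2)"
    using assms tr_adj_self[OF assms] complex_norm_square[of c] by (simp add: tr_scal mult.commute)
  thus ?thesis unfolding n2_def[of "scal c * a"] using assms by (simp add: real_sqrt_mult)
qed

lemma n2_scaleR: "a \<in> M \<Longrightarrow> n2 (r *\<^sub>R a) = \<bar>r\<bar> * n2 a"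
  using n2_scal[of a "complex_of_real r"] by (simp add: scal_of_real_mult)

lemma n2_minus [simp]: "n2 (- a) = n2 a" unfolding n2_def by (simp add: adj_minus)

lemma n2_diff_commute: "n2 (a - b) = n2 (b - a)"
  using n2_minus[of "a - b"] by simp

lemma n2_one: "n2 1 = 1" unfolding n2_def by (simp add: tr_one)

lemma n2_zero [simp]: "n2 0 = 0" unfolding n2_def by simp

lemma n2_add_sq:
  assumes "a \<in> M" "b \<in> M"
  shows "(n2 (a + b))\<^sup>2 = (n2 a)\<^sup>2 + 2 * Re (tr (adj b * a)) + (n2 b)\<^sup>2"
proof -
  have "complex_of_real ((n2 (a + b))\<^sup>2) = tr (adj a * a) + tr (adj b * a) + tr (adj a * b) + tr (adj b * b)"
    unfolding tr_adj_self[OF add_M[OF assms], symmetric]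
    using assms by (simp add: adj_add distrib_left distrib_right tr_add)
  moreover have "Re (tr (adj a * b)) = Re (tr (adj b * a))"
    using tr_adj[of "adj b * a"] assms by (simp add: adj_mult)
  ultimately show ?thesis
    using assms by (simp add: tr_adj_self complex_eq_iff)
qed

lemma tr_cauchy_schwarz:
  assumes a: "a \<in> M" and b: "b \<in> M"
  shows "cmod (tr (adj b * a)) \<le> n2 b * n2 a"
proof (cases "n2 b = 0")
  case True thus ?thesis using n2_eq_0[OF b] by simp
next
  case False
  define t where "t = tr (adj b * a)"
  define c where "c = t / complex_of_real ((n2 b)\<^sup>2)"
  have "0 \<le> (n2 (a + scal (- c) * b))\<^sup>2" by simp
  also have "\<dots> = (n2 a)\<^sup>2 + 2 * Re (- (cnj c * t)) + (cmod c * n2 b)\<^sup>2"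
    using a b by (simp add: n2_add_sq n2_scal adj_scal_mult t_def mult.assoc tr_scal)
  also have "cnj c * t = complex_of_real ((cmod t)\<^sup>2 / (n2 b)\<^sup>2)"
    unfolding c_def using complex_norm_square[of t] by (simp add: mult.commute)
  also have "(cmod c * n2 b)\<^sup>2 = (cmod t)\<^sup>2 / (n2 b)\<^sup>2"
    unfolding c_def using False
    by (simp add: norm_divide power_mult_distrib power_divide norm_power norm_mult field_simps power2_eq_square)
  finally have "(cmod t)\<^sup>2 / (n2 b)\<^sup>2 \<le> (n2 a)\<^sup>2" by simp
  hence "(cmod t)\<^sup>2 \<le> (n2 b * n2 a)\<^sup>2"
    using False by (simp add: field_simps power_mult_distrib)
  thus ?thesis unfolding t_def by (rule power2_le_imp_le) (use a b in simp)
qed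

lemma tr_mult_le: "a \<in> M \<Longrightarrow> b \<in> M \<Longrightarrow> cmod (tr (a * b)) \<le> n2 a * n2 b"
  using tr_cauchy_schwarz[of b "adj a"] by simp

lemma tr_le_n2: "a \<in> M \<Longrightarrow> cmod (tr a) \<le> n2 a"
  using tr_mult_le[of 1 a] by (simp add: n2_one)

lemma n2_triangle: assumes "a \<in> M" "b \<in> M" shows "n2 (a + b) \<le> n2 a + n2 b"
proof -
  have "Re (tr (adj b * a)) \<le> n2 b * n2 a"
    using tr_cauchy_schwarz[OF assms] complex_Re_le_cmod order_trans by blast
  hence "(n2 (a + b))\<^sup>2 \<le> (n2 a + n2 b)\<^sup>2"
    unfolding n2_add_sq[OF assms] by (simp add: power2_sum mult.commute)
  thus ?thesis by (rule power2_le_imp_le) (use assms in simp)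
qed

lemma n2_triangle_diff: "a \<in> M \<Longrightarrow> b \<in> M \<Longrightarrow> n2 (a - b) \<le> n2 a + n2 b"
  using n2_triangle[of a "-b"] by simp

text \<open>A suitable real multiple of \<open>a\<close> has all the coefficients listed in
  \<open>tr_normal\<close> below \<open>d\<close>. The resulting constant depends on that list; the
  doubling in \<open>n2_mult_le\<close> removes it.\<close>

lemma tr_bounded: "\<exists>C\<ge>0. \<forall>a\<in>M. cmod (tr a) \<le> C * norm a"
proof -
  obtain L d where d: "d > 0" and L: "\<And>a. a \<in> M \<Longrightarrow> (\<forall>(x, y)\<in>set L. cmod (cinner (app (amp a) x) y) < d) \<Longrightarrow> cmod (tr a) < 1"
    using tr_normal[of 1] by auto
  define S where "S = 1 + (\<Sum>(x, y)\<leftarrow>L. norm x * norm y)"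
  have S: "norm x * norm y < S" if "(x, y) \<in> set L" for x y
  proof -
    have "norm x * norm y \<le> (\<Sum>(x, y)\<leftarrow>L. norm x * norm y)"
      using that by (intro member_le_sum_list) force+
    thus ?thesis unfolding S_def by simp
  qed
  have S0: "S > 0" unfolding S_def by (intro add_pos_nonneg sum_list_nonneg) auto
  have "cmod (tr a) \<le> (S / d) * norm a" if a: "a \<in> M" for a
  proof (cases "norm a = 0")
    case False
    define b where "b = (d / (S * norm a)) *\<^sub>R a"
    have nb: "norm b = d / S" unfolding b_def using False d S0 by simp
    have "cmod (tr b) < 1"
    proof (rule L)
      show "b \<in> M" unfolding b_def using a by simp
      show "\<forall>(x, y)\<in>set L. cmod (cinner (app (amp b) x) y) < d"
      proof clarify
        fix x y assume xy: "(x, y) \<in> set L"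
        have "cmod (cinner (app (amp b) x) y) \<le> norm (app (amp b) x) * norm y" by (rule cinner_cauchy_schwarz)
        also have "\<dots> \<le> (norm b * norm x) * norm y"
          using order_trans[OF norm_app mult_right_mono[OF norm_amp_le]] by (intro mult_right_mono) auto
        also have "\<dots> = (d / S) * (norm x * norm y)" by (simp add: nb)
        also have "\<dots> < (d / S) * S" using S[OF xy] d S0 by (intro mult_strict_left_mono) auto
        finally show "cmod (cinner (app (amp b) x) y) < d" using S0 by simp
      qed
    qed
    moreover have "cmod (tr b) = d / (S * norm a) * cmod (tr a)"
      unfolding b_def using a d S0 by (simp add: tr_scaleR norm_mult norm_divide)
    ultimately show ?thesis using d S0 False by (simp add: field_simps)
  qed simp
  thus ?thesis using d S0 by (intro exI[of _ "S / d"]) auto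
qed

text \<open>
  Iterating the Cauchy-Schwarz inequality avoids the square root of \<open>\<parallel>b\<parallel>\<^sup>2 - b\<^sup>*b\<close> that is
  used in the textbook proof.
\<close>

lemma n2_mult_le:
  assumes a: "a \<in> M" and b: "b \<in> M"
  shows "n2 (b * a) \<le> norm b * n2 a"
proof (cases "n2 a = 0")
  case True thus ?thesis using n2_eq_0[OF a] by simp
next
  case False
  define T where "T = adj b * b"
  have T: "T \<in> M" "adj T = T" unfolding T_def using b by (simp_all add: adj_mult)
  \<comment> \<open>The moment of order 2^j of \<open>T\<close> in the vector \<open>a\<close>.
    After normalisation Cauchy-Schwarz gives h(j)^2 \<le> h(j+1), hence h(0)^(2^j) \<le> h(j), while
    by \<open>tr_bounded\<close> h(j) is at most a constant times (norm T)^(2^j).\<close>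
  define g where "g j = Re (tr (adj a * (T ^ (2 ^ j) * a)))" for j :: nat
  have g0: "g 0 = (n2 (b * a))\<^sup>2"
    unfolding g_def using tr_adj_self[of "b * a"] a b by (simp add: T_def adj_mult mult.assoc)
  have gS: "g (Suc j) = (n2 (T ^ (2 ^ j) * a))\<^sup>2" for j
    unfolding g_def using tr_adj_self[of "T ^ (2 ^ j) * a"] a T
    by (simp add: adj_mult adj_power mult.assoc power_add[symmetric] mult_2 flip: mult.assoc[of "T ^ (2^j)"])
  have gpos: "0 \<le> g j" for j by (cases j) (simp_all add: g0 gS)
  define h where "h j = g j / (n2 a)\<^sup>2" for j
  have step: "(h j)\<^sup>2 \<le> h (Suc j)" for j
  proof -
    have "g j \<le> cmod (tr (adj a * (T ^ (2 ^ j) * a)))" unfolding g_def by (rule complex_Re_le_cmod)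
    also have "\<dots> \<le> n2 a * n2 (T ^ (2 ^ j) * a)" using a T by (intro tr_cauchy_schwarz) auto
    finally have "(g j)\<^sup>2 \<le> (n2 a)\<^sup>2 * g (Suc j)"
      unfolding gS power_mult_distrib[symmetric] using gpos by (intro power_mono)
    hence "(g j)\<^sup>2 / ((n2 a)\<^sup>2 * (n2 a)\<^sup>2) \<le> (n2 a)\<^sup>2 * g (Suc j) / ((n2 a)\<^sup>2 * (n2 a)\<^sup>2)"
      by (intro divide_right_mono) auto
    thus ?thesis unfolding h_def using False by (simp add: power_divide power2_eq_square)
  qed
  have pow: "(h 0) ^ (2 ^ j) \<le> h j" for j
  proof (induction j)
    case (Suc j)
    have "(h 0) ^ (2 ^ Suc j) = ((h 0) ^ (2 ^ j))\<^sup>2" by (simp add: power_mult[symmetric] mult.commute)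
    also have "\<dots> \<le> (h j)\<^sup>2" using Suc gpos by (intro power_mono) (auto simp: h_def)
    also have "\<dots> \<le> h (Suc j)" by (rule step)
    finally show ?case .
  qed simp
  obtain C where C: "C \<ge> 0" "\<And>x. x \<in> M \<Longrightarrow> cmod (tr x) \<le> C * norm x" using tr_bounded by blast
  have bound: "(h 0) ^ (2 ^ j) \<le> (C * (norm a)\<^sup>2 / (n2 a)\<^sup>2) * norm T ^ (2 ^ j)" for j
  proof -
    have "g j \<le> cmod (tr (adj a * (T ^ (2 ^ j) * a)))" unfolding g_def by (rule complex_Re_le_cmod)
    also have "\<dots> \<le> C * norm (adj a * (T ^ (2 ^ j) * a))" using a T by (intro C) auto
    also have "norm (adj a * (T ^ (2 ^ j) * a)) \<le> norm (adj a) * norm (T ^ (2 ^ j) * a)" by (rule norm_mult_ineq)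
    also have "norm (T ^ (2 ^ j) * a) \<le> norm (T ^ (2 ^ j)) * norm a" by (rule norm_mult_ineq)
    also have "norm (T ^ (2 ^ j)) \<le> norm T ^ (2 ^ j)" by (rule norm_power_bop_le) simp
    finally have "g j \<le> C * (norm a * (norm T ^ (2 ^ j) * norm a))"
      using C(1) by (simp add: mult_left_mono mult_right_mono)
    hence "h j \<le> C * (norm a * (norm T ^ (2 ^ j) * norm a)) / (n2 a)\<^sup>2"
      unfolding h_def by (intro divide_right_mono) auto
    thus ?thesis using pow[of j] by (simp add: power2_eq_square mult_ac)
  qed
  have "h 0 \<le> norm T" by (rule power_double_exp_bound[OF _ _ bound]) (auto simp: h_def gpos)
  also have "\<dots> \<le> norm b * norm b" unfolding T_def using norm_mult_ineq[of "adj b" b] by simp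
  finally have "(n2 (b * a))\<^sup>2 \<le> (norm b * n2 a)\<^sup>2"
    unfolding h_def g0 using False n2_nonneg[OF a] by (simp add: pos_divide_le_eq power_mult_distrib power2_eq_square mult_ac)
  thus ?thesis by (rule power2_le_imp_le) (use a in simp)
qed

lemma n2_mult_le': "a \<in> M \<Longrightarrow> b \<in> M \<Longrightarrow> n2 (a * b) \<le> n2 a * norm b"
  using n2_mult_le[of "adj a" "adj b"] n2_adj[of "a * b"] by (simp add: adj_mult mult.commute)

lemma n2_le_norm: "a \<in> M \<Longrightarrow> n2 a \<le> norm a"
  using n2_mult_le[of 1 a] by (simp add: n2_one)

text \<open>By normality \<open>tr (adj b * b)\<close> is small once finitely many coefficients of
  \<open>amp (adj b * b)\<close> are. These are inner products of \<open>app (amp b) x\<close> and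
  \<open>app (amp b) y\<close>, all dominated by one merged vector, at which
  \<open>bicommutant_density\<close> applies.\<close>

lemma n2_density:
  assumes A: "star_algebra A" "A \<subseteq> M" "M \<subseteq> bcomm (bcomm A)" and u: "u \<in> M" and e: "e > 0"
  shows "\<exists>p\<in>A. n2 (p - u) < e"
proof -
  obtain L d where d: "d > 0" and L: "\<And>a. a \<in> M \<Longrightarrow> (\<forall>(x, y)\<in>set L. cmod (cinner (app (amp a) x) y) < d) \<Longrightarrow> cmod (tr a) < e\<^sup>2"
    using tr_normal[of "e\<^sup>2"] e by auto
  obtain z where z: "\<forall>a. \<forall>x\<in>set (map fst L @ map snd L). norm (app (amp a) x) \<le> norm (app (amp a) z)"
    using ell2_merge_list by blast
  obtain p where p: "p \<in> A" "norm (app (amp u) z - app (amp p) z) < sqrt d"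
    using bicommutant_density[OF A(1), of u "sqrt d" z] A u d by auto
  define b where "b = p - u"
  have b: "b \<in> M" unfolding b_def using p A u by auto
  have bz: "norm (app (amp b) z) < sqrt d" using p unfolding b_def by (simp add: amp_diff norm_minus_commute)
  have "cmod (tr (adj b * b)) < e\<^sup>2"
  proof (rule L)
    show "\<forall>(x, y)\<in>set L. cmod (cinner (app (amp (adj b * b)) x) y) < d"
    proof clarify
      fix x y assume xy: "(x, y) \<in> set L"
      have "cinner (app (amp (adj b * b)) x) y = cinner (app (amp b) x) (app (amp b) y)"
        by (simp add: amp_mult adj_amp[symmetric] cinner_adj)
      hence "cmod (cinner (app (amp (adj b * b)) x) y) \<le> norm (app (amp b) x) * norm (app (amp b) y)"
        by (simp add: cinner_cauchy_schwarz)
      also have "\<dots> \<le> norm (app (amp b) z) * norm (app (amp b) z)"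
        using z xy by (intro mult_mono) force+
      also have "\<dots> < sqrt d * sqrt d" using bz by (intro mult_strict_mono') auto
      finally show "cmod (cinner (app (amp (adj b * b)) x) y) < d" using d by simp
    qed
  qed (use b in simp)
  hence "(n2 b)\<^sup>2 < e\<^sup>2" using tr_adj_self[OF b] by (simp add: norm_power)
  hence "n2 b < e" using e by (simp add: power_less_imp_less_base)
  thus ?thesis using p unfolding b_def by blast
qed

end


context tracial_algebra
begin

section \<open>Approximation of unitaries with a uniform norm bound, and weak limits of almost
  central elements\<close>

lemma unitary_norm_le: "adj u * u = 1 \<Longrightarrow> norm u \<le> 1"
proof (rule norm_bop_leI)
  fix x assume u: "adj u * u = 1"
  have "(norm (app u x))\<^sup>2 = Re (cinner (app (adj u * u) x) x)"
    by (simp add: Re_cinner_self[symmetric]) (metis cinner_adj adj_adj)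
  thus "norm (app u x) \<le> 1 * norm x" by (simp add: u Re_cinner_self)
qed simp

text \<open>
  For a unitary \<open>u\<close> and \<open>p\<close> close to \<open>u\<close> in the 2-norm, \<open>2 p (1 + p\<^sup>*p)\<^sup>-\<^sup>1\<close> is bounded and
  still close to \<open>u\<close>, because \<open>t \<mapsto> 2t/(1 + t\<^sup>2)\<close> fixes 1. The inverse is replaced by a partial
  sum of its Neumann series, which stays in the algebra.
\<close>

lemma unitary_density:
  assumes A: "star_algebra A" "A \<subseteq> M" "M \<subseteq> bcomm (bcomm A)"
    and u: "u \<in> M" "adj u * u = 1" "u * adj u = 1" and e: "e > 0"
  shows "\<exists>r\<in>A. norm r \<le> 4 \<and> n2 (r - u) < e"
proof -
  obtain p where p: "p \<in> A" "n2 (p - u) < e / 8"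
    using n2_density[OF A u(1), of "e / 8"] e by auto
  have pM: "p \<in> M" using p A by blast
  \<comment> \<open>This \<open>c\<close> puts \<open>y\<close> between 0 and \<open>k < 1\<close>,
    so the inverse of \<open>1 + adj p * p\<close> is 1/c times the sum of all powers of
    \<open>y\<close>. For the partial sum \<open>q\<close> the product with
    \<open>1 + adj p * p\<close> is \<open>1 - y ^ n\<close>.\<close>
  define c where "c = 2 + (norm p)\<^sup>2"
  have c: "c \<ge> 2" unfolding c_def by simp
  define k where "k = 1 - 1 / c"
  have k: "0 < k" "k < 1" unfolding k_def using c by (simp_all add: field_simps)
  define y where "y = 1 - (1 / c) *\<^sub>R (1 + adj p * p)"
  have cl: "1 \<in> A" "\<And>a b. a \<in> A \<Longrightarrow> b \<in> A \<Longrightarrow> a + b \<in> A" "\<And>a b. a \<in> A \<Longrightarrow> b \<in> A \<Longrightarrow> a * b \<in> A"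
    "\<And>a. a \<in> A \<Longrightarrow> adj a \<in> A" "\<And>a s. a \<in> A \<Longrightarrow> scal s * a \<in> A"
    using A unfolding star_algebra_def by blast+
  have clR: "r *\<^sub>R a \<in> A" if "a \<in> A" for r a
    using cl(5)[OF that, of "complex_of_real r"] by (simp add: scal_of_real_mult)
  have yA: "y \<in> A"
    using cl(2)[OF cl(1) clR[OF cl(2)[OF cl(1) cl(3)[OF cl(4)[OF p(1)] p(1)]], of "- (1 / c)"]]
    unfolding y_def by simp
  have ya: "adj y = y" unfolding y_def by (simp add: adj_diff adj_add adj_mult)
  have yform: "Re (cinner (app y x) x) = k * (norm x)\<^sup>2 - (norm (app p x))\<^sup>2 / c" for x
  proof -
    have "cinner (app (adj p) (app p x)) x = complex_of_real ((norm (app p x))\<^sup>2)"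
      by (metis cinner_adj adj_adj cinner_self)
    thus ?thesis unfolding y_def k_def
      by (simp add: cinner_simps cinner_scaleR_left cinner_self algebra_simps)
  qed
  have px: "(norm (app p x))\<^sup>2 \<le> (c - 2) * (norm x)\<^sup>2" for x
    using power_mono[OF norm_app[of p x], of 2] unfolding c_def by (simp add: power_mult_distrib)
  have ny: "norm y \<le> k"
  proof (rule positive_operator_norm_le[OF ya k(1)])
    fix x
    show "Re (cinner (app y x) x) \<le> k * (norm x)\<^sup>2" unfolding yform using c by simp
    have "(norm (app p x))\<^sup>2 / c \<le> (c - 2) * (norm x)\<^sup>2 / c" using px c by (intro divide_right_mono) auto
    also have "\<dots> \<le> k * (norm x)\<^sup>2" unfolding k_def using c by (simp add: field_simps)
    finally show "0 \<le> Re (cinner (app y x) x)" unfolding yform by simp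
  qed
  obtain n where n: "k ^ n < e / 2" using real_arch_pow_inv[of "e / 2" k] e k by auto
  define q where "q = (1 / c) *\<^sub>R (\<Sum>i<n. y ^ i)"
  have powA: "y ^ i \<in> A" for i by (induction i) (use cl yA in auto)
  have zA: "0 \<in> A" using clR[OF cl(1), of 0] by simp
  have qA: "q \<in> A" unfolding q_def
  proof (rule clR)
    show "(\<Sum>i<n. y ^ i) \<in> A" by (induction n) (use zA cl powA in auto)
  qed
  hence qM: "q \<in> M" and yM: "y \<in> M" using A yA by blast+
  have cy: "1 + adj p * p = c *\<^sub>R (1 - y)" unfolding y_def using c by simp
  have q1: "q * (1 + adj p * p) = 1 - y ^ n"
    unfolding q_def cy using c power_telescope[of y n] by simp
  have "y * (\<Sum>i<n. y ^ i) = (\<Sum>i<n. y ^ i) * y"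
    by (simp add: sum_distrib_left sum_distrib_right power_commutes)
  hence yq: "y * q = q * y" unfolding q_def by simp
  have q2: "(1 + adj p * p) * q = 1 - y ^ n"
  proof -
    have "(1 + adj p * p) * q = q * (1 + adj p * p)" unfolding cy by (simp add: algebra_simps yq)
    thus ?thesis using q1 by simp
  qed
  have nyn: "norm (y ^ n) \<le> k ^ n" by (rule norm_power_bop_le[OF ny])
  have kn: "k ^ n \<le> 1" using k by (simp add: power_le_one)
  \<comment> \<open>With v = q x, pairing \<open>app (1 + adj p * p) v\<close> with \<open>v\<close>
    gives |v|^2 + |p v|^2 \<le> 2 |x| |v|. The resulting bounds are free of the norm of
    \<open>p\<close>, which is the point of the construction.\<close>
  have key: "norm (app q x) \<le> 2 * norm x \<and> norm (app p (app q x)) \<le> 2 * norm x" for x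
  proof -
    define v where "v = app q x"
    have "(norm v)\<^sup>2 + (norm (app p v))\<^sup>2 = Re (cinner (app (1 + adj p * p) v) v)"
      by (simp add: cinner_simps Re_cinner_self[symmetric]) (metis cinner_adj adj_adj)
    also have "app (1 + adj p * p) v = app (1 - y ^ n) x"
      unfolding v_def q2[symmetric] by simp
    also have "Re (cinner (app (1 - y ^ n) x) v) \<le> norm (app (1 - y ^ n) x) * norm v"
      using cinner_cauchy_schwarz complex_Re_le_cmod order_trans by blast
    also have "norm (app (1 - y ^ n) x) \<le> 2 * norm x"
    proof -
      have "norm (app (1 - y ^ n) x) \<le> norm x + norm (app (y ^ n) x)" by (simp add: norm_triangle_ineq4)
      also have "norm (app (y ^ n) x) \<le> 1 * norm x"
        using order_trans[OF norm_app mult_right_mono[OF order_trans[OF nyn kn]]] by simp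
      finally show ?thesis by simp
    qed
    finally have *: "(norm v)\<^sup>2 + (norm (app p v))\<^sup>2 \<le> 2 * norm x * norm v" by (simp add: mult_right_mono)
    hence "norm v * norm v \<le> (2 * norm x) * norm v"
      using zero_le_power2[of "norm (app p v)"] unfolding power2_eq_square by linarith
    hence v: "norm v \<le> 2 * norm x" by (cases "norm v = 0") auto
    have "(norm (app p v))\<^sup>2 \<le> 2 * norm x * norm v" using * by (smt (verit) zero_le_power2)
    also have "\<dots> \<le> 2 * norm x * (2 * norm x)" using v by (intro mult_left_mono) auto
    finally have "(norm (app p v))\<^sup>2 \<le> (2 * norm x)\<^sup>2" by (simp add: power2_eq_square)
    hence "norm (app p v) \<le> 2 * norm x" by (rule power2_le_imp_le) simp
    with v show ?thesis unfolding v_def by simp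
  qed
  have nq: "norm q \<le> 2" by (rule norm_bop_leI) (use key in auto)
  have npq: "norm (p * q) \<le> 2" by (rule norm_bop_leI) (use key in auto)
  have nu: "norm u \<le> 1" by (rule unitary_norm_le[OF u(2)])
  define r where "r = 2 *\<^sub>R (p * q)"
  have rA: "r \<in> A" unfolding r_def using clR cl p qA by blast
  have rn: "norm r \<le> 4" unfolding r_def using npq by simp
  define f where "f = p - u"
  have fM: "f \<in> M" unfolding f_def using pM u by simp
  have nf: "n2 f < e / 8" unfolding f_def using p by simp
  \<comment> \<open>Since \<open>u * adj u = 1\<close>, the error is linear in
    \<open>f = p - u\<close>, with factors \<open>q\<close> and \<open>p * q\<close> of norm at most
    2. It is at most 4 times \<open>n2 f\<close> plus k^n, and each of the two is below e/2.\<close>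
  have "r - u = r - u * (1 - y ^ n) - u * y ^ n" by (simp add: right_diff_distrib)
  also have "r - u * (1 - y ^ n) = (2 *\<^sub>R p - u - u * adj p * p) * q"
    unfolding r_def q2[symmetric] by (simp add: algebra_simps)
  also have "2 *\<^sub>R p - u - u * adj p * p = f - u * adj f * p"
  proof -
    have "u * adj f * p = u * adj p * p - (u * adj u) * p"
      unfolding f_def by (simp add: adj_diff algebra_simps)
    thus ?thesis unfolding u f_def by (simp add: scaleR_2)
  qed
  finally have eq: "r - u = f * q - u * adj f * (p * q) - u * y ^ n"
    by (simp add: algebra_simps)
  have "n2 (r - u) \<le> n2 (f * q - u * adj f * (p * q)) + n2 (u * y ^ n)"
    unfolding eq using fM qM pM u yM by (intro n2_triangle_diff) auto
  also have "n2 (f * q - u * adj f * (p * q)) \<le> n2 (f * q) + n2 (u * adj f * (p * q))"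
    using fM qM pM u yM by (intro n2_triangle_diff) auto
  also have "n2 (f * q) \<le> n2 f * 2"
    using order_trans[OF n2_mult_le'[OF fM qM] mult_left_mono[OF nq]] fM by simp
  also have "n2 (u * adj f * (p * q)) \<le> n2 f * 2"
  proof -
    have "n2 (u * adj f * (p * q)) \<le> n2 (u * adj f) * norm (p * q)"
      using fM qM pM u by (intro n2_mult_le') auto
    also have "\<dots> \<le> (norm u * n2 (adj f)) * norm (p * q)"
      using fM u by (intro mult_right_mono n2_mult_le) auto
    also have "\<dots> \<le> (1 * n2 f) * 2"
      using fM nu npq by (intro mult_mono) auto
    finally show ?thesis by simp
  qed
  also have "n2 (u * y ^ n) \<le> norm u * n2 (y ^ n)" using u yM by (intro n2_mult_le) auto
  also have "\<dots> \<le> 1 * k ^ n"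
    using nu yM order_trans[OF n2_le_norm[of "y ^ n"] nyn] by (intro mult_mono) auto
  finally have "n2 (r - u) \<le> n2 f * 2 + n2 f * 2 + k ^ n" by simp
  hence "n2 (r - u) < e" using nf n by simp
  thus ?thesis using rA rn by blast
qed

subsection \<open>Almost central elements\<close>

text \<open>On the unit ball, convergence of the coefficients on \<open>'h\<close> implies
  convergence of the amplified ones: the vectors \<open>y\<close> for which it holds form a closed
  subspace of \<open>ell2\<close>, by boundedness, and it contains every \<open>inj2 n v\<close>.
  Then \<open>tr_normal\<close> applies.\<close>

lemma weak_limit_tr:
  assumes G: "G \<noteq> bot" and bd: "eventually (\<lambda>z. z \<in> M \<and> norm z \<le> 1) G"
    and lim: "\<And>x y. ((\<lambda>z. cinner (app z x) y) \<longlongrightarrow> cinner (app z0 x) y) G"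
    and z0: "z0 \<in> M" and b: "b \<in> M"
  shows "((\<lambda>z. tr (b * z)) \<longlongrightarrow> tr (b * z0)) G"
proof -
  have weak: "((\<lambda>z. cinner (app (amp (z - z0)) x) y) \<longlongrightarrow> 0) G" for x y
  proof -
    define W where "W = {y. ((\<lambda>z. cinner (app (amp (z - z0)) x) y) \<longlongrightarrow> 0) G}"
    define K where "K = (1 + norm z0) * norm x + 1"
    have K: "K > 0" unfolding K_def by (simp add: add_nonneg_pos)
    have "y \<in> W"
    proof (rule ell2_dense)
      show "csubspace W"
        unfolding csubspace_def W_def
      proof (intro conjI ballI allI; clarsimp)
        fix y y' assume "((\<lambda>z. cinner (app (amp (z - z0)) x) y) \<longlongrightarrow> 0) G" "((\<lambda>z. cinner (app (amp (z - z0)) x) y') \<longlongrightarrow> 0) G"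
        from tendsto_add[OF this]
        show "((\<lambda>z. cinner (app (amp (z - z0)) x) (y + y')) \<longlongrightarrow> 0) G" by (simp add: cinner_add_right)
      next
        fix c y assume "((\<lambda>z. cinner (app (amp (z - z0)) x) y) \<longlongrightarrow> 0) G"
        from tendsto_mult_right_zero[OF this, of "cnj c"]
        show "((\<lambda>z. cinner (app (amp (z - z0)) x) (scaleC c y)) \<longlongrightarrow> 0) G" by (simp add: cinner_scaleC_right mult.commute)
      qed
      show "closed W"
        unfolding closed_sequential_limits
      proof (intro allI impI, elim conjE)
        fix f y assume f: "\<forall>n. f n \<in> W" "f \<longlonglongrightarrow> y"
        show "y \<in> W" unfolding W_def
        proof (intro CollectI tendstoI)
          fix e :: real assume e: "e > 0"
          obtain n where n: "norm (f n - y) < e / (2 * K)"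
            using LIMSEQ_D[OF f(2), of "e / (2 * K)"] e K by auto
          have "eventually (\<lambda>z. dist (cinner (app (amp (z - z0)) x) (f n)) 0 < e / 2) G"
            using f(1) e unfolding W_def by (auto dest!: tendstoD[of _ _ _ "e / 2"] spec[of _ n])
          thus "eventually (\<lambda>z. dist (cinner (app (amp (z - z0)) x) y) 0 < e) G"
            using bd
          proof eventually_elim
            case (elim z)
            have "norm (app (amp (z - z0)) x) \<le> norm (z - z0) * norm x"
              using order_trans[OF norm_app mult_right_mono[OF norm_amp_le]] by simp
            also have "\<dots> \<le> K" unfolding K_def
              using elim norm_triangle_ineq4[of z z0] mult_right_mono[of "norm (z - z0)" "1 + norm z0" "norm x"] by simp
            finally have "cmod (cinner (app (amp (z - z0)) x) (y - f n)) \<le> K * norm (y - f n)"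
              by (intro order_trans[OF cinner_cauchy_schwarz] mult_right_mono) auto
            also have "\<dots> < K * (e / (2 * K))" using n K by (intro mult_strict_left_mono) (auto simp: norm_minus_commute)
            finally have "cmod (cinner (app (amp (z - z0)) x) (y - f n)) < e / 2" using K by simp
            moreover have "cmod (cinner (app (amp (z - z0)) x) y) \<le>
                cmod (cinner (app (amp (z - z0)) x) (y - f n)) + cmod (cinner (app (amp (z - z0)) x) (f n))"
              using norm_triangle_ineq[of "cinner (app (amp (z - z0)) x) (y - f n)" "cinner (app (amp (z - z0)) x) (f n)"]
              by (simp add: cinner_add_right[symmetric])
            ultimately show ?case using elim by simp
          qed
        qed
      qed
      show "inj2 n v \<in> W" for n v
      proof -
        have "cinner (app (amp (z - z0)) x) (inj2 n v) = cinner (app z (nth2 x n)) v - cinner (app z0 (nth2 x n)) v" for z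
        proof -
          have "cinner (inj2 n v) (app (amp (z - z0)) x) = cinner v (app (z - z0) (nth2 x n))" by (simp only: cinner_inj2 nth2_amp)
          hence "cinner (app (amp (z - z0)) x) (inj2 n v) = cinner (app (z - z0) (nth2 x n)) v" by (metis cinner_commute)
          thus ?thesis by (simp add: cinner_simps)
        qed
        thus ?thesis unfolding W_def using LIM_zero[OF lim[of "nth2 x n" v]] by simp
      qed
    qed
    thus ?thesis unfolding W_def by simp
  qed
  have "((\<lambda>z. tr (b * (z - z0))) \<longlongrightarrow> 0) G"
  proof (rule tendstoI)
    fix e :: real assume "e > 0"
    from tr_normal[OF this] obtain L d where d: "d > 0"
      and L: "\<And>a. a \<in> M \<Longrightarrow> (\<forall>(x, y)\<in>set L. cmod (cinner (app (amp a) x) y) < d) \<Longrightarrow> cmod (tr a) < e"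
      by auto
    have "eventually (\<lambda>z. \<forall>w\<in>set L. cmod (cinner (app (amp (b * (z - z0))) (fst w)) (snd w)) < d) G"
    proof (rule eventually_ball_finite)
      show "\<forall>w\<in>set L. eventually (\<lambda>z. cmod (cinner (app (amp (b * (z - z0))) (fst w)) (snd w)) < d) G"
      proof
        fix w
        have "eventually (\<lambda>z. dist (cinner (app (amp (z - z0)) (fst w)) (app (amp (adj b)) (snd w))) 0 < d) G"
          by (rule tendstoD[OF weak d])
        thus "eventually (\<lambda>z. cmod (cinner (app (amp (b * (z - z0))) (fst w)) (snd w)) < d) G"
          by (simp add: amp_mult adj_amp[symmetric] cinner_adj)
      qed
    qed simp
    thus "eventually (\<lambda>z. dist (tr (b * (z - z0))) 0 < e) G"
      using bd
    proof eventually_elim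
      case (elim z)
      have "cmod (tr (b * (z - z0))) < e" by (rule L) (use elim b z0 in auto)
      thus ?case by simp
    qed
  qed
  moreover have "eventually (\<lambda>z. tr (b * (z - z0)) = tr (b * z) - tr (b * z0)) G"
    using bd by eventually_elim (use b z0 in \<open>simp add: right_diff_distrib tr_diff\<close>)
  ultimately have "((\<lambda>z. tr (b * z) - tr (b * z0)) \<longlongrightarrow> 0) G"
    by (rule Lim_transform_eventually)
  thus ?thesis by (rule LIM_zero_cancel)
qed

text \<open>
  The unit ball is compact in the weak operator topology (Tychonoff), so a filter of elements
  that asymptotically commute with everything has a weak limit point, which is central.
\<close>

theorem almost_central_independent:
  assumes factor: "M \<inter> bcomm M = range scal" and y: "y \<in> M" and e: "e > 0"
  shows "\<exists>X d. finite X \<and> X \<subseteq> M \<and> d > 0 \<and>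
    (\<forall>z\<in>M. norm z \<le> 1 \<longrightarrow> (\<forall>x\<in>X. n2 (z * x - x * z) < d) \<longrightarrow> cmod (tr (y * z) - tr y * tr z) < e)"
proof (rule ccontr)
  assume neg: "\<not> ?thesis"
  \<comment> \<open>\<open>Z (X, d)\<close> collects the counterexamples that commute with
    \<open>X\<close> up to \<open>d\<close>. Enlarging \<open>X\<close> and shrinking
    \<open>d\<close> makes it smaller, so these nonempty sets generate a proper filter.\<close>
  define Z where "Z = (\<lambda>(X, d). {z \<in> M. norm z \<le> 1 \<and> (\<forall>x\<in>X. n2 (z * x - x * z) < d) \<and> e \<le> cmod (tr (y * z) - tr y * tr z)})"
  define I where "I = {X. finite X \<and> X \<subseteq> M} \<times> {0::real<..}"
  have Z_ne: "Z i \<noteq> {}" if "i \<in> I" for i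
  proof -
    obtain X d where i: "i = (X, d)" "finite X" "X \<subseteq> M" "d > 0" using \<open>i \<in> I\<close> unfolding I_def by auto
    hence "\<not> (\<forall>z\<in>M. norm z \<le> 1 \<longrightarrow> (\<forall>x\<in>X. n2 (z * x - x * z) < d) \<longrightarrow> cmod (tr (y * z) - tr y * tr z) < e)"
      using neg by blast
    then obtain z where "z \<in> M" "norm z \<le> 1" "\<forall>x\<in>X. n2 (z * x - x * z) < d" "e \<le> cmod (tr (y * z) - tr y * tr z)"
      by (metis not_less)
    hence "z \<in> Z i" unfolding Z_def i by simp
    thus ?thesis by blast
  qed
  define F where "F = (INF i\<in>I. principal (Z i))"
  have evF: "eventually P F \<longleftrightarrow> (\<exists>i\<in>I. \<forall>z\<in>Z i. P z)" for P
    unfolding F_def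
  proof (subst eventually_INF_base)
    show "I \<noteq> {}" unfolding I_def by (auto intro: exI[of _ 1])
    fix a b assume "a \<in> I" "b \<in> I"
    hence "(fst a \<union> fst b, min (snd a) (snd b)) \<in> I" unfolding I_def by auto
    moreover have "Z (fst a \<union> fst b, min (snd a) (snd b)) \<subseteq> Z a \<inter> Z b"
      unfolding Z_def by (auto split: prod.splits)
    ultimately show "\<exists>x\<in>I. principal (Z x) \<le> inf (principal (Z a)) (principal (Z b))" by auto
  qed (simp add: eventually_principal)
  have F: "F \<noteq> bot" using Z_ne evF[of "\<lambda>_. False"] by (auto simp: trivial_limit_def)
  \<comment> \<open>An operator is recorded by its matrix coefficients, as a point in a product of
    discs.\<close>
  define g :: "'h bop \<Rightarrow> ('h \<times> 'h) \<Rightarrow> complex" where "g z = (\<lambda>(x, y). cinner (app z x) y)" for z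
  define K :: "(('h \<times> 'h) \<Rightarrow> complex) set" where "K = PiE UNIV (\<lambda>(x, y). cball 0 (norm x * norm y))"
  have "compactin (product_topology (\<lambda>i. euclidean) UNIV) K"
    unfolding K_def compactin_PiE by auto
  hence K: "compact K" by (simp add: euclidean_product_topology compactin_euclidean_iff)
  have gK: "g z \<in> K" if "norm z \<le> 1" for z
  proof -
    have "cmod (cinner (app z x) y) \<le> norm x * norm y" for x y
      using order_trans[OF norm_app mult_right_mono[OF that norm_ge_zero]]
      by (intro order_trans[OF cinner_cauchy_schwarz] mult_right_mono) auto
    thus ?thesis unfolding K_def g_def by auto
  qed
  have i1: "({}, 1) \<in> I" unfolding I_def by simp
  have evM: "eventually (\<lambda>z. z \<in> M \<and> norm z \<le> 1) F"
    unfolding evF by (rule bexI[OF _ i1]) (auto simp: Z_def)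
  have "eventually (\<lambda>w. w \<in> K) (filtermap g F)"
    unfolding eventually_filtermap using evM by eventually_elim (simp add: gK)
  then obtain B where B: "inf (nhds B) (filtermap g F) \<noteq> bot"
    using K F unfolding compact_filter by (metis filtermap_bot_iff)
  \<comment> \<open>\<open>B\<close> is only a cluster point of \<open>g\<close> along
    \<open>F\<close>; along the finer filter \<open>G\<close> the coefficients converge to
    it.\<close>
  define G where "G = inf F (filtercomap g (nhds B))"
  have G: "G \<noteq> bot"
  proof
    assume "G = bot"
    hence "eventually (\<lambda>_. False) G" by simp
    then obtain P Q where PQ: "eventually P F" "eventually Q (filtercomap g (nhds B))" "\<And>z. P z \<Longrightarrow> Q z \<Longrightarrow> False"
      unfolding G_def eventually_inf by blast
    obtain R where R: "eventually R (nhds B)" "\<And>z. R (g z) \<Longrightarrow> Q z"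
      using PQ(2) unfolding eventually_filtercomap by blast
    have "eventually (\<lambda>w. \<not> R w) (filtermap g F)"
      unfolding eventually_filtermap using PQ(1) by eventually_elim (use PQ R in blast)
    with R(1) have "eventually (\<lambda>_. False) (inf (nhds B) (filtermap g F))"
      unfolding eventually_inf by blast
    thus False using B by (simp add: trivial_limit_def)
  qed
  have GF: "G \<le> F" unfolding G_def by simp
  have evG: "eventually P G" if "eventually P F" for P using that GF by (metis filter_leD)
  have "filterlim g (nhds B) G"
    unfolding G_def filterlim_def
    by (rule order_trans[OF filtermap_mono[OF inf_le2] filtermap_filtercomap])
  hence "((\<lambda>z. g z i) \<longlongrightarrow> B i) G" for i
    using continuous_on_tendsto_compose[OF continuous_on_product_coordinates[of i], of g B G] by simp
  from this[of "(_, _)"] have lim: "((\<lambda>z. cinner (app z x) v) \<longlongrightarrow> B (x, v)) G" for x v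
    unfolding g_def by simp
  note uniq = tendsto_unique[OF G]
  have "\<exists>z0. \<forall>x v. B (x, v) = cinner (app z0 x) v"
  proof (rule bop_of_form[of "\<lambda>x v. B (x, v)" 1])
    fix x x' v v' c
    show "B (x + x', v) = B (x, v) + B (x', v)"
      by (rule uniq[OF lim]) (use tendsto_add[OF lim[of x v] lim[of x' v]] in \<open>simp add: app_add_right cinner_simps\<close>)
    show "B (x, v + v') = B (x, v) + B (x, v')"
      by (rule uniq[OF lim]) (use tendsto_add[OF lim[of x v] lim[of x v']] in \<open>simp add: cinner_simps\<close>)
    show "B (scaleC c x, v) = c * B (x, v)"
      by (rule uniq[OF lim]) (use tendsto_mult_left[OF lim[of x v], of c] in \<open>simp add: app_scaleC_right cinner_simps\<close>)
    show "B (x, scaleC c v) = cnj c * B (x, v)"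
      by (rule uniq[OF lim]) (use tendsto_mult_left[OF lim[of x v], of "cnj c"] in \<open>simp add: cinner_simps\<close>)
    have "eventually (\<lambda>z. cmod (cinner (app z x) v) \<le> norm x * norm v) G"
      using evG[OF evM] by eventually_elim (use gK in \<open>auto simp: K_def g_def PiE_def Pi_def\<close>)
    thus "cmod (B (x, v)) \<le> 1 * norm x * norm v"
      using tendsto_upperbound[OF tendsto_norm[OF lim] _ G] by simp
  qed
  then obtain z0 where z0: "B (x, v) = cinner (app z0 x) v" for x v by blast
  note lim = lim[unfolded z0]
  \<comment> \<open>Every \<open>z\<close> in the filter commutes with the commutant of
    \<open>M\<close>, and this survives the weak limit.\<close>
  have "z0 \<in> bcomm (bcomm M)"
    unfolding bcomm_def
  proof (intro CollectI ballI)
    fix c assume "c \<in> {a. \<forall>s\<in>M. a * s = s * a}"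
    hence c: "\<And>z. z \<in> M \<Longrightarrow> c * z = z * c" by blast
    show "z0 * c = c * z0"
    proof (rule bop_eqI_cinner)
      fix x v
      have "((\<lambda>z. cinner (app z (app c x)) v) \<longlongrightarrow> cinner (app z0 x) (app (adj c) v)) G"
      proof (rule Lim_transform_eventually[OF lim])
        show "eventually (\<lambda>z. cinner (app z x) (app (adj c) v) = cinner (app z (app c x)) v) G"
          using evG[OF evM]
        proof eventually_elim
          case (elim z)
          hence "app z (app c x) = app c (app z x)" using c by (metis app_mult)
          thus ?case by (simp add: cinner_adj)
        qed
      qed
      from uniq[OF lim this] show "cinner (app (z0 * c) x) v = cinner (app (c * z0) x) v"
        by (simp add: cinner_adj)
    qed
  qed
  hence z0M: "z0 \<in> M" using bicommutant by simp
  have trlim: "((\<lambda>z. tr (b * z)) \<longlongrightarrow> tr (b * z0)) G" if "b \<in> M" for b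
    by (rule weak_limit_tr[OF G evG[OF evM] lim z0M that])
  have "z0 * x = x * z0" if x: "x \<in> M" for x
  proof -
    define b where "b = adj (z0 * x - x * z0)"
    have b: "b \<in> M" unfolding b_def using x z0M by auto
    \<comment> \<open>The trace property frees \<open>z\<close> from the commutator: the right-hand
      side has a fixed coefficient times \<open>z\<close>, so it passes to the weak limit.\<close>
    have eq: "tr (b * (z * x - x * z)) = tr ((x * b - b * x) * z)" if "z \<in> M" for z
      using tr_commute[of "b * z" x] b x that by (simp add: algebra_simps tr_diff)
    have "((\<lambda>z. tr ((x * b - b * x) * z)) \<longlongrightarrow> tr (b * (z0 * x - x * z0))) G"
      unfolding eq[OF z0M] using b x by (intro trlim) auto
    hence l1: "((\<lambda>z. tr (b * (z * x - x * z))) \<longlongrightarrow> tr (b * (z0 * x - x * z0))) G"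
      by (rule Lim_transform_eventually) (use evG[OF evM] eq in \<open>auto elim!: eventually_mono\<close>)
    have l2: "((\<lambda>z. tr (b * (z * x - x * z))) \<longlongrightarrow> 0) G"
    proof (rule tendstoI)
      fix d :: real assume d: "d > 0"
      define d' where "d' = d / (n2 b + 1)"
      have nb: "n2 b \<ge> 0" using b by simp
      have d': "d' > 0" unfolding d'_def using d nb by (simp add: add_nonneg_pos)
      have "eventually (\<lambda>z. n2 (z * x - x * z) < d') F"
        unfolding evF by (rule bexI[of _ "({x}, d')"]) (use d' x in \<open>auto simp: Z_def I_def\<close>)
      from evG[OF this] evG[OF evM] show "eventually (\<lambda>z. dist (tr (b * (z * x - x * z))) 0 < d) G"
      proof eventually_elim
        case (elim z)
        have "cmod (tr (b * (z * x - x * z))) \<le> n2 b * n2 (z * x - x * z)"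
          using elim b x by (intro tr_mult_le) auto
        also have "\<dots> \<le> n2 b * d'" using elim nb by (intro mult_left_mono) auto
        also have "\<dots> < d" unfolding d'_def using d nb by (simp add: field_simps)
        finally show ?case by simp
      qed
    qed
    have "tr (adj (z0 * x - x * z0) * (z0 * x - x * z0)) = 0"
      using uniq[OF l1 l2] unfolding b_def .
    hence "z0 * x - x * z0 = 0" using x z0M by (intro tr_faithful) auto
    thus ?thesis by simp
  qed
  hence "z0 \<in> M \<inter> bcomm M" using z0M unfolding bcomm_def by blast
  \<comment> \<open>For scalar \<open>z0\<close> the trace of the product factorises exactly,
    whereas every \<open>z\<close> in the filter misses this by at least \<open>e\<close>.\<close>
  then obtain s where s: "z0 = scal s" using factor by blast
  have "((\<lambda>z. tr (y * z) - tr y * tr (1 * z)) \<longlongrightarrow> tr (y * z0) - tr y * tr (1 * z0)) G"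
    using y by (intro tendsto_intros trlim) auto
  moreover have "tr (y * z0) - tr y * tr (1 * z0) = 0"
    unfolding s scal_commute using y tr_scal[OF y, of s] tr_scal[OF one_M, of s] by (simp add: tr_one)
  ultimately have ev: "eventually (\<lambda>z. dist (tr (y * z) - tr y * tr z) 0 < e) G"
    using e by (auto dest: tendstoD)
  have "eventually (\<lambda>z. e \<le> cmod (tr (y * z) - tr y * tr z)) F"
    unfolding evF by (rule bexI[OF _ i1]) (auto simp: Z_def)
  from evG[OF this] ev have "eventually (\<lambda>_. False) G" by eventually_elim simp
  thus False using G by (simp add: trivial_limit_def)
qed

end


section \<open>Moment sequences and their exponential generating functions\<close>

text \<open>The characteristic function at \<open>t\<close> of a variable with moments
  \<open>\<mu>\<close>.\<close>

definition mgf :: "(nat \<Rightarrow> complex) \<Rightarrow> real \<Rightarrow> complex" where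
  "mgf \<mu> t = (\<Sum>q. (\<i> * complex_of_real t) ^ q / fact q * \<mu> q)"

text \<open>The moments of a sum of two independent variables.\<close>

definition binconv :: "(nat \<Rightarrow> complex) \<Rightarrow> (nat \<Rightarrow> complex) \<Rightarrow> nat \<Rightarrow> complex" where
  "binconv \<mu> m q = (\<Sum>a\<le>q. of_nat (q choose a) * \<mu> a * m (q - a))"

text \<open>
  Modelled on the sum of \<open>s\<close> independent centered random variables that are bounded by 1 and
  have variance at least 1/2.
\<close>

definition spread_moments :: "nat \<Rightarrow> (nat \<Rightarrow> complex) \<Rightarrow> bool" where
  "spread_moments s \<mu> \<longleftrightarrow> (\<forall>q. cmod (\<mu> q) \<le> real s ^ q) \<and>
     (\<forall>t. \<bar>t\<bar> \<le> 1 \<longrightarrow> cmod (mgf \<mu> t) \<le> (1 - t\<^sup>2 / 8) ^ s)"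

lemma mgf_term_le:
  assumes "cmod (\<mu> q) \<le> real s ^ q"
  shows "norm ((\<i> * complex_of_real t) ^ q / fact q * \<mu> q) \<le> (\<bar>t\<bar> * real s) ^ q / fact q"
proof -
  have "norm ((\<i> * complex_of_real t) ^ q / fact q * \<mu> q) = \<bar>t\<bar> ^ q / fact q * cmod (\<mu> q)"
    by (simp add: norm_mult norm_divide norm_power norm_fact)
  also have "\<dots> \<le> \<bar>t\<bar> ^ q / fact q * real s ^ q" by (intro mult_left_mono assms) auto
  finally show ?thesis by (simp add: power_mult_distrib)
qed

lemma summable_exp_terms: "summable (\<lambda>q. x ^ q / fact q :: real)"
  using summable_exp[of x] by (simp add: field_simps)

lemma summable_norm_mgf:
  assumes "\<And>q. cmod (\<mu> q) \<le> real s ^ q"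
  shows "summable (\<lambda>q. norm ((\<i> * complex_of_real t) ^ q / fact q * \<mu> q))"
  by (rule summable_comparison_test[OF _ summable_exp_terms[of "\<bar>t\<bar> * real s"]])
     (intro exI[of _ 0] allI impI, simp only: real_norm_def abs_norm_cancel mgf_term_le assms)

lemma mgf_binconv:
  assumes "\<And>q. cmod (\<mu> q) \<le> real s ^ q" "\<And>q. cmod (m q) \<le> real r ^ q"
  shows "mgf (binconv \<mu> m) t = mgf \<mu> t * mgf m t"
proof -
  define z where "z = \<i> * complex_of_real t"
  have "mgf \<mu> t * mgf m t = (\<Sum>k. \<Sum>i\<le>k. (z ^ i / fact i * \<mu> i) * (z ^ (k - i) / fact (k - i) * m (k - i)))"
    unfolding mgf_def z_def by (rule Cauchy_product[OF summable_norm_mgf[OF assms(1)] summable_norm_mgf[OF assms(2)]])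
  also have "\<dots> = (\<Sum>k. z ^ k / fact k * binconv \<mu> m k)"
  proof (rule arg_cong[where f = suminf], rule ext)
    fix k
    have "(z ^ i / fact i * \<mu> i) * (z ^ (k - i) / fact (k - i) * m (k - i)) =
        z ^ k / fact k * (of_nat (k choose i) * \<mu> i * m (k - i))" if "i \<le> k" for i
    proof -
      have "z ^ i * z ^ (k - i) = z ^ k" using that by (simp flip: power_add)
      moreover have "(of_nat (k choose i) :: complex) = fact k / (fact i * fact (k - i))"
        using that by (rule binomial_fact)
      ultimately show ?thesis by (simp add: field_simps)
    qed
    thus "(\<Sum>i\<le>k. (z ^ i / fact i * \<mu> i) * (z ^ (k - i) / fact (k - i) * m (k - i))) = z ^ k / fact k * binconv \<mu> m k"
      unfolding binconv_def sum_distrib_left by (intro sum.cong) auto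
  qed
  finally show ?thesis unfolding mgf_def z_def by simp
qed

text \<open>Compares the exponential series from order 3 on with a geometric series of ratio
  1/4.\<close>

lemma fact_add3_ge: "(6::real) * 4 ^ q \<le> fact (q + 3)"
proof (induction q)
  case (Suc q)
  have "(6::real) * 4 ^ Suc q = 4 * (6 * 4 ^ q)" by simp
  also have "\<dots> \<le> real (q + 4) * fact (q + 3)" using Suc by (intro mult_mono) auto
  also have "\<dots> = fact (Suc (q + 3))" by (simp only: fact_Suc) simp
  finally show ?case by simp
qed (simp add: fact_numeral)

text \<open>The expansion begins with 1 - t^2 v/2. All moments from order 2 on are bounded by the
  variance \<open>v\<close>, so the tail is at most (t^2 v/6)(4/3) = (2/9) t^2 v. This leaves 1 -
  (5/18) t^2 v, and \<open>v \<ge> 1/2\<close> with 5/36 \<ge> 1/8 gives the claim.\<close>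

lemma mgf_centered_le:
  assumes m0: "m 0 = 1" and m1: "m 1 = 0" and m2: "m 2 = complex_of_real v"
    and v: "1/2 \<le> v" "v \<le> 1" and mq: "\<And>q. q \<ge> 2 \<Longrightarrow> cmod (m q) \<le> v" and t: "\<bar>t\<bar> \<le> 1"
  shows "cmod (mgf m t) \<le> 1 - t\<^sup>2 / 8"
proof -
  define z where "z = \<i> * complex_of_real t"
  have m_le: "cmod (m q) \<le> real 1 ^ q" for q
  proof -
    consider "q = 0" | "q = 1" | "q \<ge> 2" by linarith
    thus ?thesis by cases (use m0 m1 mq[of q] v in auto)
  qed
  have sm: "summable (\<lambda>q. norm (z ^ q / fact q * m q))" unfolding z_def by (rule summable_norm_mgf[OF m_le])
  have "mgf m t = (\<Sum>q. z ^ (q + 3) / fact (q + 3) * m (q + 3)) + (\<Sum>q<3. z ^ q / fact q * m q)"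
    unfolding mgf_def z_def[symmetric] by (rule suminf_split_initial_segment[OF summable_norm_cancel[OF sm]])
  also have "(\<Sum>q<3. z ^ q / fact q * m q) = m 0 + z * m 1 + z\<^sup>2 / 2 * m 2"
    by (simp add: eval_nat_numeral)
  also have "z\<^sup>2 = - complex_of_real (t\<^sup>2)" unfolding z_def by (simp add: power_mult_distrib)
  also have "m 0 + z * m 1 + - complex_of_real (t\<^sup>2) / 2 * m 2 = complex_of_real (1 - t\<^sup>2 * v / 2)"
    using m0 m1 m2 by simp
  finally have eq: "mgf m t = (\<Sum>q. z ^ (q + 3) / fact (q + 3) * m (q + 3)) + complex_of_real (1 - t\<^sup>2 * v / 2)" .
  have t2: "t\<^sup>2 \<le> 1" using t by (simp add: abs_square_le_1)
  have tail: "norm (z ^ (q + 3) / fact (q + 3) * m (q + 3)) \<le> t\<^sup>2 * v / 6 * (1 / 4) ^ q" for q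
  proof -
    have "norm (z ^ (q + 3) / fact (q + 3) * m (q + 3)) = \<bar>t\<bar> ^ (q + 3) / fact (q + 3) * cmod (m (q + 3))"
      unfolding z_def by (simp add: norm_mult norm_divide norm_power norm_fact)
    also have "\<dots> \<le> (\<bar>t\<bar> ^ 2 / (6 * 4 ^ q)) * v"
      using t fact_add3_ge[of q] v
      by (intro mult_mono frac_le power_decreasing mq) auto
    finally show ?thesis by (simp add: power_one_over field_simps)
  qed
  have "norm (\<Sum>q. z ^ (q + 3) / fact (q + 3) * m (q + 3)) \<le> (\<Sum>q. t\<^sup>2 * v / 6 * (1 / 4) ^ q)"
    by (rule norm_suminf_le[OF tail]) (intro summable_mult summable_geometric, simp)
  also have "\<dots> = t\<^sup>2 * v / 6 * (4 / 3)"
    by (subst suminf_mult) (simp_all add: suminf_geometric summable_geometric)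
  finally have "cmod (mgf m t) \<le> t\<^sup>2 * v / 6 * (4 / 3) + cmod (complex_of_real (1 - t\<^sup>2 * v / 2))"
    unfolding eq by (intro order_trans[OF norm_triangle_ineq] add_mono) auto
  also have "cmod (complex_of_real (1 - t\<^sup>2 * v / 2)) = 1 - t\<^sup>2 * v / 2"
    using mult_mono[OF t2 v(2)] v by (simp only: norm_of_real) simp
  also have "t\<^sup>2 * v / 6 * (4 / 3) + (1 - t\<^sup>2 * v / 2) = 1 - t\<^sup>2 * v * (5 / 18)" by simp
  also have "\<dots> \<le> 1 - t\<^sup>2 * (1 / 2) * (5 / 18)" using v by (intro diff_left_mono mult_right_mono mult_left_mono) auto
  also have "\<dots> \<le> 1 - t\<^sup>2 / 8" by simp
  finally show ?thesis .
qed

text \<open>One more independent summand: characteristic functions multiply, and the moment bound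
  follows from the binomial theorem.\<close>

lemma spread_moments_binconv:
  assumes \<mu>: "spread_moments s \<mu>"
    and m0: "m 0 = 1" and m1: "m 1 = 0" and m2: "m 2 = complex_of_real v"
    and v: "1/2 \<le> v" "v \<le> 1" and mq: "\<And>q. q \<ge> 2 \<Longrightarrow> cmod (m q) \<le> v"
  shows "spread_moments (Suc s) (binconv \<mu> m)"
  unfolding spread_moments_def
proof (intro conjI allI impI)
  have \<mu>_le: "cmod (\<mu> q) \<le> real s ^ q" for q using \<mu> unfolding spread_moments_def by blast
  have m_le: "cmod (m q) \<le> real 1 ^ q" for q
  proof -
    consider "q = 0" | "q = 1" | "q \<ge> 2" by linarith
    thus ?thesis by cases (use m0 m1 mq[of q] v in auto)
  qed
  fix q
  have "cmod (binconv \<mu> m q) \<le> (\<Sum>a\<le>q. real (q choose a) * real s ^ a * 1 ^ (q - a))"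
    unfolding binconv_def
  proof (rule sum_norm_le)
    fix a
    have "cmod (\<mu> a) * cmod (m (q - a)) \<le> real s ^ a * real 1 ^ (q - a)" by (intro mult_mono \<mu>_le m_le) auto
    thus "cmod (of_nat (q choose a) * \<mu> a * m (q - a)) \<le> real (q choose a) * real s ^ a * 1 ^ (q - a)"
      by (simp add: norm_mult mult.assoc mult_left_mono)
  qed
  also have "\<dots> = real (Suc s) ^ q" by (simp add: binomial_ring[of "real s" 1 q, simplified, symmetric] add.commute)
  finally show "cmod (binconv \<mu> m q) \<le> real (Suc s) ^ q" .
  fix t :: real assume t: "\<bar>t\<bar> \<le> 1"
  have t2: "t\<^sup>2 / 8 \<le> 1" using t abs_square_le_1[of t] by simp
  have "cmod (mgf (binconv \<mu> m) t) = cmod (mgf \<mu> t) * cmod (mgf m t)"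
    by (simp add: mgf_binconv[OF \<mu>_le m_le] norm_mult)
  also have "\<dots> \<le> (1 - t\<^sup>2 / 8) ^ s * (1 - t\<^sup>2 / 8)"
    using \<mu> t t2 mgf_centered_le[OF m0 m1 m2 v mq t] unfolding spread_moments_def by (intro mult_mono) auto
  finally show "cmod (mgf (binconv \<mu> m) t) \<le> (1 - t\<^sup>2 / 8) ^ Suc s" by (simp add: mult.commute)
qed

lemma spread_moments_0: "spread_moments 0 (\<lambda>q. if q = 0 then 1 else 0)"
proof -
  have "(\<Sum>q. (\<i> * complex_of_real t) ^ q / fact q * (if q = 0 then 1 else 0)) = 1" for t
  proof -
    have "(\<Sum>q. (\<i> * complex_of_real t) ^ q / fact q * (if q = 0 then 1 else 0)) =
       (\<Sum>q\<in>{0}. (\<i> * complex_of_real t) ^ q / fact q * (if q = 0 then 1 else 0))"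
      by (rule suminf_finite) auto
    thus ?thesis by simp
  qed
  thus ?thesis unfolding spread_moments_def mgf_def by auto
qed

section \<open>Spread almost central elements\<close>

context tracial_algebra
begin

section \<open>Powers of almost commuting elements\<close>

lemma n2_commutator_power:
  assumes x: "x \<in> M" and y: "y \<in> M" and K: "norm x \<le> K" "1 \<le> K"
  shows "n2 (x ^ q * y - y * x ^ q) \<le> real q * K ^ q * n2 (x * y - y * x)"
proof (induction q)
  case 0 show ?case by simp
next
  case (Suc q)
  define c where "c = n2 (x * y - y * x)"
  have c: "0 \<le> c" unfolding c_def using x y by simp
  have "x ^ Suc q * y - y * x ^ Suc q = x * (x ^ q * y - y * x ^ q) + (x * y - y * x) * x ^ q"
    by (simp add: algebra_simps)
  hence "n2 (x ^ Suc q * y - y * x ^ Suc q) \<le> n2 (x * (x ^ q * y - y * x ^ q)) + n2 ((x * y - y * x) * x ^ q)"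
    using x y n2_triangle by simp
  also have "\<dots> \<le> norm x * n2 (x ^ q * y - y * x ^ q) + n2 (x * y - y * x) * norm (x ^ q)"
    using x y by (intro add_mono n2_mult_le n2_mult_le') auto
  also have "\<dots> \<le> K * (real q * K ^ q * c) + c * K ^ q"
    using Suc K x y c norm_power_bop_le[OF K(1), of q] unfolding c_def by (intro add_mono mult_mono) auto
  also have "\<dots> \<le> K * (real q * K ^ q * c) + c * K ^ Suc q"
    using K c by (intro add_left_mono mult_left_mono power_increasing) auto
  also have "\<dots> = real (Suc q) * K ^ Suc q * c" by (simp add: algebra_simps)
  finally show ?case unfolding c_def .
qed

lemma n2_power_diff:
  assumes x: "x \<in> M" and y: "y \<in> M" and K: "norm x \<le> K" "norm y \<le> K" "1 \<le> K"
  shows "n2 (x ^ q - y ^ q) \<le> real q * K ^ q * n2 (x - y)"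
proof (induction q)
  case 0 show ?case by simp
next
  case (Suc q)
  define c where "c = n2 (x - y)"
  have c: "0 \<le> c" unfolding c_def using x y by simp
  have "x ^ Suc q - y ^ Suc q = x * (x ^ q - y ^ q) + (x - y) * y ^ q"
    by (simp add: algebra_simps)
  hence "n2 (x ^ Suc q - y ^ Suc q) \<le> n2 (x * (x ^ q - y ^ q)) + n2 ((x - y) * y ^ q)"
    using x y n2_triangle by simp
  also have "\<dots> \<le> norm x * n2 (x ^ q - y ^ q) + n2 (x - y) * norm (y ^ q)"
    using x y by (intro add_mono n2_mult_le n2_mult_le') auto
  also have "\<dots> \<le> K * (real q * K ^ q * c) + c * K ^ q"
    using Suc K x y c norm_power_bop_le[OF K(2), of q] unfolding c_def by (intro add_mono mult_mono) auto
  also have "\<dots> \<le> K * (real q * K ^ q * c) + c * K ^ Suc q"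
    using K c by (intro add_left_mono mult_left_mono power_increasing) auto
  also have "\<dots> = real (Suc q) * K ^ Suc q * c" by (simp add: algebra_simps)
  finally show ?case unfolding c_def .
qed

text \<open>\<open>S q\<close> is the expansion of (H + g)^q with all factors \<open>H\<close> moved
  to the left. Pascal's rule gives the recursion for arbitrary \<open>H\<close> and
  \<open>g\<close>, because the new \<open>H\<close> is put on the left and the new \<open>g\<close>
  on the right.\<close>

lemma binomial_sum_Suc:
  fixes H g :: "'h bop"
  defines "S \<equiv> \<lambda>q. \<Sum>a\<le>q. real (q choose a) *\<^sub>R (H ^ a * g ^ (q - a))"
  shows "S (Suc q) = H * S q + S q * g"
proof -
  define x where "x i = H ^ i * g ^ (Suc q - i)" for i
  have "S (Suc q) = real (Suc q choose 0) *\<^sub>R x 0 + (\<Sum>i\<le>q. real (Suc q choose Suc i) *\<^sub>R x (Suc i))"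
    unfolding S_def x_def by (rule sum.atMost_Suc_shift)
  also have "\<dots> = (\<Sum>i\<le>q. real (q choose i) *\<^sub>R x (Suc i)) +
      (real (q choose 0) *\<^sub>R x 0 + (\<Sum>i\<le>q. real (q choose Suc i) *\<^sub>R x (Suc i)))"
    by (simp add: scaleR_add_left sum.distrib)
  also have "real (q choose 0) *\<^sub>R x 0 + (\<Sum>i\<le>q. real (q choose Suc i) *\<^sub>R x (Suc i)) = (\<Sum>i\<le>Suc q. real (q choose i) *\<^sub>R x i)"
    by (rule sum.atMost_Suc_shift[symmetric])
  also have "\<dots> = (\<Sum>i\<le>q. real (q choose i) *\<^sub>R x i)" by simp
  also have "\<dots> = S q * g"
    unfolding S_def sum_distrib_right
    by (intro sum.cong) (auto simp: x_def Suc_diff_le mult.assoc power_commutes)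
  also have "(\<Sum>i\<le>q. real (q choose i) *\<^sub>R x (Suc i)) = H * S q"
    unfolding S_def sum_distrib_left by (intro sum.cong) (auto simp: x_def mult.assoc)
  finally show ?thesis .
qed

lemma tr_binomial_approx:
  assumes H: "H \<in> M" and e: "e > 0"
  shows "\<exists>d>0. \<forall>g\<in>M. norm g \<le> 1 \<longrightarrow> n2 (g * H - H * g) < d \<longrightarrow>
    (\<forall>q\<le>Q. cmod (tr ((H + g) ^ q) - (\<Sum>a\<le>q. of_nat (q choose a) * tr (H ^ a * g ^ (q - a)))) < e)"
proof -
  define K where "K = norm H + 1"
  have K: "1 \<le> K" unfolding K_def by simp
  \<comment> \<open>The error recursion between (H + g)^q and the ordered expansion:
    \<open>K + 1\<close> comes from multiplying the old error by \<open>H\<close> and by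
    \<open>g\<close>, and q K^q from commuting \<open>g\<close> with (H + g)^q.\<close>
  define c where "c = rec_nat 0 (\<lambda>q r. (K + 1) * r + real q * K ^ q)"
  have c0: "c 0 = 0" and cS: "c (Suc q) = (K + 1) * c q + real q * K ^ q" for q
    unfolding c_def by simp_all
  have cpos: "0 \<le> c q" for q by (induction q) (use K in \<open>auto simp: c0 cS\<close>)
  define C where "C = 1 + (\<Sum>q\<le>Q. c q)"
  have C: "C > 0" unfolding C_def by (intro add_pos_nonneg sum_nonneg cpos) simp
  have cC: "c q < C" if "q \<le> Q" for q
  proof -
    have "c q \<le> (\<Sum>q\<le>Q. c q)" by (rule member_le_sum) (use that cpos in auto)
    thus ?thesis unfolding C_def by simp
  qed
  show ?thesis
  proof (intro exI[of _ "e / C"] conjI ballI impI allI)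
    show "e / C > 0" using e C by simp
    fix g q assume g: "g \<in> M" "norm g \<le> 1" "n2 (g * H - H * g) < e / C" and q: "q \<le> Q"
    define \<delta> where "\<delta> = n2 (g * H - H * g)"
    have \<delta>: "0 \<le> \<delta>" unfolding \<delta>_def using g H by simp
    define S where "S q = (\<Sum>a\<le>q. real (q choose a) *\<^sub>R (H ^ a * g ^ (q - a)))" for q
    have SM: "S q \<in> M" for q unfolding S_def using H g by auto
    define P where "P q = (H + g) ^ q" for q
    have PM: "P q \<in> M" for q unfolding P_def using H g by auto
    have nHg: "norm (H + g) \<le> K" unfolding K_def using g by (intro norm_triangle_le) simp
    have D: "n2 (P q - S q) \<le> c q * \<delta>" for q
    proof (induction q)
      case 0 show ?case unfolding P_def S_def by (simp add: c0)
    next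
      case (Suc q)
      have "P (Suc q) - S (Suc q) = H * (P q - S q) + ((P q - S q) * g + (g * P q - P q * g))"
        unfolding P_def S_def binomial_sum_Suc by (simp add: algebra_simps)
      hence "n2 (P (Suc q) - S (Suc q)) \<le> n2 (H * (P q - S q)) + n2 ((P q - S q) * g + (g * P q - P q * g))"
        using n2_triangle[of "H * (P q - S q)" "(P q - S q) * g + (g * P q - P q * g)"] PM SM g H by simp
      also have "n2 ((P q - S q) * g + (g * P q - P q * g)) \<le> n2 ((P q - S q) * g) + n2 (g * P q - P q * g)"
        using PM SM g H by (intro n2_triangle) auto
      also have "n2 (H * (P q - S q)) \<le> K * (c q * \<delta>)"
        using order_trans[OF n2_mult_le mult_mono[OF _ Suc]] PM SM H K unfolding K_def by simp
      also have "n2 ((P q - S q) * g) \<le> (c q * \<delta>) * 1"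
        using order_trans[OF n2_mult_le' mult_mono[OF Suc g(2)]] PM SM g cpos \<delta> by simp
      also have "n2 (g * P q - P q * g) \<le> real q * K ^ q * \<delta>"
      proof -
        have "n2 ((H + g) ^ q * g - g * (H + g) ^ q) \<le> real q * K ^ q * n2 ((H + g) * g - g * (H + g))"
          using g H nHg K by (intro n2_commutator_power) auto
        also have "(H + g) * g - g * (H + g) = H * g - g * H" by (simp add: algebra_simps)
        finally show ?thesis unfolding P_def \<delta>_def by (simp add: n2_diff_commute[of "g * _"])
      qed
      finally show ?case by (simp add: cS algebra_simps)
    qed
    have "tr (S q) = (\<Sum>a\<le>q. of_nat (q choose a) * tr (H ^ a * g ^ (q - a)))"
      unfolding S_def using H g by (subst tr_sum) (auto simp: tr_scaleR)
    hence "cmod (tr ((H + g) ^ q) - (\<Sum>a\<le>q. of_nat (q choose a) * tr (H ^ a * g ^ (q - a)))) = cmod (tr (P q - S q))"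
      using PM SM by (simp add: tr_diff P_def)
    also have "\<dots> \<le> n2 (P q - S q)" using PM SM by (intro tr_le_n2) auto
    also have "\<dots> \<le> c q * \<delta>" by (rule D)
    also have "\<dots> \<le> C * \<delta>" using cC[OF q] \<delta> by (intro mult_right_mono) auto
    also have "\<dots> < e" using g(3) C unfolding \<delta>_def[symmetric] by (simp add: field_simps)
    finally show "cmod (tr ((H + g) ^ q) - (\<Sum>a\<le>q. of_nat (q choose a) * tr (H ^ a * g ^ (q - a)))) < e" .
  qed
qed

text \<open>\<open>almost_central_independent\<close> for each \<open>H ^ a\<close>, with
  \<open>g ^ b\<close> in the role of the almost central element.\<close>

lemma powers_independent:
  assumes factor: "M \<inter> bcomm M = range scal" and H: "H \<in> M" and e: "e > 0"
  shows "\<exists>X d. finite X \<and> X \<subseteq> M \<and> d > 0 \<and>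
    (\<forall>g\<in>M. norm g \<le> 1 \<longrightarrow> (\<forall>x\<in>X. n2 (g * x - x * g) < d) \<longrightarrow>
      (\<forall>a\<le>Q. \<forall>b\<le>Q. cmod (tr (H ^ a * g ^ b) - tr (H ^ a) * tr (g ^ b)) < e))"
proof -
  have "\<forall>a. \<exists>X d. finite X \<and> X \<subseteq> M \<and> d > 0 \<and>
    (\<forall>z\<in>M. norm z \<le> 1 \<longrightarrow> (\<forall>x\<in>X. n2 (z * x - x * z) < d) \<longrightarrow> cmod (tr (H ^ a * z) - tr (H ^ a) * tr z) < e)"
    using almost_central_independent[OF factor power_M[OF H] e] by blast
  then obtain X d where Xd: "\<And>a. finite (X a)" "\<And>a. X a \<subseteq> M" "\<And>a. d a > 0"
    "\<And>a z. z \<in> M \<Longrightarrow> norm z \<le> 1 \<Longrightarrow> (\<forall>x\<in>X a. n2 (z * x - x * z) < d a) \<Longrightarrow> cmod (tr (H ^ a * z) - tr (H ^ a) * tr z) < e"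
    by metis
  \<comment> \<open>Passing from commutators of \<open>g\<close> to those of \<open>g ^ b\<close>
    costs at most a factor \<open>b \<le> Q\<close>.\<close>
  define d0 where "d0 = Min (d ` {..Q}) / (real Q + 1)"
  have "Min (d ` {..Q}) > 0" using Xd by simp
  hence d0: "d0 > 0" unfolding d0_def by simp
  show ?thesis
  proof (intro exI[of _ "\<Union>a\<le>Q. X a"] exI[of _ d0] conjI ballI impI allI)
    fix g a b assume g: "g \<in> M" "norm g \<le> 1" "\<forall>x\<in>\<Union>a\<le>Q. X a. n2 (g * x - x * g) < d0" and a: "a \<le> Q" and b: "b \<le> Q"
    have ngb: "norm (g ^ b) \<le> 1" using norm_power_bop_le[OF g(2), of b] by simp
    show "cmod (tr (H ^ a * g ^ b) - tr (H ^ a) * tr (g ^ b)) < e"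
    proof (rule Xd(4)[OF power_M[OF g(1)] ngb], rule ballI)
      fix x assume x: "x \<in> X a"
      hence xM: "x \<in> M" using Xd by blast
      have "n2 (g ^ b * x - x * g ^ b) \<le> real b * 1 ^ b * n2 (g * x - x * g)"
        using g xM by (intro n2_commutator_power) auto
      also have "\<dots> \<le> real Q * n2 (g * x - x * g)" using b g xM by (intro mult_right_mono) auto
      also have "\<dots> \<le> real Q * d0" using g(3) x a by (intro mult_left_mono) force+
      also have "\<dots> < (real Q + 1) * d0" using d0 by simp
      also have "\<dots> = Min (d ` {..Q})" unfolding d0_def by simp
      also have "\<dots> \<le> d a" using a by simp
      finally show "n2 (g ^ b * x - x * g ^ b) < d a" .
    qed
  qed (use Xd d0 in auto)
qed

section \<open>Real parts of trace-zero unitaries\<close>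

definition rpart :: "'h bop \<Rightarrow> 'h bop" where "rpart w = (1/2) *\<^sub>R (w + adj w)"

lemma rpart_M [simp]: "w \<in> M \<Longrightarrow> rpart w \<in> M" unfolding rpart_def by auto
lemma adj_rpart [simp]: "adj (rpart w) = rpart w" unfolding rpart_def by (simp add: adj_add add.commute)
lemma norm_rpart: "norm (rpart w) \<le> norm w"
  unfolding rpart_def using norm_triangle_ineq[of w "adj w"] by simp

lemma n2_rpart_diff: assumes "r \<in> M" "w \<in> M" shows "n2 (rpart r - rpart w) \<le> n2 (r - w)"
proof -
  have "rpart r - rpart w = (1/2) *\<^sub>R ((r - w) + adj (r - w))"
    unfolding rpart_def by (simp add: adj_diff algebra_simps)
  moreover have "n2 ((r - w) + adj (r - w)) \<le> n2 (r - w) + n2 (adj (r - w))"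
    using assms by (intro n2_triangle) auto
  ultimately show ?thesis using assms by (simp add: n2_scaleR)
qed

lemma n2_commutator_rpart:
  assumes w: "w \<in> M" "adj w * w = 1" "w * adj w = 1" and x: "x \<in> M"
  shows "n2 (rpart w * x - x * rpart w) \<le> n2 (w * x - x * w)"
proof -
  \<comment> \<open>For unitary \<open>w\<close> the commutator of \<open>adj w\<close> with
    \<open>x\<close> is that of \<open>x\<close> with \<open>w\<close>, multiplied by
    \<open>adj w\<close> on both sides.\<close>
  have "adj w * ((x * w - w * x) * adj w) = (adj w * x) * (w * adj w) - (adj w * w) * (x * adj w)"
    by (simp add: algebra_simps)
  hence "adj w * x - x * adj w = adj w * ((x * w - w * x) * adj w)" using w by simp
  hence "n2 (adj w * x - x * adj w) \<le> norm (adj w) * n2 ((x * w - w * x) * adj w)"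
    using w x n2_mult_le[of "(x * w - w * x) * adj w" "adj w"] by simp
  also have "\<dots> \<le> norm (adj w) * (n2 (x * w - w * x) * norm (adj w))"
    using w x by (intro mult_left_mono n2_mult_le') auto
  also have "\<dots> \<le> 1 * (n2 (x * w - w * x) * 1)"
    using unitary_norm_le[OF w(2)] w x by (intro mult_mono) auto
  finally have *: "n2 (adj w * x - x * adj w) \<le> n2 (w * x - x * w)" by (simp add: n2_diff_commute[of "x * w"])
  have "rpart w * x - x * rpart w = (1/2) *\<^sub>R ((w * x - x * w) + (adj w * x - x * adj w))"
    unfolding rpart_def by (simp add: algebra_simps)
  hence "n2 (rpart w * x - x * rpart w) \<le> (1/2) * (n2 (w * x - x * w) + n2 (adj w * x - x * adj w))"
    using w x n2_triangle by (simp add: n2_scaleR)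
  thus ?thesis using * by simp
qed

text \<open>The real parts of u and of -i u act as cosine and sine: their squares add up to 1, so
  one of the two has at least half of the trace. This supplies the lower bound 1/2 for the
  variance.\<close>

lemma unitary_large_rpart:
  assumes u: "u \<in> M" "adj u * u = 1" "u * adj u = 1"
  shows "\<exists>c. cmod c = 1 \<and> 1/2 \<le> (n2 (rpart (scal c * u)))\<^sup>2"
proof (rule ccontr)
  assume "\<not> ?thesis"
  hence *: "(n2 (rpart (scal c * u)))\<^sup>2 < 1/2" if "cmod c = 1" for c
    using that by force
  define g1 where "g1 = rpart (scal 1 * u)"
  define g2 where "g2 = rpart (scal (- \<i>) * u)"
  have M: "g1 \<in> M" "g2 \<in> M" unfolding g1_def g2_def using u by simp_all
  define v where "v = scal (- \<i>) * u"
  have m1: "scaleC (-1) y = - y" and p1: "scaleC 1 y = y" for y :: 'h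
    using scaleR_scaleC[of "-1" y] scaleR_scaleC[of 1 y] by simp_all
  have v: "v * v = - (u * u)" "v * adj v = u * adj u" "adj v * v = adj u * u" "adj v * adj v = - (adj u * adj u)"
    unfolding v_def by (rule bop_eqI, simp add: adj_scal_mult app_scaleC_right scaleC_scaleC m1 p1)+
  have sa: "adj g1 = g1" "adj g2 = g2" unfolding g1_def g2_def by simp_all
  have g: "g1 = (1/2) *\<^sub>R (u + adj u)" "g2 = (1/2) *\<^sub>R (v + adj v)"
    unfolding g1_def g2_def v_def rpart_def by simp_all
  have four: "a + a + (a + a) = 4 *\<^sub>R a" for a :: "'h bop" by (simp add: scaleR_2[symmetric])
  have "adj g1 * g1 + adj g2 * g2 = g1 * g1 + g2 * g2" by (simp only: sa)
  also have "\<dots> = (1/4) *\<^sub>R ((u + adj u) * (u + adj u) + (v + adj v) * (v + adj v))"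
    unfolding g by (simp add: scaleR_add_right[of "1/4"])
  also have "(u + adj u) * (u + adj u) + (v + adj v) * (v + adj v) = 4 *\<^sub>R 1"
    unfolding four[symmetric] by (simp add: distrib_left distrib_right u v)
  also have "(1/4) *\<^sub>R 4 *\<^sub>R 1 = (1 :: 'h bop)" by simp
  finally have "tr (adj g1 * g1) + tr (adj g2 * g2) = 1"
    using M by (simp add: tr_add[symmetric] tr_one)
  hence "complex_of_real ((n2 g1)\<^sup>2 + (n2 g2)\<^sup>2) = 1" using M by (simp add: tr_adj_self)
  hence "(n2 g1)\<^sup>2 + (n2 g2)\<^sup>2 = 1" using of_real_eq_1_iff by blast
  moreover have "(n2 g1)\<^sup>2 < 1/2" "(n2 g2)\<^sup>2 < 1/2" unfolding g1_def g2_def by (rule *; simp)+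
  ultimately show False by linarith
qed

end


context tracial_algebra
begin

text \<open>Collects the hypotheses of \<open>spread_moments_binconv\<close>. For the last clause
  two factors \<open>g\<close> are split off from \<open>g ^ q\<close> and the remaining power is
  estimated in norm by 1.\<close>

lemma rpart_moments:
  assumes w: "w \<in> M" "adj w * w = 1" "tr w = 0"
  defines "g \<equiv> rpart w"
  shows "g \<in> M" "norm g \<le> 1" "tr (g ^ 0) = 1" "tr (g ^ 1) = 0" "tr (g ^ 2) = complex_of_real ((n2 g)\<^sup>2)"
    "(n2 g)\<^sup>2 \<le> 1" "q \<ge> 2 \<Longrightarrow> cmod (tr (g ^ q)) \<le> (n2 g)\<^sup>2"
proof -
  show g: "g \<in> M" unfolding g_def using w by simp
  show ng: "norm g \<le> 1" unfolding g_def using norm_rpart unitary_norm_le[OF w(2)] order_trans by blast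
  show "tr (g ^ 0) = 1" by (simp add: tr_one)
  show "tr (g ^ 1) = 0" unfolding g_def rpart_def using w by (simp add: tr_scaleR tr_add tr_adj)
  have sa: "adj g = g" unfolding g_def by simp
  show "tr (g ^ 2) = complex_of_real ((n2 g)\<^sup>2)"
    using tr_adj_self[OF g] by (simp add: sa power2_eq_square)
  have n: "0 \<le> n2 g" "n2 g \<le> 1" using g n2_le_norm[OF g] ng by auto
  thus "(n2 g)\<^sup>2 \<le> 1" by (simp add: power_le_one)
  assume "q \<ge> 2"
  then obtain r where r: "q = Suc (Suc r)" by (metis Suc_le_D numeral_2_eq_2 Suc_le_mono)
  have "g ^ q = adj g * (g ^ r * g)" unfolding r sa by (simp add: power_commutes)
  hence "cmod (tr (g ^ q)) \<le> n2 g * n2 (g ^ r * g)" using tr_cauchy_schwarz[of "g ^ r * g" g] g by simp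
  also have "n2 (g ^ r * g) \<le> norm (g ^ r) * n2 g" using g by (intro n2_mult_le) auto
  also have "\<dots> \<le> 1 ^ r * n2 g" using n norm_power_bop_le[OF ng, of r] by (intro mult_right_mono) auto
  finally show "cmod (tr (g ^ q)) \<le> (n2 g)\<^sup>2" using n by (simp add: power2_eq_square mult_left_mono)
qed

lemma unitary_scal:
  assumes u: "u \<in> M" "adj u * u = 1" "u * adj u = 1" "tr u = 0" and c: "cmod c = 1"
  defines "w \<equiv> scal c * u"
  shows "w \<in> M" "adj w * w = 1" "w * adj w = 1" "tr w = 0"
    "x \<in> M \<Longrightarrow> n2 (w * x - x * w) = n2 (u * x - x * u)"
proof -
  have cc: "c * cnj c = 1" using c complex_norm_square[of c] by simp
  show "w \<in> M" unfolding w_def using u by simp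
  have "adj w * w = scal (c * cnj c) * (adj u * u)" "w * adj w = scal (c * cnj c) * (u * adj u)"
    unfolding w_def by (rule bop_eqI, simp add: adj_scal_mult app_scaleC_right scaleC_scaleC mult.commute)+
  thus "adj w * w = 1" "w * adj w = 1" using cc u by simp_all
  show "tr w = 0" unfolding w_def using u by (simp add: tr_scal)
  assume "x \<in> M"
  have "w * x - x * w = scal c * (u * x - x * u)"
    unfolding w_def by (simp add: right_diff_distrib mult_scal_left mult.assoc)
  thus "n2 (w * x - x * w) = n2 (u * x - x * u)" using u c \<open>x \<in> M\<close> by (simp add: n2_scal)
qed

text \<open>
  Each step adds to \<open>H\<close> a trace-zero element \<open>h\<close> that is almost central relative to \<open>H\<close>, so
  that the two behave like independent random variables.
\<close>

theorem spread_element: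
  assumes A: "star_algebra A" "A \<subseteq> M" "M \<subseteq> bcomm (bcomm A)"
    and factor: "M \<inter> bcomm M = range scal"
    and gamma: "\<And>X e. finite X \<Longrightarrow> X \<subseteq> M \<Longrightarrow> e > 0 \<Longrightarrow>
      \<exists>u\<in>M. adj u * u = 1 \<and> u * adj u = 1 \<and> tr u = 0 \<and> (\<forall>x\<in>X. n2 (u * x - x * u) < e)"
    and X: "finite X" "X \<subseteq> M"
  shows "e > 0 \<Longrightarrow> \<exists>H\<in>A. adj H = H \<and> (\<forall>x\<in>X. n2 (H * x - x * H) < e) \<and>
    (\<exists>\<mu>. spread_moments s \<mu> \<and> (\<forall>q\<le>Q. cmod (tr (H ^ q) - \<mu> q) < e))"
proof (induction s arbitrary: e)
  case 0
  have "scal 0 * 1 \<in> A" using A unfolding star_algebra_def by blast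
  hence zA: "0 \<in> A" by simp
  have "cmod (tr (0 ^ q) - (if q = 0 then 1 else 0)) < e" for q
    using 0 by (cases q) (simp_all add: tr_one)
  thus ?case using zA 0 spread_moments_0 by (intro bexI[OF _ zA]) auto
next
  case (Suc s)
  \<comment> \<open>\<open>P\<close> bounds the sum of a row of binomial coefficients. Each product
    of moments is off by at most 2 e1, so the whole row costs e/4.\<close>
  define P where "P = (2::real) ^ Q"
  have P: "P \<ge> 1" unfolding P_def by simp
  define e1 where "e1 = e / (8 * P)"
  have e1: "e1 > 0" unfolding e1_def using Suc P by simp
  have e1le: "e1 \<le> e / 8" unfolding e1_def using P Suc by (simp add: field_simps mult_left_mono)
  obtain H \<mu> where H: "H \<in> A" "adj H = H" "\<forall>x\<in>X. n2 (H * x - x * H) < e1" "spread_moments s \<mu>"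
    "\<And>q. q \<le> Q \<Longrightarrow> cmod (tr (H ^ q) - \<mu> q) < e1"
    using Suc.IH[OF e1] by blast
  have HM: "H \<in> M" using H A by blast
  obtain d1 where d1: "d1 > 0" "\<And>g q. g \<in> M \<Longrightarrow> norm g \<le> 1 \<Longrightarrow> n2 (g * H - H * g) < d1 \<Longrightarrow> q \<le> Q \<Longrightarrow>
      cmod (tr ((H + g) ^ q) - (\<Sum>a\<le>q. of_nat (q choose a) * tr (H ^ a * g ^ (q - a)))) < e / 8"
    using tr_binomial_approx[OF HM, of "e / 8" Q] Suc.prems by auto
  obtain Y d2 where Y: "finite Y" "Y \<subseteq> M" "d2 > 0" and Y_ind:
    "\<forall>g\<in>M. norm g \<le> 1 \<longrightarrow> (\<forall>x\<in>Y. n2 (g * x - x * g) < d2) \<longrightarrow>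
      (\<forall>a\<le>Q. \<forall>b\<le>Q. cmod (tr (H ^ a * g ^ b) - tr (H ^ a) * tr (g ^ b)) < e1)"
    using powers_independent[OF factor HM e1, of Q] by (elim exE conjE)
  define d where "d = min (min d1 d2) (e / 8)"
  have d: "d > 0" unfolding d_def using d1 Y Suc.prems by simp
  obtain u where u: "u \<in> M" "adj u * u = 1" "u * adj u = 1" "tr u = 0"
    "\<forall>x\<in>insert H (X \<union> Y). n2 (u * x - x * u) < d"
    using gamma[of "insert H (X \<union> Y)" d] X Y HM d by auto
  obtain c where c: "cmod c = 1" "1/2 \<le> (n2 (rpart (scal c * u)))\<^sup>2"
    using unitary_large_rpart[OF u(1-3)] by blast
  define w where "w = scal c * u"
  note w = unitary_scal[OF u(1-4) c(1), folded w_def]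
  define g where "g = rpart w"
  note g = rpart_moments[OF w(1,2,4), folded g_def]
  have gc: "n2 (g * x - x * g) < d" if "x \<in> insert H (X \<union> Y)" for x
  proof -
    have xM: "x \<in> M" using that X Y HM by blast
    have "n2 (g * x - x * g) \<le> n2 (w * x - x * w)" unfolding g_def by (rule n2_commutator_rpart[OF w(1-3) xM])
    also have "\<dots> < d" using w(5)[OF xM] u(5) that by auto
    finally show ?thesis .
  qed
  define K where "K = norm H + 4"
  have K: "1 \<le> K" unfolding K_def by simp
  define B where "B = (\<Sum>x\<in>X. norm x)"
  have B: "0 \<le> B" "\<And>x. x \<in> X \<Longrightarrow> norm x \<le> B"
    unfolding B_def using X by (auto intro: sum_nonneg member_le_sum)
  \<comment> \<open>The tolerance for replacing \<open>g\<close> by an element of \<open>A\<close>: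
    the first entry pays for the moments up to order \<open>Q\<close>, the second for the
    commutators with \<open>X\<close>.\<close>
  define d3 where "d3 = min (e / (8 * (real Q * K ^ Q + 1))) (e / (8 * (2 * B + 1)))"
  have QK: "real Q * K ^ Q + 1 > 0" using K by (intro add_nonneg_pos) auto
  have d3: "d3 > 0" unfolding d3_def using Suc.prems QK B by simp
  obtain r where r: "r \<in> A" "norm r \<le> 4" "n2 (r - w) < d3"
    using unitary_density[OF A w(1-3) d3] by blast
  have rM: "r \<in> M" using r A by blast
  \<comment> \<open>\<open>g\<close> has norm at most 1, trace zero and is almost central, but lies
    only in \<open>M\<close>; \<open>h\<close> replaces it in \<open>A\<close>. The tolerance
    \<open>d3\<close> had to be fixed before \<open>r\<close>, yet depends through \<open>K\<close>
    on a bound for \<open>norm h\<close>. The uniform bound 4 breaks this circle.\<close>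
  define h where "h = rpart r"
  have hA: "h \<in> A"
  proof -
    have "scal (complex_of_real (1/2)) * (r + adj r) \<in> A" using r A unfolding star_algebra_def by blast
    thus ?thesis unfolding h_def rpart_def scal_of_real_mult .
  qed
  have hM: "h \<in> M" using hA A by blast
  have hn: "norm h \<le> 4" unfolding h_def using norm_rpart r order_trans by blast
  have hg: "n2 (h - g) < d3" unfolding h_def g_def using n2_rpart_diff[OF rM w(1)] r by simp
  have hg0: "0 \<le> n2 (h - g)" using hM g by simp
  \<comment> \<open>The model sequence uses the moments of \<open>g\<close> in all orders;
    \<open>H + h\<close> has to match it only up to order \<open>Q\<close>.\<close>
  define m where "m q = tr (g ^ q)" for q
  define v where "v = (n2 g)\<^sup>2"
  have spread: "spread_moments (Suc s) (binconv \<mu> m)"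
  proof (rule spread_moments_binconv[OF H(4)])
    show "m 0 = 1" "m 1 = 0" "m 2 = complex_of_real v" "v \<le> 1" unfolding m_def v_def using g by blast+
    show "1 / 2 \<le> v" unfolding v_def g_def w_def by (rule c)
    show "cmod (m q) \<le> v" if "q \<ge> 2" for q unfolding m_def v_def using g(7)[OF that] .
  qed
  have HhA: "H + h \<in> A" using H hA A unfolding star_algebra_def by blast
  have Hhsa: "adj (H + h) = H + h" using H unfolding h_def by (simp add: adj_add)
  have comm: "n2 ((H + h) * x - x * (H + h)) < e" if x: "x \<in> X" for x
  proof -
    have xM: "x \<in> M" using x X by blast
    have "(H + h) * x - x * (H + h) = (H * x - x * H) + ((g * x - x * g) + ((h - g) * x - x * (h - g)))"
      by (simp add: algebra_simps)
    hence "n2 ((H + h) * x - x * (H + h)) \<le> n2 (H * x - x * H) + n2 ((g * x - x * g) + ((h - g) * x - x * (h - g)))"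
      using HM hM g(1) xM n2_triangle by simp
    also have "n2 ((g * x - x * g) + ((h - g) * x - x * (h - g))) \<le> n2 (g * x - x * g) + n2 ((h - g) * x - x * (h - g))"
      using hM g(1) xM by (intro n2_triangle) auto
    also have "n2 ((h - g) * x - x * (h - g)) \<le> n2 ((h - g) * x) + n2 (x * (h - g))"
      using hM g(1) xM by (intro n2_triangle_diff) auto
    also have "n2 ((h - g) * x) \<le> n2 (h - g) * norm x" using hM g(1) xM by (intro n2_mult_le') auto
    also have "n2 (x * (h - g)) \<le> norm x * n2 (h - g)" using hM g(1) xM by (intro n2_mult_le) auto
    also have "n2 (H * x - x * H) \<le> e / 8" using H(3) x e1le by force
    also have "n2 (g * x - x * g) \<le> e / 8" using gc[of x] x unfolding d_def by simp
    finally have "n2 ((H + h) * x - x * (H + h)) \<le> e / 8 + (e / 8 + (n2 (h - g) * norm x + norm x * n2 (h - g)))" by simp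
    also have "n2 (h - g) * norm x + norm x * n2 (h - g) \<le> (2 * B + 1) * n2 (h - g)"
      using mult_right_mono[OF B(2)[OF x] hg0] hg0 by (simp add: algebra_simps)
    also have "\<dots> \<le> (2 * B + 1) * (e / (8 * (2 * B + 1)))"
      using hg B unfolding d3_def by (intro mult_left_mono) auto
    also have "\<dots> = e / 8" using B by (simp add: field_simps)
    also have "e / 8 + (e / 8 + e / 8) < e" using Suc.prems by simp
    finally show ?thesis by simp
  qed
  have mom: "cmod (tr ((H + h) ^ q) - binconv \<mu> m q) < e" if q: "q \<le> Q" for q
  proof -
    have choose_le: "(\<Sum>a\<le>q. real (q choose a)) \<le> P"
    proof -
      have "(\<Sum>a\<le>q. real (q choose a)) = real (\<Sum>a\<le>q. q choose a)" by simp
      also have "\<dots> = 2 ^ q" by (subst choose_row_sum) simp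
      also have "\<dots> \<le> P" unfolding P_def using q by (intro power_increasing) auto
      finally show ?thesis .
    qed
    have t1: "cmod (tr ((H + h) ^ q) - tr ((H + g) ^ q)) \<le> e / 8"
    proof -
      have "cmod (tr ((H + h) ^ q) - tr ((H + g) ^ q)) \<le> n2 ((H + h) ^ q - (H + g) ^ q)"
        using HM hM g(1) tr_le_n2[of "(H + h) ^ q - (H + g) ^ q"] by (simp add: tr_diff)
      also have "\<dots> \<le> real q * K ^ q * n2 ((H + h) - (H + g))"
        using HM hM g K hn unfolding K_def by (intro n2_power_diff) (auto intro: norm_triangle_le)
      also have "\<dots> = real q * K ^ q * n2 (h - g)" by simp
      also have "\<dots> \<le> (real Q * K ^ Q + 1) * n2 (h - g)"
        using q K hg0 by (intro mult_right_mono add_increasing2 mult_mono power_increasing) auto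
      also have "\<dots> \<le> (real Q * K ^ Q + 1) * (e / (8 * (real Q * K ^ Q + 1)))"
        using hg QK unfolding d3_def by (intro mult_left_mono) auto
      also have "\<dots> = e / 8" using QK by (simp add: field_simps)
      finally show ?thesis .
    qed
    have t2: "cmod (tr ((H + g) ^ q) - (\<Sum>a\<le>q. of_nat (q choose a) * tr (H ^ a * g ^ (q - a)))) < e / 8"
      using d1(2)[OF g(1,2) _ q] gc[of H] unfolding d_def by simp
    have Yg: "\<forall>x\<in>Y. n2 (g * x - x * g) < d2" using gc unfolding d_def by simp
    have m_le: "cmod (m b) \<le> 1" for b
      using g(1) tr_le_n2[OF power_M[OF g(1), of b]] n2_le_norm[OF power_M[OF g(1), of b]]
        norm_power_bop_le[OF g(2), of b] unfolding m_def by simp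
    have "cmod ((\<Sum>a\<le>q. of_nat (q choose a) * tr (H ^ a * g ^ (q - a))) - binconv \<mu> m q)
        = cmod (\<Sum>a\<le>q. of_nat (q choose a) * (tr (H ^ a * g ^ (q - a)) - \<mu> a * m (q - a)))"
      unfolding binconv_def by (simp add: sum_subtractf[symmetric] algebra_simps)
    also have "\<dots> \<le> (\<Sum>a\<le>q. real (q choose a) * (2 * e1))"
    proof (rule sum_norm_le)
      fix a assume a: "a \<in> {..q}"
      have "tr (H ^ a * g ^ (q - a)) - \<mu> a * m (q - a) =
        (tr (H ^ a * g ^ (q - a)) - tr (H ^ a) * tr (g ^ (q - a))) + (tr (H ^ a) - \<mu> a) * m (q - a)"
        unfolding m_def by (simp add: algebra_simps)
      hence "cmod (tr (H ^ a * g ^ (q - a)) - \<mu> a * m (q - a)) \<le>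
        cmod (tr (H ^ a * g ^ (q - a)) - tr (H ^ a) * tr (g ^ (q - a))) + cmod (tr (H ^ a) - \<mu> a) * cmod (m (q - a))"
        by (metis norm_triangle_ineq norm_mult)
      also have "\<dots> \<le> e1 + e1 * 1"
        using Y_ind[rule_format, OF g(1,2) _ , of a "q - a"] Yg H(5)[of a] a q m_le e1
        by (intro add_mono mult_mono) (auto intro: less_imp_le)
      finally show "cmod (of_nat (q choose a) * (tr (H ^ a * g ^ (q - a)) - \<mu> a * m (q - a))) \<le> real (q choose a) * (2 * e1)"
        by (simp add: norm_mult mult_left_mono)
    qed
    also have "\<dots> \<le> P * (2 * e1)"
      unfolding sum_distrib_right[symmetric] using choose_le e1 by (intro mult_right_mono) auto
    also have "\<dots> = e / 4" unfolding e1_def using P by simp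
    finally have t3: "cmod ((\<Sum>a\<le>q. of_nat (q choose a) * tr (H ^ a * g ^ (q - a))) - binconv \<mu> m q) \<le> e / 4" .
    define S where "S = (\<Sum>a\<le>q. of_nat (q choose a) * tr (H ^ a * g ^ (q - a)))"
    have "dist (tr ((H + h) ^ q)) (binconv \<mu> m q) \<le>
        dist (tr ((H + h) ^ q)) (tr ((H + g) ^ q)) + (dist (tr ((H + g) ^ q)) S + dist S (binconv \<mu> m q))"
      by (rule order_trans[OF dist_triangle add_left_mono[OF dist_triangle]])
    moreover have "dist (tr ((H + h) ^ q)) (tr ((H + g) ^ q)) \<le> e / 8" "dist (tr ((H + g) ^ q)) S < e / 8"
      "dist S (binconv \<mu> m q) \<le> e / 4"
      using t1 t2 t3 unfolding S_def dist_norm by simp_all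
    ultimately have "dist (tr ((H + h) ^ q)) (binconv \<mu> m q) < e" using Suc.prems by linarith
    thus ?thesis by (simp add: dist_norm)
  qed
  show ?case using HhA Hhsa comm spread mom by blast
qed

end


section \<open>Complex matrices\<close>

lemma mat_adjoint_carrier [simp, intro]: "A \<in> carrier_mat n m \<Longrightarrow> mat_adjoint A \<in> carrier_mat m n"
  unfolding mat_adjoint_def by (auto simp: mat_of_rows_def)

lemma dim_mat_adjoint [simp]: "dim_row (mat_adjoint A) = dim_col A" "dim_col (mat_adjoint A) = dim_row A"
  unfolding mat_adjoint_def by (auto simp: mat_of_rows_def)

lemma mat_adjoint_index:
  fixes A :: "complex mat"
  assumes "A \<in> carrier_mat n m" "i < m" "j < n"
  shows "mat_adjoint A $$ (i, j) = cnj (A $$ (j, i))"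
  using assms unfolding mat_adjoint_def by (auto simp: mat_of_rows_def)

lemma mult_mat_index:
  assumes "A \<in> carrier_mat n m" "B \<in> carrier_mat m p" "i < n" "j < p"
  shows "(A * B) $$ (i, j) = (\<Sum>a<m. A $$ (i, a) * B $$ (a, j))"
  using assms by (auto simp: scalar_prod_def atLeast0LessThan intro!: sum.cong)

lemma mat_adjoint_adjoint [simp]:
  fixes A :: "complex mat"
  assumes "A \<in> carrier_mat n m" shows "mat_adjoint (mat_adjoint A) = A"
  by (rule eq_matI) (use assms mat_adjoint_carrier[OF assms] mat_adjoint_carrier[OF mat_adjoint_carrier[OF assms]]
      in \<open>auto simp: mat_adjoint_index[of _ n m] mat_adjoint_index[of _ m n]\<close>)

lemma mat_adjoint_mult:
  fixes A B :: "complex mat"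
  assumes A: "A \<in> carrier_mat n m" and B: "B \<in> carrier_mat m p"
  shows "mat_adjoint (A * B) = mat_adjoint B * mat_adjoint A"
proof (rule eq_matI)
  fix i j assume "i < dim_row (mat_adjoint B * mat_adjoint A)" "j < dim_col (mat_adjoint B * mat_adjoint A)"
  hence ij: "i < p" "j < n" using mat_adjoint_carrier[OF A] mat_adjoint_carrier[OF B] by auto
  have "mat_adjoint (A * B) $$ (i, j) = cnj (\<Sum>a<m. A $$ (j, a) * B $$ (a, i))"
    using ij by (simp add: mat_adjoint_index[OF mult_carrier_mat[OF A B]] mult_mat_index[OF A B])
  also have "\<dots> = (\<Sum>a<m. mat_adjoint B $$ (i, a) * mat_adjoint A $$ (a, j))"
    using ij by (auto simp: mat_adjoint_index[OF A] mat_adjoint_index[OF B] mult.commute intro!: sum.cong)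
  also have "\<dots> = (mat_adjoint B * mat_adjoint A) $$ (i, j)"
    using ij by (simp add: mult_mat_index[OF mat_adjoint_carrier[OF B] mat_adjoint_carrier[OF A]])
  finally show "mat_adjoint (A * B) $$ (i, j) = (mat_adjoint B * mat_adjoint A) $$ (i, j)" .
qed (use mat_adjoint_carrier[OF A] mat_adjoint_carrier[OF B] mat_adjoint_carrier[OF mult_carrier_mat[OF A B]] in auto)

lemma mat_adjoint_add:
  fixes A B :: "complex mat"
  assumes "A \<in> carrier_mat n m" "B \<in> carrier_mat n m"
  shows "mat_adjoint (A + B) = mat_adjoint A + mat_adjoint B"
  by (rule eq_matI)
     (use assms mat_adjoint_carrier[OF assms(1)] mat_adjoint_carrier[OF assms(2)] mat_adjoint_carrier[OF add_carrier_mat[OF assms(2), of A]]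
      in \<open>auto simp: mat_adjoint_index[of _ n m]\<close>)

lemma mat_adjoint_smult:
  fixes A :: "complex mat"
  assumes "A \<in> carrier_mat n m"
  shows "mat_adjoint (c \<cdot>\<^sub>m A) = cnj c \<cdot>\<^sub>m mat_adjoint A"
  by (rule eq_matI)
     (use assms mat_adjoint_carrier[OF assms(1)] mat_adjoint_carrier[OF smult_carrier_mat[OF assms, of c]]
      in \<open>auto simp: mat_adjoint_index[of _ n m]\<close>)

lemma mat_adjoint_one [simp]: "mat_adjoint (1\<^sub>m n :: complex mat) = 1\<^sub>m n"
  by (rule eq_matI) (use mat_adjoint_carrier[OF one_carrier_mat, of n] in \<open>auto simp: mat_adjoint_index[of _ n n]\<close>)

lemma mult_carrier_square [simp, intro]:
  "A \<in> carrier_mat k k \<Longrightarrow> B \<in> carrier_mat k k \<Longrightarrow> A * B \<in> carrier_mat k k"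
  by (rule mult_carrier_mat)

lemma assoc_mult_square:
  "A \<in> carrier_mat k k \<Longrightarrow> B \<in> carrier_mat k k \<Longrightarrow> C \<in> carrier_mat k k \<Longrightarrow> A * B * C = A * (B * C)"
  by (rule assoc_mult_mat)

lemma unitary_group_carrier:
  "W \<in> unitary_group k \<Longrightarrow> W \<in> carrier_mat k k \<and> mat_adjoint W \<in> carrier_mat k k"
  unfolding unitary_group_def by auto

lemma unitary_cancel:
  assumes W: "W \<in> unitary_group k" and X: "X \<in> carrier_mat k k"
  shows "W * (mat_adjoint W * X) = X" "mat_adjoint W * (W * X) = X"
proof -
  have c: "W \<in> carrier_mat k k" "mat_adjoint W \<in> carrier_mat k k"
    and e: "mat_adjoint W * W = 1\<^sub>m k" "W * mat_adjoint W = 1\<^sub>m k" using W unfolding unitary_group_def by auto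
  show "W * (mat_adjoint W * X) = X" using assoc_mult_square[OF c(1) c(2) X] e X by simp
  show "mat_adjoint W * (W * X) = X" using assoc_mult_square[OF c(2) c(1) X] e X by simp
qed

lemma unitary_group_mult:
  assumes U: "U \<in> unitary_group k" and W: "W \<in> unitary_group k"
  shows "U * W \<in> unitary_group k"
proof -
  note c = unitary_group_carrier[OF U] unitary_group_carrier[OF W]
  have "mat_adjoint W * mat_adjoint U * (U * W) = 1\<^sub>m k" "U * W * (mat_adjoint W * mat_adjoint U) = 1\<^sub>m k"
    using c U W by (simp_all add: assoc_mult_square[of _ k] unitary_cancel) (simp_all add: unitary_group_def)
  thus ?thesis
    using c by (simp add: unitary_group_def mat_adjoint_mult[of _ k k _ k])
qed

lemma unitary_group_adjoint: "W \<in> unitary_group k \<Longrightarrow> mat_adjoint W \<in> unitary_group k"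
  unfolding unitary_group_def by auto

section \<open>Diagonalisation of hermitian matrices\<close>

lemma unitary_with_first_column:
  fixes v :: "complex vec"
  assumes v: "v \<in> carrier_vec n" "v \<noteq> 0\<^sub>v n" and n: "n > 0"
  shows "\<exists>W\<in>unitary_group n. \<exists>c. col W 0 = c \<cdot>\<^sub>v v"
proof -
  interpret cof_vec_space n "TYPE(complex)" .
  define b where "b = basis_completion v"
  define ws where "ws = gram_schmidt n b"
  define W0 where "W0 = mat_of_cols n ws"
  note bc = basis_completion[OF v, folded b_def]
  then obtain vs where bv: "b = v # vs" using n by (cases b) auto
  from gram_schmidt_result[OF bc(2) bc(4) bc(5) ws_def]
  have ws: "set ws \<subseteq> carrier_vec n" "corthogonal ws" "length ws = n" using bc by auto
  have hd: "hd ws = v" unfolding ws_def bv by (rule gram_schmidt_hd[OF v(1)])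
  have W0: "W0 \<in> carrier_mat n n" using ws unfolding W0_def by (metis mat_of_cols_carrier(1))
  have orth: "corthogonal_mat W0" using orthogonal_mat_of_cols ws unfolding W0_def .
  have col0: "col W0 0 = v" unfolding W0_def using ws hd n
    by (metis col_mat_of_cols hd_conv_nth length_greater_0_conv nth_mem subsetD)
  define g where "g i j = (\<Sum>a<n. cnj (W0 $$ (a, i)) * W0 $$ (a, j))" for i j
  have g: "g i j = col W0 j \<bullet>c col W0 i" if "i < n" "j < n" for i j
    unfolding g_def using W0 that
    by (auto simp: scalar_prod_def atLeast0LessThan mult.commute intro!: sum.cong)
  have g0: "g i j = 0" if "i < n" "j < n" "i \<noteq> j" for i j
    using g[OF that(1,2)] corthogonal_matD[OF orth, of j i] W0 that by auto
  define s where "s i = (\<Sum>a<n. (cmod (W0 $$ (a, i)))\<^sup>2)" for i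
  have gs: "g i i = complex_of_real (s i)" for i
    unfolding g_def s_def of_real_sum complex_norm_square by (simp add: mult.commute)
  have s: "s i > 0" if "i < n" for i
  proof -
    have "g i i \<noteq> 0" using g[OF that that] corthogonal_matD[OF orth, of i i] W0 that by auto
    hence "s i \<noteq> 0" using gs by simp
    moreover have "s i \<ge> 0" unfolding s_def by (simp add: sum_nonneg)
    ultimately show ?thesis by simp
  qed
  \<comment> \<open>\<open>gram_schmidt\<close> returns orthogonal columns without normalising them;
    \<open>r\<close> holds their lengths.\<close>
  define r where "r i = complex_of_real (sqrt (s i))" for i
  define W where "W = mat n n (\<lambda>(i, j). W0 $$ (i, j) / r j)"
  have W: "W \<in> carrier_mat n n" unfolding W_def by simp
  have rr: "r i * r i = complex_of_real (s i)" "cnj (r i) = r i" "r i \<noteq> 0" if "i < n" for i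
    using s[OF that] unfolding r_def by (simp_all flip: of_real_mult)
  have WW: "mat_adjoint W * W = 1\<^sub>m n"
  proof (rule eq_matI)
    fix i j assume "i < dim_row (1\<^sub>m n)" "j < dim_col (1\<^sub>m n)"
    hence ij: "i < n" "j < n" by auto
    have "(mat_adjoint W * W) $$ (i, j) = (\<Sum>a<n. cnj (W0 $$ (a, i)) / r i * (W0 $$ (a, j) / r j))"
      using ij rr(2) by (simp add: mult_mat_index[OF mat_adjoint_carrier[OF W] W] mat_adjoint_index[OF W])
         (auto simp: W_def intro!: sum.cong)
    also have "\<dots> = g i j / (r i * r j)" unfolding g_def by (simp add: sum_divide_distrib)
    also have "\<dots> = (if i = j then 1 else 0)" using g0[OF ij] gs rr ij s[OF ij(1)] by auto
    finally show "(mat_adjoint W * W) $$ (i, j) = 1\<^sub>m n $$ (i, j)" using ij by simp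
  qed (use mat_adjoint_carrier[OF W] W in auto)
  hence "W * mat_adjoint W = 1\<^sub>m n" by (rule mat_mult_left_right_inverse[OF mat_adjoint_carrier[OF W] W])
  hence "W \<in> unitary_group n" unfolding unitary_group_def using W WW by simp
  moreover have "col W 0 = (1 / r 0) \<cdot>\<^sub>v v"
    unfolding col0[symmetric] using W W0 n by (intro eq_vecI) (auto simp: W_def)
  ultimately show ?thesis by blast
qed

definition diag_real :: "nat \<Rightarrow> (nat \<Rightarrow> real) \<Rightarrow> complex mat" where
  "diag_real k d = mat k k (\<lambda>(i, j). if i = j then complex_of_real (d i) else 0)"

lemma diag_real_carrier [simp]: "diag_real k d \<in> carrier_mat k k"
  unfolding diag_real_def by simp

text \<open>Deflation: in an orthonormal basis that begins with an eigenvector, the first column is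
  a multiple of the first unit vector. By hermiticity so is the first row, and a hermitian block of
  size \<open>k\<close> remains.\<close>

theorem hermitian_diagonalization:
  fixes A :: "complex mat"
  assumes "A \<in> carrier_mat k k" "mat_adjoint A = A"
  shows "\<exists>W\<in>unitary_group k. \<exists>d. mat_adjoint W * A * W = diag_real k d"
  using assms
proof (induction k arbitrary: A)
  case 0
  have "1\<^sub>m 0 \<in> unitary_group 0" unfolding unitary_group_def by auto
  moreover have "mat_adjoint (1\<^sub>m 0) * A * 1\<^sub>m 0 = diag_real 0 (\<lambda>_. 0)"
    using 0 by (intro eq_matI) (auto simp: diag_real_def)
  ultimately show ?case by blast
next
  case (Suc k)
  note A = Suc.prems(1) and herm = Suc.prems(2)
  obtain e where "eigenvalue A e" using spectrum_non_empty[OF A] unfolding spectrum_def by auto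
  then obtain v where v: "v \<in> carrier_vec (Suc k)" "v \<noteq> 0\<^sub>v (Suc k)" "A *\<^sub>v v = e \<cdot>\<^sub>v v"
    unfolding eigenvalue_def eigenvector_def using A by auto
  obtain W c where W: "W \<in> unitary_group (Suc k)" and col: "col W 0 = c \<cdot>\<^sub>v v"
    using unitary_with_first_column[OF v(1,2)] by auto
  have Wc: "W \<in> carrier_mat (Suc k) (Suc k)" and WW: "mat_adjoint W * W = 1\<^sub>m (Suc k)"
    using W unfolding unitary_group_def by auto
  note aWc = mat_adjoint_carrier[OF Wc]
  define B where "B = mat_adjoint W * (A * W)"
  have AW: "A * W \<in> carrier_mat (Suc k) (Suc k)" using A Wc by simp
  have B: "B \<in> carrier_mat (Suc k) (Suc k)" unfolding B_def using aWc AW by simp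
  have Bh: "mat_adjoint B = B"
    unfolding B_def using A Wc aWc herm
    by (simp add: mat_adjoint_mult[OF aWc AW] mat_adjoint_mult[OF A Wc] mat_adjoint_adjoint[OF Wc]
        assoc_mult_mat[OF aWc A Wc])
  have "col (A * W) 0 = A *\<^sub>v (c \<cdot>\<^sub>v v)" using col col_mult2[OF A Wc, of 0] by simp
  also have "\<dots> = e \<cdot>\<^sub>v col W 0" using A v col by (simp add: mult_mat_vec smult_smult_assoc mult.commute)
  finally have colAW: "col (A * W) 0 = e \<cdot>\<^sub>v col W 0" .
  have AW0: "(A * W) $$ (a, 0) = e * W $$ (a, 0)" if "a < Suc k" for a
    using arg_cong[OF colAW, of "\<lambda>u. u $ a"] that A Wc AW by simp
  have B0: "B $$ (i, 0) = (if i = 0 then e else 0)" if "i < Suc k" for i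
  proof -
    have "B $$ (i, 0) = (\<Sum>a<Suc k. mat_adjoint W $$ (i, a) * (A * W) $$ (a, 0))"
      unfolding B_def using that by (intro mult_mat_index[OF aWc AW]) auto
    also have "\<dots> = e * (\<Sum>a<Suc k. mat_adjoint W $$ (i, a) * W $$ (a, 0))"
      unfolding sum_distrib_left using AW0 by (intro sum.cong) (auto simp: mult_ac)
    also have "\<dots> = e * (mat_adjoint W * W) $$ (i, 0)"
      using that mult_mat_index[OF aWc Wc, of i 0] by simp
    finally show ?thesis using that by (simp add: WW)
  qed
  have B0': "B $$ (0, i) = cnj (B $$ (i, 0))" if "i < Suc k" for i
    using mat_adjoint_index[OF B, of 0 i] that Bh by simp
  have ce: "cnj e = e" using B0'[of 0] B0[of 0] by simp
  have e: "e = complex_of_real (Re e)" using B0'[of 0] B0[of 0] by (simp add: complex_eq_iff)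
  define A' where "A' = mat k k (\<lambda>(i, j). B $$ (Suc i, Suc j))"
  have A': "A' \<in> carrier_mat k k" unfolding A'_def by simp
  have "mat_adjoint A' = A'"
  proof (rule eq_matI)
    fix i j assume "i < dim_row A'" "j < dim_col A'"
    hence ij: "i < k" "j < k" using A' by auto
    have "cnj (B $$ (Suc j, Suc i)) = B $$ (Suc i, Suc j)"
      using mat_adjoint_index[OF B, of "Suc i" "Suc j"] ij Bh by simp
    thus "mat_adjoint A' $$ (i, j) = A' $$ (i, j)"
      using ij mat_adjoint_index[OF A', of i j] by (simp add: A'_def)
  qed (use A' mat_adjoint_carrier[OF A'] in auto)
  from Suc.IH[OF A' this] obtain W' d' where W': "W' \<in> unitary_group k" "mat_adjoint W' * A' * W' = diag_real k d'"
    by blast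
  have W'c: "W' \<in> carrier_mat k k" "mat_adjoint W' * W' = 1\<^sub>m k" "W' * mat_adjoint W' = 1\<^sub>m k"
    using W' unfolding unitary_group_def by auto
  note aW'c = mat_adjoint_carrier[OF W'c(1)]
  define emb where "emb X C = four_block_mat (X :: complex mat) (0\<^sub>m 1 k) (0\<^sub>m k 1) (C :: complex mat)" for X C
  have emb_mult: "emb X C * emb Y D = emb (X * Y) (C * D)"
    if "C \<in> carrier_mat k k" "D \<in> carrier_mat k k" "X \<in> carrier_mat 1 1" "Y \<in> carrier_mat 1 1" for C D X Y
    unfolding emb_def using that
    by (subst mult_four_block_mat[of _ 1 1 _ k _ k _ _ 1 _ k]) auto
  have emb_adj: "mat_adjoint (emb (1\<^sub>m 1) W') = emb (1\<^sub>m 1) (mat_adjoint W')"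
  proof -
    have ec: "emb (1\<^sub>m 1) W' \<in> carrier_mat (Suc k) (Suc k)" "emb (1\<^sub>m 1) (mat_adjoint W') \<in> carrier_mat (Suc k) (Suc k)"
      unfolding emb_def using W'c aW'c by auto
    show ?thesis
    proof (rule eq_matI)
    fix i j assume "i < dim_row (emb (1\<^sub>m 1) (mat_adjoint W'))" "j < dim_col (emb (1\<^sub>m 1) (mat_adjoint W'))"
    hence ij: "i < Suc k" "j < Suc k" using ec by auto
    show "mat_adjoint (emb (1\<^sub>m 1) W') $$ (i, j) = emb (1\<^sub>m 1) (mat_adjoint W') $$ (i, j)"
      using ij W'c aW'c unfolding mat_adjoint_index[OF ec(1) ij]
      by (auto simp: emb_def mat_adjoint_index[OF W'c(1)])
    qed (use ec in auto)
  qed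
  have emb_one: "emb (1\<^sub>m 1) (1\<^sub>m k) = 1\<^sub>m (Suc k)"
    unfolding emb_def by (rule eq_matI) auto
  define E where "E = mat 1 1 (\<lambda>_. e)"
  have E: "E \<in> carrier_mat 1 1" unfolding E_def by simp
  have B_eq: "B = emb E A'"
    unfolding emb_def E_def using B
    by (intro eq_matI) (auto simp: A'_def B0 B0' ce not_less_eq_eq Suc_le_eq less_Suc_eq_0_disj)
  define V where "V = emb (1\<^sub>m 1) W'"
  have Vc: "V \<in> carrier_mat (Suc k) (Suc k)" unfolding V_def emb_def using W'c by auto
  note aVc = mat_adjoint_carrier[OF Vc]
  have "mat_adjoint V * V = 1\<^sub>m (Suc k)" "V * mat_adjoint V = 1\<^sub>m (Suc k)"
    unfolding V_def emb_adj
    using emb_mult[OF aW'c W'c(1) one_carrier_mat one_carrier_mat] emb_mult[OF W'c(1) aW'c one_carrier_mat one_carrier_mat]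
      W'c emb_one by simp_all
  hence V: "V \<in> unitary_group (Suc k)" unfolding unitary_group_def using Vc by simp
  have "mat_adjoint (W * V) * A * (W * V) = mat_adjoint V * (B * V)"
    unfolding B_def mat_adjoint_mult[OF Wc Vc] using A Wc Vc aWc aVc
    by (simp add: assoc_mult_mat[of _ "Suc k" "Suc k" _ "Suc k" _ "Suc k"])
  also have "\<dots> = emb E (mat_adjoint W' * A' * W')"
    unfolding B_eq V_def emb_adj using E A' W'c aW'c
    by (simp add: emb_mult assoc_mult_mat[OF aW'c A' W'c(1)])
  also have "\<dots> = diag_real (Suc k) (\<lambda>i. case i of 0 \<Rightarrow> Re e | Suc i \<Rightarrow> d' i)"
    unfolding W'(2) emb_def E_def diag_real_def using e
    by (intro eq_matI) (auto simp: less_Suc_eq_0_disj split: if_splits)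
  finally show ?case using unitary_group_mult[OF W V] by blast
qed

subsection \<open>Normalized traces\<close>

lemma tau_mat_add: "A \<in> carrier_mat k k \<Longrightarrow> B \<in> carrier_mat k k \<Longrightarrow> tau_mat k (A + B) = tau_mat k A + tau_mat k B"
  unfolding tau_mat_def by (simp add: sum.distrib add_divide_distrib)

lemma tau_mat_smult: "A \<in> carrier_mat k k \<Longrightarrow> tau_mat k (c \<cdot>\<^sub>m A) = c * tau_mat k A"
  unfolding tau_mat_def by (simp add: sum_distrib_left)

lemma tau_mat_one: "k > 0 \<Longrightarrow> tau_mat k (1\<^sub>m k) = 1"
  unfolding tau_mat_def by simp

lemma tau_mat_commute:
  assumes "A \<in> carrier_mat k k" "B \<in> carrier_mat k k"
  shows "tau_mat k (A * B) = tau_mat k (B * A)"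
proof -
  have "(\<Sum>i<k. (A * B) $$ (i, i)) = (\<Sum>i<k. \<Sum>a<k. A $$ (i, a) * B $$ (a, i))"
    by (intro sum.cong refl mult_mat_index[OF assms]) auto
  also have "\<dots> = (\<Sum>a<k. \<Sum>i<k. B $$ (a, i) * A $$ (i, a))" by (subst sum.swap) (simp add: mult.commute)
  also have "\<dots> = (\<Sum>a<k. (B * A) $$ (a, a))"
    by (intro sum.cong refl mult_mat_index[OF assms(2,1), symmetric]) auto
  finally show ?thesis unfolding tau_mat_def by simp
qed

text \<open>The square of the normalised Hilbert-Schmidt norm.\<close>

definition fro :: "nat \<Rightarrow> complex mat \<Rightarrow> real" where
  "fro k B = (\<Sum>i<k. \<Sum>j<k. (cmod (B $$ (i, j)))\<^sup>2) / real k"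

lemma tau_mat_adjoint_mult:
  assumes "B \<in> carrier_mat k k"
  shows "tau_mat k (mat_adjoint B * B) = complex_of_real (fro k B)"
proof -
  have "(\<Sum>i<k. (mat_adjoint B * B) $$ (i, i)) = (\<Sum>i<k. \<Sum>a<k. complex_of_real ((cmod (B $$ (a, i)))\<^sup>2))"
  proof (intro sum.cong refl)
    fix i assume i: "i \<in> {..<k}"
    have "(mat_adjoint B * B) $$ (i, i) = (\<Sum>a<k. mat_adjoint B $$ (i, a) * B $$ (a, i))"
      using i by (intro mult_mat_index[OF mat_adjoint_carrier[OF assms] assms]) auto
    also have "\<dots> = (\<Sum>a<k. complex_of_real ((cmod (B $$ (a, i)))\<^sup>2))"
      using i by (intro sum.cong refl, subst mat_adjoint_index[OF assms]) (auto simp only: complex_norm_square mult.commute lessThan_iff)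
    finally show "(mat_adjoint B * B) $$ (i, i) = (\<Sum>a<k. complex_of_real ((cmod (B $$ (a, i)))\<^sup>2))" .
  qed
  also have "\<dots> = complex_of_real (\<Sum>i<k. \<Sum>a<k. (cmod (B $$ (a, i)))\<^sup>2)" by simp
  also have "(\<Sum>i<k. \<Sum>a<k. (cmod (B $$ (a, i)))\<^sup>2) = (\<Sum>a<k. \<Sum>i<k. (cmod (B $$ (a, i)))\<^sup>2)" by (rule sum.swap)
  finally show ?thesis unfolding tau_mat_def fro_def by simp
qed

lemma tau_mat_conj:
  assumes W: "W \<in> unitary_group k" and B: "B \<in> carrier_mat k k"
  shows "tau_mat k (mat_adjoint W * B * W) = tau_mat k B"
proof -
  note c = unitary_group_carrier[OF W]
  have "tau_mat k (mat_adjoint W * B * W) = tau_mat k (W * (mat_adjoint W * B))"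
    using c B by (intro tau_mat_commute) auto
  thus ?thesis using unitary_cancel[OF W B] by simp
qed

lemma fro_conj:
  assumes W: "W \<in> unitary_group k" and B: "B \<in> carrier_mat k k"
  shows "fro k (mat_adjoint W * B * W) = fro k B"
proof -
  note c = unitary_group_carrier[OF W]
  have aB: "mat_adjoint B \<in> carrier_mat k k" using B by simp
  have "mat_adjoint (mat_adjoint W * B * W) * (mat_adjoint W * B * W) = mat_adjoint W * (mat_adjoint B * B) * W"
    using c B aB W by (simp add: assoc_mult_square[of _ k] mat_adjoint_mult[of _ k k _ k] mat_adjoint_adjoint[OF conjunct1[OF c]] unitary_cancel)
  hence "complex_of_real (fro k (mat_adjoint W * B * W)) = complex_of_real (fro k B)"
    using tau_mat_conj[OF W, of "mat_adjoint B * B"] tau_mat_adjoint_mult[OF B] tau_mat_adjoint_mult[of "mat_adjoint W * B * W" k] c B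
    by simp
  thus ?thesis using of_real_eq_iff by blast
qed


section \<open>Counting close pairs through moments\<close>

text \<open>The characteristic function of the uniform distribution on the first \<open>k\<close>
  values of \<open>d\<close>, which will be the eigenvalues of a matrix.\<close>

definition charfun :: "nat \<Rightarrow> (nat \<Rightarrow> real) \<Rightarrow> real \<Rightarrow> complex" where
  "charfun k d t = (\<Sum>i<k. exp (\<i> * complex_of_real (t * d i))) / of_nat k"

definition moment :: "nat \<Rightarrow> (nat \<Rightarrow> real) \<Rightarrow> nat \<Rightarrow> real" where
  "moment k d q = (\<Sum>i<k. d i ^ q) / real k"

lemma norm_charfun_le: "cmod (charfun k d t) \<le> 1"
proof (cases "k = 0")
  case False
  have "cmod (\<Sum>i<k. exp (\<i> * complex_of_real (t * d i))) \<le> (\<Sum>i<k. 1)"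
    by (rule sum_norm_le) (simp add: norm_exp_eq_Re)
  thus ?thesis unfolding charfun_def using False by (simp add: norm_divide divide_le_eq)
qed (simp add: charfun_def)

text \<open>For odd \<open>n\<close> the power \<open>\<bar>d i\<bar> ^ Suc n\<close> equals
  \<open>d i ^ Suc n\<close>, so the averaged Taylor remainder is itself a moment. This controls
  large values of \<open>d\<close> through moments alone.\<close>

lemma charfun_taylor:
  assumes k: "k > 0" and t: "\<bar>t\<bar> \<le> 1" and n: "odd n"
  shows "cmod (charfun k d t - (\<Sum>q\<le>n. (\<i> * complex_of_real t) ^ q / fact q * complex_of_real (moment k d q)))
    \<le> moment k d (Suc n) / fact n"
proof -
  have eq: "(\<Sum>q\<le>n. (\<i> * complex_of_real t) ^ q / fact q * complex_of_real (moment k d q)) =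
    (\<Sum>i<k. \<Sum>q\<le>n. (\<i> * complex_of_real (t * d i)) ^ q / fact q) / of_nat k"
    unfolding moment_def of_real_divide of_real_sum of_real_of_nat_eq
    by (subst sum.swap) (simp add: sum_distrib_left sum_divide_distrib power_mult_distrib mult_ac)
  have "cmod (charfun k d t - (\<Sum>q\<le>n. (\<i> * complex_of_real t) ^ q / fact q * complex_of_real (moment k d q))) =
    cmod (\<Sum>i<k. exp (\<i> * complex_of_real (t * d i)) - (\<Sum>q\<le>n. (\<i> * complex_of_real (t * d i)) ^ q / fact q)) / real k"
    unfolding eq charfun_def by (simp add: sum_subtractf diff_divide_distrib[symmetric] norm_divide)
  also have "\<dots> \<le> (\<Sum>i<k. d i ^ Suc n / fact n) / real k"
  proof (intro divide_right_mono sum_norm_le)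
    fix i
    have "cmod (exp (\<i> * complex_of_real (t * d i)) - (\<Sum>q\<le>n. (\<i> * complex_of_real (t * d i)) ^ q / fact q))
      \<le> \<bar>t * d i\<bar> ^ Suc n / fact n"
      using Taylor_exp[of "\<i> * complex_of_real (t * d i)" n] by (simp add: norm_mult abs_mult)
    also have "\<bar>t * d i\<bar> ^ Suc n \<le> \<bar>d i\<bar> ^ Suc n"
      using t by (intro power_mono) (auto simp: abs_mult mult_left_le_one_le)
    also have "\<bar>d i\<bar> ^ Suc n = d i ^ Suc n" using n by (intro power_even_abs) simp
    finally show "cmod (exp (\<i> * complex_of_real (t * d i)) - (\<Sum>q\<le>n. (\<i> * complex_of_real (t * d i)) ^ q / fact q)) \<le> d i ^ Suc n / fact n"
      by (simp add: divide_right_mono)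
  qed simp
  also have "\<dots> = moment k d (Suc n) / fact n"
    unfolding moment_def by (simp add: sum_divide_distrib[symmetric])
  finally show ?thesis .
qed

text \<open>Provides one odd degree that makes the truncation errors in
  \<open>charfun_le_of_moments\<close> small at once.\<close>

lemma exp_tail_small:
  fixes x e :: real
  assumes "e > 0"
  shows "\<exists>n. odd n \<and> x ^ Suc n / fact n < e \<and> 1 / fact n < e \<and> (\<Sum>q. x ^ (q + Suc n) / fact (q + Suc n)) < e"
proof -
  define f where "f q = x ^ q / fact q" for q
  have sf: "summable f" unfolding f_def by (rule summable_exp_terms)
  have l1: "(\<lambda>n. x * f n) \<longlonglongrightarrow> 0" using tendsto_mult_right_zero[OF summable_LIMSEQ_zero[OF sf]] .
  have l2: "(\<lambda>n. 1 ^ n / fact n :: real) \<longlonglongrightarrow> 0" by (rule summable_LIMSEQ_zero[OF summable_exp_terms])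
  have "(\<lambda>n. \<Sum>q. f (q + n)) \<longlonglongrightarrow> 0" using suminf_exist_split2[OF sf] .
  hence l3: "(\<lambda>n. \<Sum>q. f (q + Suc n)) \<longlonglongrightarrow> 0" using LIMSEQ_Suc[of "\<lambda>n. \<Sum>q. f (q + n)"] by simp
  have "eventually (\<lambda>n. x * f n < e \<and> 1 ^ n / fact n < e \<and> (\<Sum>q. f (q + Suc n)) < e) sequentially"
    using order_tendstoD(2)[OF l1 assms] order_tendstoD(2)[OF l2 assms] order_tendstoD(2)[OF l3 assms]
    by eventually_elim simp
  then obtain N where N: "\<And>n. n \<ge> N \<Longrightarrow> x * f n < e \<and> 1 ^ n / fact n < e \<and> (\<Sum>q. f (q + Suc n)) < e"
    unfolding eventually_sequentially by blast
  show ?thesis by (rule exI[of _ "2 * N + 1"]) (use N[of "2 * N + 1"] in \<open>auto simp: f_def\<close>)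
qed

text \<open>Both characteristic functions are compared with their Taylor polynomials of degree
  \<open>n\<close>. Four errors of \<kappa>/4 arise: two from the remainder for \<open>d\<close>,
  which is a moment of order \<open>n + 1\<close> and explains \<open>Suc n\<close> as the choice
  for \<open>Q\<close>, one from the coefficients and one from the tail of
  \<open>mgf\<close>.\<close>

lemma charfun_le_of_moments:
  assumes "\<kappa> > 0"
  shows "\<exists>Q e. e > 0 \<and> (\<forall>k d \<mu> t. k > 0 \<longrightarrow> spread_moments s \<mu> \<longrightarrow>
    (\<forall>q\<le>Q. cmod (complex_of_real (moment k d q) - \<mu> q) < e) \<longrightarrow> \<bar>t\<bar> \<le> 1 \<longrightarrow>
    cmod (charfun k d t) \<le> (1 - t\<^sup>2 / 8) ^ s + \<kappa>)"
proof -
  obtain n where n: "odd n" "real s ^ Suc n / fact n < \<kappa> / 4" "1 / fact n < \<kappa> / 4"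
    "(\<Sum>q. real s ^ (q + Suc n) / fact (q + Suc n)) < \<kappa> / 4"
    using exp_tail_small[of "\<kappa> / 4" "real s"] assms by auto
  define e where "e = min 1 (\<kappa> / (4 * (real n + 1)))"
  have e: "e > 0" "e \<le> 1" unfolding e_def using assms by auto
  have en: "(real n + 1) * e \<le> \<kappa> / 4"
  proof -
    have "(real n + 1) * e \<le> (real n + 1) * (\<kappa> / (4 * (real n + 1)))" unfolding e_def by (intro mult_left_mono) auto
    also have "\<dots> = \<kappa> / 4" by (simp add: field_simps)
    finally show ?thesis .
  qed
  show ?thesis
  proof (intro exI[of _ "Suc n"] exI[of _ e] conjI allI impI e)
    fix k d \<mu> and t :: real
    assume k: "k > 0" and sp: "spread_moments s \<mu>" and t: "\<bar>t\<bar> \<le> 1"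
      and mom: "\<forall>q\<le>Suc n. cmod (complex_of_real (moment k d q) - \<mu> q) < e"
    have \<mu>_le: "cmod (\<mu> q) \<le> real s ^ q" for q using sp unfolding spread_moments_def by blast
    define z where "z = \<i> * complex_of_real t"
    have z: "cmod z \<le> 1" unfolding z_def using t by (simp add: norm_mult)
    define F where "F \<nu> = (\<Sum>q\<le>n. z ^ q / fact q * \<nu> q)" for \<nu> :: "nat \<Rightarrow> complex"
    define m where "m q = complex_of_real (moment k d q)" for q
    have "cmod (charfun k d t - F m) \<le> moment k d (Suc n) / fact n"
      unfolding F_def m_def z_def by (rule charfun_taylor[OF k t n(1)])
    also have "moment k d (Suc n) \<le> real s ^ Suc n + 1"
    proof -
      have "moment k d (Suc n) \<le> cmod (complex_of_real (moment k d (Suc n)))" by simp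
      also have "\<dots> \<le> cmod (\<mu> (Suc n)) + cmod (complex_of_real (moment k d (Suc n)) - \<mu> (Suc n))"
        by (metis norm_triangle_sub)
      also have "\<dots> \<le> real s ^ Suc n + 1" using mom e \<mu>_le[of "Suc n"] by (intro add_mono) force+
      finally show ?thesis .
    qed
    finally have 1: "cmod (charfun k d t - F m) \<le> real s ^ Suc n / fact n + 1 / fact n"
      by (simp add: add_divide_distrib divide_right_mono)
    have "cmod (F m - F \<mu>) = cmod (\<Sum>q\<le>n. z ^ q / fact q * (m q - \<mu> q))"
      unfolding F_def by (simp add: sum_subtractf right_diff_distrib)
    also have "\<dots> \<le> (\<Sum>q\<le>n. e)"
    proof (rule sum_norm_le)
      fix q assume q: "q \<in> {..n}"
      have "cmod z ^ q \<le> fact q" using power_le_one[OF norm_ge_zero z, of q] fact_ge_1[of q] order_trans by (metis (no_types) of_nat_fact)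
      hence "cmod (z ^ q / fact q) \<le> 1" by (simp add: norm_divide norm_power norm_fact)
      moreover have "cmod (m q - \<mu> q) \<le> e" unfolding m_def using mom q by (auto intro: less_imp_le)
      ultimately have "cmod (z ^ q / fact q) * cmod (m q - \<mu> q) \<le> 1 * e" by (intro mult_mono) auto
      thus "cmod (z ^ q / fact q * (m q - \<mu> q)) \<le> e" by (simp only: norm_mult mult_1)
    qed
    also have "\<dots> \<le> \<kappa> / 4" using en by (simp add: algebra_simps)
    finally have 2: "cmod (F m - F \<mu>) \<le> \<kappa> / 4" .
    have sm: "summable (\<lambda>q. norm (z ^ q / fact q * \<mu> q))" unfolding z_def by (rule summable_norm_mgf[OF \<mu>_le])
    have "mgf \<mu> t = (\<Sum>q. z ^ (q + Suc n) / fact (q + Suc n) * \<mu> (q + Suc n)) + (\<Sum>q<Suc n. z ^ q / fact q * \<mu> q)"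
      unfolding mgf_def z_def[symmetric] by (rule suminf_split_initial_segment[OF summable_norm_cancel[OF sm]])
    hence "mgf \<mu> t - F \<mu> = (\<Sum>q. z ^ (q + Suc n) / fact (q + Suc n) * \<mu> (q + Suc n))"
      unfolding F_def lessThan_Suc_atMost by simp
    also have "cmod \<dots> \<le> (\<Sum>q. real s ^ (q + Suc n) / fact (q + Suc n))"
    proof (rule norm_suminf_le)
      fix q
      have "norm (z ^ (q + Suc n) / fact (q + Suc n) * \<mu> (q + Suc n)) \<le> (\<bar>t\<bar> * real s) ^ (q + Suc n) / fact (q + Suc n)"
        unfolding z_def by (rule mgf_term_le[OF \<mu>_le])
      also have "\<dots> \<le> real s ^ (q + Suc n) / fact (q + Suc n)"
        using t by (intro divide_right_mono power_mono mult_left_le_one_le) auto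
      finally show "norm (z ^ (q + Suc n) / fact (q + Suc n) * \<mu> (q + Suc n)) \<le> real s ^ (q + Suc n) / fact (q + Suc n)" .
      show "summable (\<lambda>q. real s ^ (q + Suc n) / fact (q + Suc n))"
        using summable_ignore_initial_segment[OF summable_exp_terms[of "real s"], of "Suc n"] by simp
    qed
    finally have 3: "cmod (mgf \<mu> t - F \<mu>) \<le> \<kappa> / 4" using n(4) by simp
    have "cmod (charfun k d t) \<le> cmod (mgf \<mu> t) + (cmod (charfun k d t - F m) + (cmod (F m - F \<mu>) + cmod (mgf \<mu> t - F \<mu>)))"
    proof -
      have "dist (charfun k d t) (mgf \<mu> t) \<le> dist (charfun k d t) (F m) + (dist (F m) (F \<mu>) + dist (F \<mu>) (mgf \<mu> t))"
        by (rule order_trans[OF dist_triangle add_left_mono[OF dist_triangle]])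
      moreover have "cmod (charfun k d t) \<le> cmod (mgf \<mu> t) + cmod (charfun k d t - mgf \<mu> t)" by (rule norm_triangle_sub)
      ultimately show ?thesis by (simp add: dist_norm norm_minus_commute[of "F \<mu>" "mgf \<mu> t"])
    qed
    moreover have "cmod (mgf \<mu> t) \<le> (1 - t\<^sup>2 / 8) ^ s" using sp t unfolding spread_moments_def by blast
    ultimately show "cmod (charfun k d t) \<le> (1 - t\<^sup>2 / 8) ^ s + \<kappa>" using 1 2 3 n(2,3) by linarith
  qed
qed

lemma cos_ge_half: fixes y :: real assumes "\<bar>y\<bar> \<le> 1" shows "1 / 2 \<le> cos y"
proof -
  have "cos (pi / 3) \<le> cos \<bar>y\<bar>" using assms pi_gt3 by (intro cos_monotone_0_pi_le) auto
  thus ?thesis by (simp add: cos_60)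
qed

text \<open>
  The Fejer-type kernel \<open>|1/N \<Sum>\<^sub>a exp(i a x / N)|\<^sup>2\<close> is at least 1/4 for \<open>|x| < 1\<close>, and its sum over
  all differences \<open>x = d\<^sub>i - d\<^sub>j\<close> is a mean of values of \<open>|charfun|\<^sup>2\<close>.
\<close>

lemma close_pairs_le:
  assumes N: "N > 0" and k: "k > 0" and b: "\<And>a b. a < N \<Longrightarrow> b < N \<Longrightarrow> a \<noteq> b \<Longrightarrow> cmod (charfun k d ((real a - real b) / real N)) \<le> \<beta>"
    and \<beta>: "0 \<le> \<beta>"
  shows "real (card {(i, j). i < k \<and> j < k \<and> \<bar>d i - d j\<bar> < 1}) \<le> 4 * (real k)\<^sup>2 * (1 / real N + \<beta>)"
proof -
  define T where "T = {(i, j). i < k \<and> j < k \<and> \<bar>d i - d j\<bar> < 1}"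
  define E where "E a x = exp (\<i> * complex_of_real (real a / real N * x))" for a x
  define \<Phi> where "\<Phi> x = (cmod ((\<Sum>a<N. E a x) / of_nat N))\<^sup>2" for x
  have \<Phi>: "1 / 4 \<le> \<Phi> x" if x: "\<bar>x\<bar> < 1" for x
  proof -
    have "1 / 2 \<le> Re (E a x)" if a: "a < N" for a
    proof -
      have "\<bar>real a / real N * x\<bar> \<le> 1 * 1" using a x N unfolding abs_mult by (intro mult_mono) auto
      hence "1 / 2 \<le> cos (real a / real N * x)" by (intro cos_ge_half) simp
      thus ?thesis unfolding E_def by (simp add: Re_exp)
    qed
    hence "(\<Sum>a<N. 1 / 2) \<le> (\<Sum>a<N. Re (E a x))" by (intro sum_mono) auto
    hence "real N / 2 \<le> Re (\<Sum>a<N. E a x)" by simp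
    also have "\<dots> \<le> cmod (\<Sum>a<N. E a x)" by (rule complex_Re_le_cmod)
    finally have "1 / 2 \<le> cmod ((\<Sum>a<N. E a x) / of_nat N)" using N by (simp add: norm_divide field_simps)
    hence "(1 / 2)\<^sup>2 \<le> \<Phi> x" unfolding \<Phi>_def by (intro power_mono) auto
    thus ?thesis by (simp add: power2_eq_square)
  qed
  have prodE: "E a x * cnj (E b x) = exp (\<i> * complex_of_real ((real a - real b) / real N * x))" for a b x
    unfolding E_def by (simp add: exp_cnj exp_add[symmetric] diff_divide_distrib left_diff_distrib right_diff_distrib)
  have \<Phi>_sum: "complex_of_real (\<Phi> x) = (\<Sum>a<N. \<Sum>b<N. exp (\<i> * complex_of_real ((real a - real b) / real N * x))) / (of_nat N)\<^sup>2" for x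
  proof -
    have "complex_of_real (\<Phi> x) = ((\<Sum>a<N. E a x) / of_nat N) * cnj ((\<Sum>a<N. E a x) / of_nat N)"
      unfolding \<Phi>_def by (rule complex_norm_square)
    also have "\<dots> = (\<Sum>a<N. \<Sum>b<N. E a x * cnj (E b x)) / (of_nat N)\<^sup>2"
      by (simp add: sum_product power2_eq_square)
    finally show ?thesis by (simp only: prodE)
  qed
  have cf: "(\<Sum>i<k. \<Sum>j<k. exp (\<i> * complex_of_real (t * (d i - d j)))) = complex_of_real ((real k * cmod (charfun k d t))\<^sup>2)" for t
  proof -
    define c where "c = (\<Sum>i<k. exp (\<i> * complex_of_real (t * d i)))"
    have "(\<Sum>i<k. \<Sum>j<k. exp (\<i> * complex_of_real (t * (d i - d j)))) = c * cnj c"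
      unfolding c_def cnj_sum sum_product
      by (intro sum.cong refl) (simp add: exp_cnj exp_add[symmetric] right_diff_distrib)
    also have "\<dots> = complex_of_real ((cmod c)\<^sup>2)" by (rule complex_norm_square[symmetric])
    also have "cmod c = real k * cmod (charfun k d t)" unfolding charfun_def c_def using k by (simp add: norm_divide)
    finally show ?thesis .
  qed
  have "complex_of_real (\<Sum>i<k. \<Sum>j<k. \<Phi> (d i - d j)) =
    (\<Sum>i<k. \<Sum>j<k. \<Sum>a<N. \<Sum>b<N. exp (\<i> * complex_of_real ((real a - real b) / real N * (d i - d j)))) / (of_nat N)\<^sup>2"
    unfolding of_real_sum \<Phi>_sum sum_divide_distrib ..
  also have "(\<Sum>i<k. \<Sum>j<k. \<Sum>a<N. \<Sum>b<N. exp (\<i> * complex_of_real ((real a - real b) / real N * (d i - d j)))) =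
      (\<Sum>a<N. \<Sum>b<N. \<Sum>i<k. \<Sum>j<k. exp (\<i> * complex_of_real ((real a - real b) / real N * (d i - d j))))"
  proof -
    have swap3: "(\<Sum>j\<in>J. \<Sum>a\<in>A. \<Sum>b\<in>B. f j a b) = (\<Sum>a\<in>A. \<Sum>b\<in>B. \<Sum>j\<in>J. f j a b)" for f :: "nat \<Rightarrow> nat \<Rightarrow> nat \<Rightarrow> complex" and J A B
      by (subst sum.swap) (intro sum.cong refl sum.swap)
    have "(\<Sum>i<k. \<Sum>j<k. \<Sum>a<N. \<Sum>b<N. exp (\<i> * complex_of_real ((real a - real b) / real N * (d i - d j)))) =
      (\<Sum>i<k. \<Sum>a<N. \<Sum>b<N. \<Sum>j<k. exp (\<i> * complex_of_real ((real a - real b) / real N * (d i - d j))))"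
      by (intro sum.cong refl swap3)
    also have "\<dots> = (\<Sum>a<N. \<Sum>b<N. \<Sum>i<k. \<Sum>j<k. exp (\<i> * complex_of_real ((real a - real b) / real N * (d i - d j))))"
      by (rule swap3)
    finally show ?thesis .
  qed
  also have "\<dots> = complex_of_real (\<Sum>a<N. \<Sum>b<N. (real k * cmod (charfun k d ((real a - real b) / real N)))\<^sup>2)"
    by (simp only: cf of_real_sum)
  finally have "complex_of_real (\<Sum>i<k. \<Sum>j<k. \<Phi> (d i - d j)) =
      complex_of_real ((\<Sum>a<N. \<Sum>b<N. (real k * cmod (charfun k d ((real a - real b) / real N)))\<^sup>2) / (real N)\<^sup>2)"
    by simp
  hence eq: "(\<Sum>i<k. \<Sum>j<k. \<Phi> (d i - d j)) = (\<Sum>a<N. \<Sum>b<N. (real k * cmod (charfun k d ((real a - real b) / real N)))\<^sup>2) / (real N)\<^sup>2"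
    using of_real_eq_iff by blast
  \<comment> \<open>The term with \<open>b = a\<close> has only the trivial bound 1; it is the
    source of \<open>1 / real N\<close> in the conclusion.\<close>
  have row: "(\<Sum>b<N. (real k * cmod (charfun k d ((real a - real b) / real N)))\<^sup>2) \<le> (real k)\<^sup>2 * (1 + real N * \<beta>)" if a: "a < N" for a
  proof -
    have "(\<Sum>b<N. (real k * cmod (charfun k d ((real a - real b) / real N)))\<^sup>2) \<le> (\<Sum>b<N. (real k)\<^sup>2 * ((if a = b then 1 else 0) + \<beta>))"
    proof (rule sum_mono)
      fix b assume "b \<in> {..<N}"
      define c where "c = cmod (charfun k d ((real a - real b) / real N))"
      have c: "0 \<le> c" "c \<le> 1" unfolding c_def using norm_charfun_le by auto
      have "c\<^sup>2 \<le> (if a = b then 1 else 0) + \<beta>"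
      proof (cases "a = b")
        case True thus ?thesis using c \<beta> power_le_one[OF c, of 2] by simp
      next
        case False
        have "c\<^sup>2 \<le> c * 1" unfolding power2_eq_square using c by (intro mult_left_mono) auto
        also have "\<dots> \<le> \<beta>" using b[OF a _ False] \<open>b \<in> {..<N}\<close> unfolding c_def by simp
        finally show ?thesis using False by simp
      qed
      thus "(real k * c)\<^sup>2 \<le> (real k)\<^sup>2 * ((if a = b then 1 else 0) + \<beta>)"
        unfolding power_mult_distrib by (intro mult_left_mono) auto
    qed
    also have "\<dots> = (real k)\<^sup>2 * (\<Sum>b<N. (if a = b then 1 else 0) + \<beta>)"
      by (rule sum_distrib_left[symmetric])
    also have "(\<Sum>b<N. (if a = b then 1 else 0) + \<beta>) = 1 + real N * \<beta>"
      using a by (subst sum.distrib) simp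
    finally show ?thesis .
  qed
  have "real (card T) * (1 / 4) = (\<Sum>(i, j)\<in>T. 1 / 4)" by simp
  also have "\<dots> \<le> (\<Sum>(i, j)\<in>T. \<Phi> (d i - d j))" by (rule sum_mono) (use \<Phi> in \<open>auto simp: T_def\<close>)
  also have "\<dots> \<le> (\<Sum>(i, j)\<in>{..<k} \<times> {..<k}. \<Phi> (d i - d j))"
    by (rule sum_mono2) (auto simp: T_def \<Phi>_def)
  also have "\<dots> = (\<Sum>i<k. \<Sum>j<k. \<Phi> (d i - d j))" by (simp add: sum.cartesian_product)
  also have "\<dots> \<le> (\<Sum>a<N. (real k)\<^sup>2 * (1 + real N * \<beta>)) / (real N)\<^sup>2"
    unfolding eq by (intro divide_right_mono sum_mono row) auto
  also have "\<dots> = (real k)\<^sup>2 * (1 / real N + \<beta>)" using N by (simp add: field_simps power2_eq_square)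
  finally show ?thesis unfolding T_def by (simp add: mult_ac)
qed

text \<open>Off the diagonal the frequencies satisfy |t| \<ge> 1/N, so (1 - t^2/8)^s falls below 1/N
  for large \<open>s\<close>. With another 1/N for the comparison of moments, the kernel estimate
  becomes 4 (1/N + 2/N) = 12/N. This fixes the number \<open>s\<close> of summands in terms of
  \<eta>.\<close>

theorem close_pairs_of_moments:
  assumes \<eta>: "\<eta> > 0"
  shows "\<exists>s Q e. e > 0 \<and> (\<forall>k d \<mu>. k > 0 \<longrightarrow> spread_moments s \<mu> \<longrightarrow>
    (\<forall>q\<le>Q. cmod (complex_of_real (moment k d q) - \<mu> q) < e) \<longrightarrow>
    real (card {(i, j). i < k \<and> j < k \<and> \<bar>d i - d j\<bar> < 1}) \<le> \<eta> * (real k)\<^sup>2)"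
proof -
  obtain N :: nat where N: "12 / \<eta> < real N" using reals_Archimedean2 by blast
  have "0 < 12 / \<eta>" using \<eta> by simp
  hence N0: "N > 0" using N by linarith
  define x where "x = 1 - 1 / (8 * (real N)\<^sup>2)"
  have N1: "1 \<le> (real N)\<^sup>2" using N0 by (simp add: one_le_power)
  have "1 \<le> 8 * (real N)\<^sup>2" using N1 by linarith
  hence x: "0 \<le> x" "x < 1" unfolding x_def using N0 by (simp_all add: field_simps)
  obtain s where s: "x ^ s < 1 / real N" using real_arch_pow_inv[of "1 / real N" x] N0 x by auto
  have "1 / real N > 0" using N0 by simp
  from charfun_le_of_moments[OF this, of s] obtain Q e where e: "e > 0" and Q:
    "\<forall>k d \<mu> t. k > 0 \<longrightarrow> spread_moments s \<mu> \<longrightarrow>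
    (\<forall>q\<le>Q. cmod (complex_of_real (moment k d q) - \<mu> q) < e) \<longrightarrow> \<bar>t\<bar> \<le> 1 \<longrightarrow>
    cmod (charfun k d t) \<le> (1 - t\<^sup>2 / 8) ^ s + 1 / real N"
    by (elim exE conjE)
  show ?thesis
  proof (rule exI[of _ s], rule exI[of _ Q], rule exI[of _ e], intro conjI allI impI e)
    fix k d \<mu> assume k: "k > 0" and sp: "spread_moments s \<mu>" and mom: "\<forall>q\<le>Q. cmod (complex_of_real (moment k d q) - \<mu> q) < e"
    have "real (card {(i, j). i < k \<and> j < k \<and> \<bar>d i - d j\<bar> < 1}) \<le> 4 * (real k)\<^sup>2 * (1 / real N + 2 / real N)"
    proof (rule close_pairs_le[OF N0 k])
      fix a b assume ab: "a < N" "b < N" "a \<noteq> b"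
      define t where "t = (real a - real b) / real N"
      have t1: "\<bar>t\<bar> \<le> 1" unfolding t_def using ab by (simp add: abs_divide)
      have "1 \<le> \<bar>real a - real b\<bar>" using ab by linarith
      hence "1 / real N \<le> \<bar>t\<bar>" unfolding t_def abs_divide using N0 by (simp add: divide_right_mono)
      hence "(1 / real N)\<^sup>2 \<le> t\<^sup>2" using power_mono[of "1 / real N" "\<bar>t\<bar>" 2] by simp
      hence "1 - t\<^sup>2 / 8 \<le> x" unfolding x_def by (simp add: power_divide)
      moreover have "0 \<le> 1 - t\<^sup>2 / 8" using t1 abs_square_le_1[of t] by simp
      ultimately have "(1 - t\<^sup>2 / 8) ^ s \<le> x ^ s" by (intro power_mono)
      thus "cmod (charfun k d ((real a - real b) / real N)) \<le> 2 / real N"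
        using Q[THEN spec, THEN spec, THEN spec, THEN spec, THEN mp, OF k, THEN mp, OF sp, THEN mp, OF mom, THEN mp, OF t1] s
        unfolding t_def by simp
    qed simp
    also have "\<dots> = (12 / real N) * (real k)\<^sup>2" by simp
    also have "\<dots> \<le> \<eta> * (real k)\<^sup>2" using N N0 \<eta> by (intro mult_right_mono) (auto simp: field_simps)
    finally show "real (card {(i, j). i < k \<and> j < k \<and> \<bar>d i - d j\<bar> < 1}) \<le> \<eta> * (real k)\<^sup>2" .
  qed
qed


section \<open>Counting codes\<close>

definition int_vectors :: "'a set \<Rightarrow> nat \<Rightarrow> ('a \<Rightarrow> int) set" where
  "int_vectors I L = {z. (\<forall>i. i \<notin> I \<longrightarrow> z i = 0) \<and> (\<Sum>i\<in>I. nat \<bar>z i\<bar>) \<le> L}"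

text \<open>The factor 2^L clears denominators, so the truncated series stays in
  \<open>nat\<close>.\<close>

lemma sum_two_power_abs_le: "(\<Sum>v\<in>{- int L..int L}. 2 ^ (L - nat \<bar>v\<bar>) :: nat) \<le> 3 * 2 ^ L"
proof -
  have "(\<Sum>a\<in>{1..L}. 2 ^ (L - a) :: nat) = (\<Sum>i<L. 2 ^ (L - Suc i))"
    by (rule sum.reindex_bij_witness[of _ Suc "\<lambda>a. a - 1"]) auto
  also have "\<dots> = (\<Sum>i<L. 2 ^ i)" by (rule sum.nat_diff_reindex)
  also have "\<dots> \<le> 2 ^ L" using sum_power2[of L] by (simp add: atLeast0LessThan)
  finally have half: "(\<Sum>a\<in>{1..L}. 2 ^ (L - a) :: nat) \<le> 2 ^ L" .
  have "{- int L..int L} \<subseteq> {0} \<union> (int ` {1..L} \<union> (\<lambda>a. - int a) ` {1..L})"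
  proof
    fix v assume v: "v \<in> {- int L..int L}"
    show "v \<in> {0} \<union> (int ` {1..L} \<union> (\<lambda>a. - int a) ` {1..L})"
    proof (cases "v > 0")
      case True
      hence "v = int (nat v)" "nat v \<in> {1..L}" using v by auto
      thus ?thesis by blast
    next
      case False
      show ?thesis
      proof (cases "v = 0")
        case False
        hence "v = - int (nat (- v))" "nat (- v) \<in> {1..L}" using v \<open>\<not> v > 0\<close> by auto
        thus ?thesis by blast
      qed simp
    qed
  qed
  hence "(\<Sum>v\<in>{- int L..int L}. 2 ^ (L - nat \<bar>v\<bar>) :: nat) \<le>
      (\<Sum>v\<in>{0} \<union> (int ` {1..L} \<union> (\<lambda>a. - int a) ` {1..L}). 2 ^ (L - nat \<bar>v\<bar>))"
    by (intro sum_mono2) auto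
  also have "\<dots> \<le> (\<Sum>v\<in>{0}. 2 ^ (L - nat \<bar>v\<bar>)) + ((\<Sum>v\<in>int ` {1..L}. 2 ^ (L - nat \<bar>v\<bar>)) + (\<Sum>v\<in>(\<lambda>a. - int a) ` {1..L}. 2 ^ (L - nat \<bar>v\<bar>)))"
    by (intro order_trans[OF sum_Un_nat[THEN eq_refl, THEN order_trans, OF _ _ diff_le_self]] add_left_mono
        sum_Un_nat[THEN eq_refl, THEN order_trans, OF _ _ diff_le_self]) auto
  also have "(\<Sum>v\<in>int ` {1..L}. 2 ^ (L - nat \<bar>v\<bar>) :: nat) = (\<Sum>a\<in>{1..L}. 2 ^ (L - a))"
    by (subst sum.reindex) (auto simp: inj_on_def)
  also have "(\<Sum>v\<in>(\<lambda>a. - int a) ` {1..L}. 2 ^ (L - nat \<bar>v\<bar>) :: nat) = (\<Sum>a\<in>{1..L}. 2 ^ (L - a))"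
    by (subst sum.reindex) (auto simp: inj_on_def)
  finally show ?thesis using half by simp
qed

text \<open>Generating-function bound: \<open>\<Sum>\<^sub>v 2\<^bsup>-|v|\<^esup> = 3\<close> over the integers.\<close>

lemma card_int_vectors_le:
  assumes "finite I"
  shows "finite (int_vectors I L) \<and> card (int_vectors I L) \<le> 2 ^ L * 3 ^ card I"
  using assms
proof (induction I arbitrary: L rule: finite_induct)
  case empty
  have "int_vectors {} L = {\<lambda>_::'a. 0}" unfolding int_vectors_def by auto
  thus ?case by simp
next
  case (insert i J)
  have sub: "int_vectors (insert i J) L \<subseteq> (\<Union>v\<in>{- int L..int L}. (\<lambda>z. z(i := v)) ` int_vectors J (L - nat \<bar>v\<bar>))"
  proof
    fix z assume z: "z \<in> int_vectors (insert i J) L"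
    define z' where "z' = z(i := 0)"
    have "(\<Sum>j\<in>J. nat \<bar>z' j\<bar>) = (\<Sum>j\<in>J. nat \<bar>z j\<bar>)"
      unfolding z'_def using insert by (intro sum.cong) auto
    moreover have s: "nat \<bar>z i\<bar> + (\<Sum>j\<in>J. nat \<bar>z j\<bar>) \<le> L"
      using z insert unfolding int_vectors_def by simp
    ultimately have "z' \<in> int_vectors J (L - nat \<bar>z i\<bar>)"
      using z unfolding int_vectors_def z'_def by auto
    moreover have "z = z'(i := z i)" unfolding z'_def by simp
    moreover have "z i \<in> {- int L..int L}" using s by auto
    ultimately show "z \<in> (\<Union>v\<in>{- int L..int L}. (\<lambda>z. z(i := v)) ` int_vectors J (L - nat \<bar>v\<bar>))" by blast
  qed
  have fin: "finite (\<Union>v\<in>{- int L..int L}. (\<lambda>z. z(i := v)) ` int_vectors J (L - nat \<bar>v\<bar>))"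
    using insert.IH by auto
  have "card (int_vectors (insert i J) L) \<le> card (\<Union>v\<in>{- int L..int L}. (\<lambda>z. z(i := v)) ` int_vectors J (L - nat \<bar>v\<bar>))"
    by (rule card_mono[OF fin sub])
  also have "\<dots> \<le> (\<Sum>v\<in>{- int L..int L}. card ((\<lambda>z. z(i := v)) ` int_vectors J (L - nat \<bar>v\<bar>)))"
    by (rule card_UN_le) simp
  also have "\<dots> \<le> (\<Sum>v\<in>{- int L..int L}. 2 ^ (L - nat \<bar>v\<bar>) * 3 ^ card J)"
    by (intro sum_mono order_trans[OF card_image_le]) (use insert.IH in auto)
  also have "\<dots> = (\<Sum>v\<in>{- int L..int L}. 2 ^ (L - nat \<bar>v\<bar>)) * 3 ^ card J"
    by (simp add: sum_distrib_right)
  also have "\<dots> \<le> (3 * 2 ^ L) * 3 ^ card J" by (intro mult_right_mono sum_two_power_abs_le) simp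
  also have "\<dots> = 2 ^ L * 3 ^ card (insert i J)" using insert by simp
  finally show ?case using finite_subset[OF sub fin] by blast
qed

section \<open>Pairs of indices in equal or adjacent cells, and rank codes\<close>

definition near :: "(nat \<Rightarrow> nat) \<Rightarrow> nat \<Rightarrow> nat \<Rightarrow> bool" where
  "near f i j \<longleftrightarrow> f i = f j \<or> f i = Suc (f j) \<or> f j = Suc (f i)"

definition near_pairs :: "nat \<Rightarrow> (nat \<Rightarrow> nat) \<Rightarrow> (nat \<times> nat) set" where
  "near_pairs k f = {(i, j). i < k \<and> j < k \<and> near f i j}"

lemma finite_near_pairs: "finite (near_pairs k f)"
  by (rule finite_subset[of _ "{..<k} \<times> {..<k}"]) (auto simp: near_pairs_def)

lemma card_fiber_pairs:
  fixes f :: "nat \<Rightarrow> nat"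
  assumes "\<And>i. i < k \<Longrightarrow> f i < m"
  shows "card {(i, j). i < k \<and> j < k \<and> f j = g (f i)} = (\<Sum>b<m. card {i. i < k \<and> f i = b} * card {i. i < k \<and> f i = g b})"
proof -
  have eq: "{(i, j). i < k \<and> j < k \<and> f j = g (f i)} = (\<Union>b<m. {i. i < k \<and> f i = b} \<times> {i. i < k \<and> f i = g b})"
    using assms by auto
  have "card (\<Union>b<m. {i. i < k \<and> f i = b} \<times> {i. i < k \<and> f i = g b}) = (\<Sum>b<m. card ({i. i < k \<and> f i = b} \<times> {i. i < k \<and> f i = g b}))"
    by (rule card_UN_disjoint) auto
  thus ?thesis unfolding eq card_cartesian_product .
qed

text \<open>With n_b indices in cell b, equality accounts for the sum of n_b^2 pairs, and each of
  the two kinds of adjacency for the sum of n_b n_(b+1). The latter is no larger, because 2 x y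
  \<le> x^2 + y^2 and the cell beyond the last is empty.\<close>

lemma card_near_pairs_le:
  assumes f: "\<And>i. i < k \<Longrightarrow> f i < m"
  shows "card (near_pairs k f) \<le> 3 * card {(i, j). i < k \<and> j < k \<and> f i = f j}"
proof -
  define E where "E g = {(i, j). i < k \<and> j < k \<and> f j = g (f i)}" for g
  define n where "n b = card {i. i < k \<and> f i = b}" for b
  have fin: "finite (E g)" for g
    by (rule finite_subset[of _ "{..<k} \<times> {..<k}"]) (auto simp: E_def)
  have E: "card (E g) = (\<Sum>b<m. n b * n (g b))" for g
    unfolding E_def n_def by (rule card_fiber_pairs[OF f])
  have id: "card (E id) = card {(i, j). i < k \<and> j < k \<and> f i = f j}"
    unfolding E_def by (rule arg_cong[where f = card]) auto
  have "{i. i < k \<and> f i = m} = {}" using f by force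
  hence nm: "n m = 0" unfolding n_def by (metis card.empty)
  have "2 * card (E Suc) = (\<Sum>b<m. 2 * (n b * n (Suc b)))" unfolding E by (simp add: sum_distrib_left)
  also have "\<dots> \<le> (\<Sum>b<m. n b * n b + n (Suc b) * n (Suc b))"
  proof (rule sum_mono)
    fix b
    have "0 \<le> (int (n b) - int (n (Suc b)))\<^sup>2" by simp
    hence "2 * int (n b) * int (n (Suc b)) \<le> (int (n b))\<^sup>2 + (int (n (Suc b)))\<^sup>2" by (simp add: power2_diff)
    hence "int (2 * (n b * n (Suc b))) \<le> int (n b * n b + n (Suc b) * n (Suc b))" by (simp add: power2_eq_square)
    thus "2 * (n b * n (Suc b)) \<le> n b * n b + n (Suc b) * n (Suc b)" by (simp only: of_nat_le_iff)
  qed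
  also have "\<dots> = (\<Sum>b<m. n b * n b) + (\<Sum>b<m. n (Suc b) * n (Suc b))" by (rule sum.distrib)
  also have "(\<Sum>b<m. n (Suc b) * n (Suc b)) \<le> (\<Sum>b<m. n b * n b)"
  proof -
    have "(\<Sum>b<m. n (Suc b) * n (Suc b)) \<le> n 0 * n 0 + (\<Sum>b<m. n (Suc b) * n (Suc b))" by simp
    also have "\<dots> = (\<Sum>b<Suc m. n b * n b)" by (rule sum.lessThan_Suc_shift[symmetric])
    also have "\<dots> = (\<Sum>b<m. n b * n b)" by (simp add: nm)
    finally show ?thesis .
  qed
  also have "(\<Sum>b<m. n b * n b) = card (E id)" unfolding E by simp
  finally have suc: "card (E Suc) \<le> card (E id)" by simp
  have "near_pairs k f \<subseteq> E id \<union> (E Suc \<union> prod.swap ` E Suc)"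
    unfolding near_pairs_def near_def E_def by (auto simp: image_iff)
  hence "card (near_pairs k f) \<le> card (E id \<union> (E Suc \<union> prod.swap ` E Suc))"
    using fin by (intro card_mono) auto
  also have "\<dots> \<le> card (E id) + (card (E Suc) + card (prod.swap ` E Suc))"
    by (intro order_trans[OF card_Un_le] add_left_mono card_Un_le)
  also have "\<dots> \<le> card (E id) + (card (E Suc) + card (E Suc))"
    using fin by (intro add_left_mono card_image_le)
  also have "\<dots> \<le> 3 * card (E id)" using suc by simp
  finally show ?thesis unfolding id .
qed

text \<open>Replacing the values of \<open>F\<close> by their ranks leaves at most \<open>k\<^sup>k\<close> possibilities for the code.\<close>

definition rank_code :: "nat \<Rightarrow> (nat \<Rightarrow> int) \<Rightarrow> nat \<Rightarrow> nat" where
  "rank_code k F i = card {b \<in> F ` {..<k}. b < F i}"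

lemma rank_code_less: assumes "i < k" shows "rank_code k F i < k"
proof -
  have "{b \<in> F ` {..<k}. b < F i} \<subset> F ` {..<k}" using assms by auto
  hence "rank_code k F i < card (F ` {..<k})" unfolding rank_code_def by (intro psubset_card_mono) auto
  also have "\<dots> \<le> k" using card_image_le[of "{..<k}" F] by simp
  finally show ?thesis .
qed

lemma rank_code_strict: assumes "i < k" "F i < F j" shows "rank_code k F i < rank_code k F j"
  unfolding rank_code_def using assms by (intro psubset_card_mono) auto

lemma rank_code_inj: assumes "i < k" "j < k" "rank_code k F i = rank_code k F j" shows "F i = F j"
  using rank_code_strict[of i k F j] rank_code_strict[of j k F i] assms by (cases "F i" "F j" rule: linorder_cases) auto

lemma rank_code_Suc: assumes "i < k" "F j = F i + 1" shows "rank_code k F j = Suc (rank_code k F i)"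
proof -
  have "{b \<in> F ` {..<k}. b < F j} = insert (F i) {b \<in> F ` {..<k}. b < F i}" using assms by auto
  thus ?thesis unfolding rank_code_def by simp
qed

text \<open>The converse fails, since distant values may receive adjacent ranks. This is harmless:
  the number of near pairs is bounded through pairs of equal rank, and equal rank means equal
  value.\<close>

lemma rank_code_near:
  assumes "i < k" "j < k" "\<bar>F i - F j\<bar> \<le> 1" shows "near (rank_code k F) i j"
proof -
  consider "F i = F j" | "F j = F i + 1" | "F i = F j + 1" using assms by linarith
  thus ?thesis
  proof cases
    case 1 thus ?thesis unfolding near_def rank_code_def by simp
  qed (use assms in \<open>auto simp: near_def rank_code_Suc[of _ k F]\<close>)
qed

text \<open>A nonzero rounding requires |x| \<ge> 1/2, and then |round x| \<le> 2 |x| \<le> 4 x^2.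
  So a bound on the 2-norm of a matrix tuple becomes a bound on the sum of absolute values that
  defines \<open>int_vectors\<close>.\<close>

lemma round_abs_le: "real (nat \<bar>round x\<bar>) \<le> 4 * x\<^sup>2" for x :: real
proof (cases "round x = 0")
  case False
  have r: "\<bar>of_int (round x) - x\<bar> \<le> 1 / 2" by (rule of_int_round_abs_le)
  have "1 \<le> \<bar>real_of_int (round x)\<bar>" using False by linarith
  hence x: "1 / 2 \<le> \<bar>x\<bar>" using r by linarith
  have "real (nat \<bar>round x\<bar>) \<le> 2 * \<bar>x\<bar>" using r x by linarith
  also have "\<dots> \<le> 2 * \<bar>x\<bar> * (2 * \<bar>x\<bar>)" using x mult_left_mono[of 1 "2 * \<bar>x\<bar>" "2 * \<bar>x\<bar>"] by simp
  also have "\<dots> = 4 * x\<^sup>2" by (simp add: power2_eq_square)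
  finally show ?thesis .
qed simp

lemma round_eq_dist: assumes "round x = round y" shows "\<bar>x - y\<bar> \<le> (1::real)"
  using of_int_round_abs_le[of x] of_int_round_abs_le[of y] assms by linarith

section \<open>Covering by orbit balls\<close>

text \<open>Centers of the balls must lie in \<open>G\<close>, so one member of \<open>G\<close> is
  picked for each code that occurs. The \<open>max\<close> accounts for the value 1 at the empty
  set.\<close>

lemma orbit_covering_number_le_codes:
  assumes fin: "finite Cd" and c: "c ` G \<subseteq> Cd"
    and same: "\<And>A B. A \<in> G \<Longrightarrow> B \<in> G \<Longrightarrow> c A = c B \<Longrightarrow> A \<in> orbit_ball k B \<omega>"
  shows "orbit_covering_number k G \<omega> \<le> max 1 (card Cd)"
proof (cases "G = {}")
  case False
  define rep where "rep w = (SOME B. B \<in> G \<and> c B = w)" for w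
  have rep: "rep (c A) \<in> G \<and> c (rep (c A)) = c A" if "A \<in> G" for A
    unfolding rep_def by (rule someI[of _ A]) (use that in simp)
  define C where "C = rep ` c ` G"
  have fc: "finite (c ` G)" using fin c finite_subset by blast
  have "\<exists>D. finite D \<and> card D = card C \<and> D \<subseteq> G \<and> G \<subseteq> (\<Union>Bs\<in>D. orbit_ball k Bs \<omega>)"
  proof (intro exI[of _ C] conjI subsetI)
    show "finite C" unfolding C_def using fc by simp
    show "x \<in> G" if "x \<in> C" for x using that rep unfolding C_def by auto
    show "A \<in> (\<Union>Bs\<in>C. orbit_ball k Bs \<omega>)" if "A \<in> G" for A
      using rep[OF that] same[OF that, of "rep (c A)"] that unfolding C_def by auto
  qed simp
  hence "orbit_covering_number k G \<omega> \<le> card C"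
    unfolding orbit_covering_number_def using False by (simp add: Least_le)
  also have "\<dots> \<le> card (c ` G)" unfolding C_def by (rule card_image_le[OF fc])
  also have "\<dots> \<le> card Cd" by (rule card_mono[OF fin c])
  finally show ?thesis by simp
qed (simp add: orbit_covering_number_def)

lemma tuple_norm2_eq:
  assumes "set Cs \<subseteq> carrier_mat k k"
  shows "tuple_norm2 k Cs = sqrt (\<Sum>l<length Cs. fro k (Cs ! l))"
proof -
  have "(\<Sum>A\<leftarrow>Cs. Re (tau_mat k (mat_adjoint A * A))) = (\<Sum>A\<leftarrow>Cs. fro k A)"
    using assms by (intro arg_cong[where f = sum_list] map_cong refl) (auto simp: tau_mat_adjoint_mult)
  thus ?thesis unfolding tuple_norm2_def by (simp add: sum_list_sum_nth atLeast0LessThan)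
qed

text \<open>\<open>W * mat_adjoint V\<close> carries the eigenbasis belonging to \<open>B\<close> to
  the one belonging to \<open>A\<close>. So two tuples are close up to conjugation as soon as their
  matrices in their own eigenbases are close.\<close>

lemma fro_diff_conj:
  assumes W: "W \<in> unitary_group k" and V: "V \<in> unitary_group k"
    and A: "A \<in> carrier_mat k k" and B: "B \<in> carrier_mat k k"
  shows "fro k (A - (W * mat_adjoint V) * B * mat_adjoint (W * mat_adjoint V)) =
    fro k (mat_adjoint W * A * W - mat_adjoint V * B * V)"
proof -
  note c = unitary_group_carrier[OF W] unitary_group_carrier[OF V]
  define T where "T = (W * mat_adjoint V) * B * mat_adjoint (W * mat_adjoint V)"
  have T: "T \<in> carrier_mat k k" unfolding T_def using c B by auto
  have "mat_adjoint W * T * W = mat_adjoint V * (B * (V * (mat_adjoint W * W)))"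
    unfolding T_def using c B V W
    by (simp add: assoc_mult_square[of _ k] mat_adjoint_mult[of _ k k _ k] mat_adjoint_adjoint[of V k k] unitary_cancel)
  also have "mat_adjoint W * W = 1\<^sub>m k" using W unfolding unitary_group_def by blast
  finally have T': "mat_adjoint W * T * W = mat_adjoint V * B * V"
    using c B by (simp add: assoc_mult_square[of _ k] right_mult_one_mat[of V k k])
  have "mat_adjoint W * (A - T) * W = mat_adjoint W * A * W - mat_adjoint W * T * W"
    using c A T by (simp add: mult_minus_distrib_mat[of _ k k] minus_mult_distrib_mat[of "mat_adjoint W * A" k k "mat_adjoint W * T" W k])
  thus ?thesis using fro_conj[OF W minus_carrier_mat[OF T, of A]] T' unfolding T_def by simp
qed

text \<open>
  A tuple is encoded by the ranks of the rounded eigenvalues \<open>d\<^sub>i\<close> and, on the near pairs, by the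
  entries in the eigenbasis rounded to multiples of \<open>\<rho>\<close>. Outside the near pairs \<open>|d\<^sub>i - d\<^sub>j| \<ge> 1\<close>,
  so there the entries are negligible by the commutator bound, and tuples with equal codes
  lie in each other's orbit ball.
\<close>

theorem ln_orbit_covering_number_le:
  assumes k: "k > 0" and \<omega>: "\<omega> > 0" and \<eta>: "\<eta> > 0" and R2: "R2 \<ge> 0"
    and G: "G \<subseteq> mat_tuples k n"
    and data: "\<And>As. As \<in> G \<Longrightarrow> \<exists>W\<in>unitary_group k. \<exists>d :: nat \<Rightarrow> real.
       (\<Sum>l<n. fro k (As ! l)) \<le> R2 \<and>
       (\<Sum>l<n. (\<Sum>i<k. \<Sum>j<k. (d i - d j)\<^sup>2 * (cmod ((mat_adjoint W * (As ! l) * W) $$ (i, j)))\<^sup>2) / real k) \<le> \<delta> \<and>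
       real (card {(i, j). i < k \<and> j < k \<and> \<bar>d i - d j\<bar> < 1}) \<le> \<eta> * (real k)\<^sup>2"
    and \<delta>: "16 * \<delta> \<le> \<omega>\<^sup>2"
  shows "ln (real (orbit_covering_number k G \<omega>)) \<le>
    real k * ln (real k) + (16 * R2 / \<omega>\<^sup>2 * ln 2 + ln 3) * (6 * (real n + 1) * \<eta> * (real k)\<^sup>2)"
proof -
  obtain W d where W: "\<And>As. As \<in> G \<Longrightarrow> W As \<in> unitary_group k"
    and fro_le: "\<And>As. As \<in> G \<Longrightarrow> (\<Sum>l<n. fro k (As ! l)) \<le> R2"
    and off: "\<And>As. As \<in> G \<Longrightarrow> (\<Sum>l<n. (\<Sum>i<k. \<Sum>j<k. (d As i - d As j)\<^sup>2 * (cmod ((mat_adjoint (W As) * (As ! l) * W As) $$ (i, j)))\<^sup>2) / real k) \<le> \<delta>"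
    and close: "\<And>As. As \<in> G \<Longrightarrow> real (card {(i, j). i < k \<and> j < k \<and> \<bar>d As i - d As j :: real\<bar> < 1}) \<le> \<eta> * (real k)\<^sup>2"
  proof -
    have "\<forall>As. \<exists>W d. As \<in> G \<longrightarrow> W \<in> unitary_group k \<and> (\<Sum>l<n. fro k (As ! l)) \<le> R2 \<and>
       (\<Sum>l<n. (\<Sum>i<k. \<Sum>j<k. (d i - d j)\<^sup>2 * (cmod ((mat_adjoint W * (As ! l) * W) $$ (i, j)))\<^sup>2) / real k) \<le> \<delta> \<and>
       real (card {(i, j). i < k \<and> j < k \<and> \<bar>d i - d j :: real\<bar> < 1}) \<le> \<eta> * (real k)\<^sup>2"
      using data by blast
    from this[THEN choice] obtain W where "\<forall>As. \<exists>d. As \<in> G \<longrightarrow> W As \<in> unitary_group k \<and> (\<Sum>l<n. fro k (As ! l)) \<le> R2 \<and>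
       (\<Sum>l<n. (\<Sum>i<k. \<Sum>j<k. (d i - d j)\<^sup>2 * (cmod ((mat_adjoint (W As) * (As ! l) * W As) $$ (i, j)))\<^sup>2) / real k) \<le> \<delta> \<and>
       real (card {(i, j). i < k \<and> j < k \<and> \<bar>d i - d j :: real\<bar> < 1}) \<le> \<eta> * (real k)\<^sup>2"
      by (elim exE)
    from this[THEN choice] obtain d where d: "\<forall>As. As \<in> G \<longrightarrow> W As \<in> unitary_group k \<and> (\<Sum>l<n. fro k (As ! l)) \<le> R2 \<and>
       (\<Sum>l<n. (\<Sum>i<k. \<Sum>j<k. (d As i - d As j)\<^sup>2 * (cmod ((mat_adjoint (W As) * (As ! l) * W As) $$ (i, j)))\<^sup>2) / real k) \<le> \<delta> \<and>
       real (card {(i, j). i < k \<and> j < k \<and> \<bar>d As i - d As j :: real\<bar> < 1}) \<le> \<eta> * (real k)\<^sup>2"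
      by (elim exE)
    show ?thesis by (rule that[of W d]) (use d in simp_all)
  qed
  \<comment> \<open>Bounds the number of rounded real parameters: two for each of the
    \<open>n\<close> entries at each of at most 3 \<eta> k^2 near pairs. \<open>n + 1\<close> keeps
    it positive for the empty tuple.\<close>
  define D where "D = 6 * (real n + 1) * \<eta> * (real k)\<^sup>2"
  have D: "D > 0" unfolding D_def using \<eta> k by (simp add: add_nonneg_pos)
  \<comment> \<open>The mesh for which rounding on the near pairs costs D \<rho>^2 / k = \<omega>^2
    / 4. The rounded entries then have absolute values with sum at most 4 k R2 / \<rho>^2, which is
    the number inside \<open>L\<close>.\<close>
  define \<rho> where "\<rho> = sqrt (real k * \<omega>\<^sup>2 / (4 * D))"
  have \<rho>2: "\<rho>\<^sup>2 = real k * \<omega>\<^sup>2 / (4 * D)" and \<rho>: "\<rho> > 0" unfolding \<rho>_def using D k \<omega> by simp_all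
  define L where "L = nat \<lfloor>16 * R2 / \<omega>\<^sup>2 * D\<rfloor>"
  have LD0: "0 \<le> 16 * R2 / \<omega>\<^sup>2 * D" using R2 D by simp
  define K where "K = nat \<lfloor>D\<rfloor>"
  define Y where "Y As l = mat_adjoint (W As) * (As ! l) * W As" for As l
  have len: "length As = n" and As_c: "l < n \<Longrightarrow> As ! l \<in> carrier_mat k k" if "As \<in> G" for As l
    using that G unfolding mat_tuples_def by (auto dest!: subsetD)
  have Yc: "Y As l \<in> carrier_mat k k" if "As \<in> G" "l < n" for As l
    unfolding Y_def using unitary_group_carrier[OF W[OF that(1)]] As_c[OF that] by auto
  define part where "part b w = (if b then Re w else Im w)" for b and w :: complex
  \<comment> \<open>\<open>restrict\<close> makes the code an element of an extensional function
    space with k^k members.\<close>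
  define f where "f As = restrict (rank_code k (\<lambda>i. \<lfloor>d As i\<rfloor>)) {..<k}" for As
  define I where "I g = {..<n} \<times> near_pairs k g \<times> (UNIV :: bool set)" for g
  define z where "z As = (\<lambda>(l, (i, j), b). if l < n \<and> (i, j) \<in> near_pairs k (f As) then round (part b (Y As l $$ (i, j)) / \<rho>) else 0)" for As
  have fnear: "near_pairs k (f As) = near_pairs k (rank_code k (\<lambda>i. \<lfloor>d As i\<rfloor>))" for As
    unfolding near_pairs_def near_def f_def by auto
  have not_near: "1 \<le> \<bar>d As i - d As j\<bar>" if "i < k" "j < k" "(i, j) \<notin> near_pairs k (f As)" for As i j
  proof (rule ccontr)
    assume "\<not> 1 \<le> \<bar>d As i - d As j\<bar>"
    hence "\<bar>\<lfloor>d As i\<rfloor> - \<lfloor>d As j\<rfloor>\<bar> \<le> 1" by linarith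
    hence "(i, j) \<in> near_pairs k (rank_code k (\<lambda>i. \<lfloor>d As i\<rfloor>))"
      using rank_code_near[of i k j "\<lambda>i. \<lfloor>d As i\<rfloor>"] that(1,2) unfolding near_pairs_def by simp
    thus False using that(3) unfolding fnear by blast
  qed
  have finI: "finite (I g)" for g unfolding I_def using finite_near_pairs by auto
  have cardI: "card (I g) = 2 * n * card (near_pairs k g)" for g
    unfolding I_def by (simp add: card_cartesian_product)
  have near_card: "real (2 * n * card (near_pairs k (f As))) \<le> D" if As: "As \<in> G" for As
  proof -
    have "card (near_pairs k (f As)) \<le> 3 * card {(i, j). i < k \<and> j < k \<and> rank_code k (\<lambda>i. \<lfloor>d As i\<rfloor>) i = rank_code k (\<lambda>i. \<lfloor>d As i\<rfloor>) j}"
      unfolding fnear by (rule card_near_pairs_le[where m = k]) (rule rank_code_less)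
    also have "\<dots> \<le> 3 * card {(i, j). i < k \<and> j < k \<and> \<bar>d As i - d As j\<bar> < 1}"
    proof (intro mult_left_mono card_mono)
      show "finite {(i, j). i < k \<and> j < k \<and> \<bar>d As i - d As j\<bar> < 1}"
        by (rule finite_subset[of _ "{..<k} \<times> {..<k}"]) auto
      show "{(i, j). i < k \<and> j < k \<and> rank_code k (\<lambda>i. \<lfloor>d As i\<rfloor>) i = rank_code k (\<lambda>i. \<lfloor>d As i\<rfloor>) j} \<subseteq> {(i, j). i < k \<and> j < k \<and> \<bar>d As i - d As j\<bar> < 1}"
      proof clarify
        fix i j assume "i < k" "j < k" "rank_code k (\<lambda>i. \<lfloor>d As i\<rfloor>) i = rank_code k (\<lambda>i. \<lfloor>d As i\<rfloor>) j"
        hence "\<lfloor>d As i\<rfloor> = \<lfloor>d As j\<rfloor>" using rank_code_inj[of i k j "\<lambda>i. \<lfloor>d As i\<rfloor>"] by simp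
        thus "\<bar>d As i - d As j\<bar> < 1" by linarith
      qed
    qed simp
    finally have "real (card (near_pairs k (f As))) \<le> 3 * real (card {(i, j). i < k \<and> j < k \<and> \<bar>d As i - d As j\<bar> < 1})" by linarith
    also have "\<dots> \<le> 3 * (\<eta> * (real k)\<^sup>2)" using close[OF As] by simp
    finally have "2 * real n * real (card (near_pairs k (f As))) \<le> 2 * real n * (3 * (\<eta> * (real k)\<^sup>2))"
      by (intro mult_left_mono) auto
    also have "\<dots> \<le> D" unfolding D_def using \<eta> by (simp add: algebra_simps)
    finally show ?thesis by simp
  qed
  define F where "F = {g \<in> {..<k} \<rightarrow>\<^sub>E {..<k}. card (I g) \<le> K}"
  define Cd where "Cd = Sigma F (\<lambda>g. int_vectors (I g) L)"
  have finF: "finite F" unfolding F_def by (rule finite_subset[OF _ finite_PiE[of "{..<k}" "\<lambda>_. {..<k}"]]) auto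
  have cardF: "card F \<le> k ^ k"
  proof -
    have "card F \<le> card ({..<k} \<rightarrow>\<^sub>E {..<k})" unfolding F_def by (intro card_mono finite_PiE) auto
    thus ?thesis by (simp add: card_PiE)
  qed
  have finCd: "finite Cd" unfolding Cd_def using finF card_int_vectors_le[OF finI] by (intro finite_SigmaI) auto
  have "card Cd = (\<Sum>g\<in>F. card (int_vectors (I g) L))"
    unfolding Cd_def using finF card_int_vectors_le[OF finI] by (intro card_SigmaI) auto
  also have "\<dots> \<le> (\<Sum>g\<in>F. 2 ^ L * 3 ^ K)"
  proof (rule sum_mono)
    fix g assume "g \<in> F"
    hence "(3::nat) ^ card (I g) \<le> 3 ^ K" unfolding F_def by (intro power_increasing) auto
    thus "card (int_vectors (I g) L) \<le> 2 ^ L * 3 ^ K"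
      using card_int_vectors_le[OF finI, of g L] mult_left_mono[of "3 ^ card (I g)" "3 ^ K" "2 ^ L :: nat"] by linarith
  qed
  also have "\<dots> \<le> k ^ k * (2 ^ L * 3 ^ K)" using cardF by simp
  finally have cardCd: "card Cd \<le> k ^ k * (2 ^ L * 3 ^ K)" .
  have codes: "(\<lambda>As. (f As, z As)) ` G \<subseteq> Cd"
  proof (rule image_subsetI)
    fix As assume As: "As \<in> G"
    have "f As \<in> {..<k} \<rightarrow>\<^sub>E {..<k}" unfolding f_def using rank_code_less by auto
    moreover have "card (I (f As)) \<le> K"
      unfolding cardI K_def using near_card[OF As] by (simp only: le_nat_floor)
    ultimately have fF: "f As \<in> F" unfolding F_def by blast
    have "real (\<Sum>w\<in>I (f As). nat \<bar>z As w\<bar>) \<le> (\<Sum>(l, (i, j), b)\<in>I (f As). 4 * (part b (Y As l $$ (i, j)) / \<rho>)\<^sup>2)"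
      unfolding of_nat_sum
    proof (rule sum_mono)
      fix w assume "w \<in> I (f As)"
      then obtain l i j b where w: "w = (l, (i, j), b)" "l < n" "(i, j) \<in> near_pairs k (f As)" unfolding I_def by auto
      show "real (nat \<bar>z As w\<bar>) \<le> (\<lambda>(l, (i, j), b). 4 * (part b (Y As l $$ (i, j)) / \<rho>)\<^sup>2) w"
        unfolding w(1) z_def using w(2,3) round_abs_le by simp
    qed
    also have "\<dots> \<le> (\<Sum>(l, (i, j), b)\<in>{..<n} \<times> ({..<k} \<times> {..<k}) \<times> UNIV. 4 * (part b (Y As l $$ (i, j)) / \<rho>)\<^sup>2)"
      by (rule sum_mono2) (auto simp: I_def near_pairs_def)
    also have "\<dots> = (\<Sum>l<n. \<Sum>i<k. \<Sum>j<k. \<Sum>b\<in>UNIV. 4 * (part b (Y As l $$ (i, j)) / \<rho>)\<^sup>2)"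
      by (simp only: sum.cartesian_product' prod.case)
    also have "\<dots> = (\<Sum>l<n. \<Sum>i<k. \<Sum>j<k. 4 / \<rho>\<^sup>2 * (cmod (Y As l $$ (i, j)))\<^sup>2)"
      by (intro sum.cong refl) (simp add: UNIV_bool part_def power_divide cmod_power2 add_divide_distrib algebra_simps)
    also have "\<dots> = (\<Sum>l<n. 4 / \<rho>\<^sup>2 * (\<Sum>i<k. \<Sum>j<k. (cmod (Y As l $$ (i, j)))\<^sup>2))"
      by (simp only: sum_distrib_left)
    also have "\<dots> = (\<Sum>l<n. 4 / \<rho>\<^sup>2 * (real k * fro k (Y As l)))" unfolding fro_def using k by simp
    also have "\<dots> = 4 / \<rho>\<^sup>2 * real k * (\<Sum>l<n. fro k (Y As l))"
      by (simp only: sum_distrib_left mult.assoc)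
    also have "(\<Sum>l<n. fro k (Y As l)) = (\<Sum>l<n. fro k (As ! l))"
      unfolding Y_def using fro_conj[OF W[OF As] As_c[OF As]] by simp
    also have "4 / \<rho>\<^sup>2 * real k * (\<Sum>l<n. fro k (As ! l)) \<le> 4 / \<rho>\<^sup>2 * real k * R2"
      using fro_le[OF As] by (intro mult_left_mono) auto
    also have "\<dots> = 16 * R2 / \<omega>\<^sup>2 * D" unfolding \<rho>2 using k D \<omega> by (simp add: field_simps)
    finally have "(\<Sum>w\<in>I (f As). nat \<bar>z As w\<bar>) \<le> L" unfolding L_def by (rule le_nat_floor)
    moreover have "z As w = 0" if "w \<notin> I (f As)" for w
      using that unfolding z_def I_def by (auto split: prod.splits)
    ultimately have "z As \<in> int_vectors (I (f As)) L" unfolding int_vectors_def by blast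
    thus "(f As, z As) \<in> Cd" using fF unfolding Cd_def by blast
  qed
  have same: "As \<in> orbit_ball k Bs \<omega>" if As: "As \<in> G" and Bs: "Bs \<in> G" and eq: "(f As, z As) = (f Bs, z Bs)" for As Bs
  proof -
    define S where "S = near_pairs k (f As)"
    have SB: "near_pairs k (f Bs) = S" unfolding S_def using eq by simp
    define a where "a As l i j = (cmod (Y As l $$ (i, j)))\<^sup>2" for As l i j
    define U where "U = W As * mat_adjoint (W Bs)"
    have U: "U \<in> unitary_group k" unfolding U_def using unitary_group_mult[OF W[OF As] unitary_group_adjoint[OF W[OF Bs]]] .
    have Uc: "U \<in> carrier_mat k k" "mat_adjoint U \<in> carrier_mat k k" using unitary_group_carrier[OF U] by auto
    \<comment> \<open>On \<open>S\<close> the roundings agree, so real and imaginary parts differ by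
      at most \<rho>. Off \<open>S\<close>, which is the same set for both tuples, the eigenvalues
      of either tuple are at distance at least 1, and each entry is paid for by its own commutator
      term.\<close>
    have entry: "(cmod ((Y As l - Y Bs l) $$ (i, j)))\<^sup>2 \<le>
      (if (i, j) \<in> S then 2 * \<rho>\<^sup>2 else 0) + (2 * ((d As i - d As j)\<^sup>2 * a As l i j) + 2 * ((d Bs i - d Bs j)\<^sup>2 * a Bs l i j))"
      if l: "l < n" and i: "i < k" and j: "j < k" for l i j
    proof -
      define x where "x = Y As l $$ (i, j)"
      define y where "y = Y Bs l $$ (i, j)"
      have xy: "(Y As l - Y Bs l) $$ (i, j) = x - y" unfolding x_def y_def using Yc[OF As l] Yc[OF Bs l] i j by simp
      show ?thesis
      proof (cases "(i, j) \<in> S")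
        case True
        have zeq: "z As (l, (i, j), b) = z Bs (l, (i, j), b)" for b using eq by simp
        have "\<bar>part b x / \<rho> - part b y / \<rho>\<bar> \<le> 1" for b
          using zeq[of b] True l SB unfolding z_def S_def x_def y_def by (intro round_eq_dist) simp
        hence "\<bar>part b x - part b y\<bar> \<le> \<rho>" for b using \<rho> by (simp add: diff_divide_distrib[symmetric] abs_divide field_simps)
        from this[of True] this[of False] have "\<bar>Re (x - y)\<bar> \<le> \<rho>" "\<bar>Im (x - y)\<bar> \<le> \<rho>" unfolding part_def by simp_all
        hence "(Re (x - y))\<^sup>2 \<le> \<rho>\<^sup>2" "(Im (x - y))\<^sup>2 \<le> \<rho>\<^sup>2" using \<rho> by (simp_all add: abs_le_square_iff[symmetric])
        hence "(cmod (x - y))\<^sup>2 \<le> 2 * \<rho>\<^sup>2" unfolding cmod_power2 by simp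
        moreover have "0 \<le> 2 * ((d As i - d As j)\<^sup>2 * a As l i j) + 2 * ((d Bs i - d Bs j)\<^sup>2 * a Bs l i j)"
          unfolding a_def by simp
        ultimately show ?thesis unfolding xy using True by simp
      next
        case False
        have "1 \<le> (d As i - d As j)\<^sup>2" "1 \<le> (d Bs i - d Bs j)\<^sup>2"
          using not_near[OF i j, of As] not_near[OF i j, of Bs] False SB unfolding S_def
          by (simp_all add: abs_le_square_iff[of 1, simplified])
        hence "1 * (cmod x)\<^sup>2 \<le> (d As i - d As j)\<^sup>2 * a As l i j" "1 * (cmod y)\<^sup>2 \<le> (d Bs i - d Bs j)\<^sup>2 * a Bs l i j"
          unfolding a_def x_def y_def by (intro mult_right_mono; simp)+
        moreover have "(cmod (x - y))\<^sup>2 \<le> 2 * (cmod x)\<^sup>2 + 2 * (cmod y)\<^sup>2"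
        proof -
          have "(cmod (x - y))\<^sup>2 \<le> (cmod x + cmod y)\<^sup>2" by (intro power_mono norm_triangle_ineq4) simp
          also have "\<dots> \<le> 2 * (cmod x)\<^sup>2 + 2 * (cmod y)\<^sup>2"
            using sum_squares_bound[of "cmod x" "cmod y"] by (simp add: power2_sum)
          finally show ?thesis .
        qed
        ultimately show ?thesis unfolding xy using False by simp
      qed
    qed
    define q where "q As = (\<Sum>l<n. (\<Sum>i<k. \<Sum>j<k. (d As i - d As j)\<^sup>2 * a As l i j) / real k)" for As
    have q: "q As \<le> \<delta>" "q Bs \<le> \<delta>" unfolding q_def a_def Y_def using off[OF As] off[OF Bs] by auto
    have "(\<Sum>l<n. fro k (Y As l - Y Bs l)) \<le> (\<Sum>l<n. (\<Sum>i<k. \<Sum>j<k. (if (i, j) \<in> S then 2 * \<rho>\<^sup>2 else 0) +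
       (2 * ((d As i - d As j)\<^sup>2 * a As l i j) + 2 * ((d Bs i - d Bs j)\<^sup>2 * a Bs l i j))) / real k)"
      unfolding fro_def by (intro sum_mono divide_right_mono entry) auto
    also have "\<dots> = (\<Sum>l<n. (\<Sum>i<k. \<Sum>j<k. if (i, j) \<in> S then 2 * \<rho>\<^sup>2 else 0) / real k) + (2 * q As + 2 * q Bs)"
      unfolding q_def by (simp add: sum.distrib add_divide_distrib sum_distrib_left)
    also have "(\<Sum>i<k. \<Sum>j<k. if (i, j) \<in> S then 2 * \<rho>\<^sup>2 else 0) = real (card S) * (2 * \<rho>\<^sup>2)"
    proof -
      have "(\<Sum>i<k. \<Sum>j<k. if (i, j) \<in> S then 2 * \<rho>\<^sup>2 else 0) = (\<Sum>p\<in>{..<k} \<times> {..<k}. if p \<in> S then 2 * \<rho>\<^sup>2 else 0)"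
        by (simp add: sum.cartesian_product split_def)
      also have "\<dots> = (\<Sum>p\<in>S. 2 * \<rho>\<^sup>2)"
        by (rule sum.mono_neutral_cong_right) (auto simp: S_def near_pairs_def)
      finally show ?thesis by simp
    qed
    also have "(\<Sum>l<n. real (card S) * (2 * \<rho>\<^sup>2) / real k) = real (2 * n * card S) * \<rho>\<^sup>2 / real k" by simp
    also have "\<dots> \<le> D * \<rho>\<^sup>2 / real k"
      using near_card[OF As] unfolding S_def by (intro divide_right_mono mult_right_mono) auto
    also have "D * \<rho>\<^sup>2 / real k = \<omega>\<^sup>2 / 4" unfolding \<rho>2 using k D by simp
    finally have "(\<Sum>l<n. fro k (Y As l - Y Bs l)) \<le> \<omega>\<^sup>2 / 4 + (2 * q As + 2 * q Bs)" by simp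
    \<comment> \<open>The commutator terms contribute at most 4 \<delta>; this is the origin of the
      16 in the hypothesis on \<delta>.\<close>
    also have "\<dots> \<le> \<omega>\<^sup>2 / 4 + \<omega>\<^sup>2 / 4" using q \<delta> by simp
    also have "\<dots> < \<omega>\<^sup>2" using \<omega> by simp
    finally have small: "(\<Sum>l<n. fro k (Y As l - Y Bs l)) < \<omega>\<^sup>2" .
    define Cs where "Cs = map2 (\<lambda>A B. A - U * B * mat_adjoint U) As Bs"
    have lenC: "length Cs = n" unfolding Cs_def using len[OF As] len[OF Bs] by simp
    have Cl: "Cs ! l = As ! l - U * (Bs ! l) * mat_adjoint U" if "l < n" for l
      unfolding Cs_def using that len[OF As] len[OF Bs] by simp
    have Cc: "set Cs \<subseteq> carrier_mat k k"
    proof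
      fix C assume "C \<in> set Cs"
      then obtain l where l: "l < n" "C = Cs ! l" using lenC by (metis in_set_conv_nth)
      show "C \<in> carrier_mat k k" unfolding l(2) Cl[OF l(1)] using Uc As_c[OF Bs l(1)] by (intro minus_carrier_mat) auto
    qed
    have "tuple_norm2 k Cs = sqrt (\<Sum>l<n. fro k (Cs ! l))" using tuple_norm2_eq[OF Cc] lenC by simp
    also have "(\<Sum>l<n. fro k (Cs ! l)) = (\<Sum>l<n. fro k (Y As l - Y Bs l))"
      using Cl fro_diff_conj[OF W[OF As] W[OF Bs] As_c[OF As] As_c[OF Bs]] unfolding Y_def U_def by (intro sum.cong) auto
    also have "sqrt \<dots> < \<omega>" using real_sqrt_less_mono[OF small] \<omega> by simp
    finally have "tuple_norm2 k Cs < \<omega>" .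
    thus ?thesis unfolding orbit_ball_def Cs_def
      using U As G len[OF Bs] by (auto intro!: bexI[of _ U])
  qed
  have "orbit_covering_number k G \<omega> \<le> max 1 (card Cd)"
    by (rule orbit_covering_number_le_codes[OF finCd codes same])
  also have "\<dots> \<le> k ^ k * (2 ^ L * 3 ^ K)"
    using cardCd k by (simp add: Suc_le_eq)
  finally have "real (orbit_covering_number k G \<omega>) \<le> real (k ^ k * (2 ^ L * 3 ^ K))"
    unfolding of_nat_le_iff .
  hence le: "real (orbit_covering_number k G \<omega>) \<le> real k ^ k * (2 ^ L * 3 ^ K)"
    by (simp only: of_nat_mult of_nat_power of_nat_numeral)
  have "ln (real (orbit_covering_number k G \<omega>)) \<le> ln (real k ^ k * (2 ^ L * 3 ^ K))"
  proof (cases "orbit_covering_number k G \<omega> = 0")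
    \<comment> \<open>A value 0 is settled by the convention \<open>ln 0 = 0\<close>, as the
      right-hand side is nonnegative.\<close>
    case True
    have "1 \<le> real k ^ k * (2 ^ L * 3 ^ K)" using k by (intro mult_ge1_I one_le_power) auto
    thus ?thesis using True by simp
  qed (use le in \<open>simp add: ln_mono\<close>)
  also have "\<dots> = real k * ln (real k) + (real L * ln 2 + real K * ln 3)"
    using k by (simp add: ln_mult ln_realpow)
  also have "\<dots> \<le> real k * ln (real k) + ((16 * R2 / \<omega>\<^sup>2 * D) * ln 2 + D * ln 3)"
    using LD0 D unfolding L_def K_def by (intro add_left_mono add_mono mult_right_mono of_nat_floor) auto
  finally show ?thesis unfolding D_def by (simp add: algebra_simps)
qed


section \<open>Star polynomials\<close>

text \<open>
  A list of monomials, each a coefficient with a word encoded as in \<open>star_words\<close>.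
\<close>

type_synonym star_poly = "(complex \<times> (nat \<times> bool) list) list"

definition poly_ok :: "nat \<Rightarrow> star_poly \<Rightarrow> bool" where
  "poly_ok n P \<longleftrightarrow> (\<forall>(c, w)\<in>set P. \<forall>(i, b)\<in>set w. i < n)"

definition poly_scale :: "complex \<Rightarrow> star_poly \<Rightarrow> star_poly" where
  "poly_scale d P = map (\<lambda>(c, w). (d * c, w)) P"

definition word_adj :: "(nat \<times> bool) list \<Rightarrow> (nat \<times> bool) list" where
  "word_adj w = rev (map (\<lambda>(i, b). (i, \<not> b)) w)"

definition poly_adj :: "star_poly \<Rightarrow> star_poly" where
  "poly_adj P = map (\<lambda>(c, w). (cnj c, word_adj w)) P"

definition poly_mult :: "star_poly \<Rightarrow> star_poly \<Rightarrow> star_poly" where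
  "poly_mult P Q = concat (map (\<lambda>(c, v). map (\<lambda>(d, w). (c * d, v @ w)) Q) P)"

fun poly_power :: "star_poly \<Rightarrow> nat \<Rightarrow> star_poly" where
  "poly_power P 0 = [(1, [])]"
| "poly_power P (Suc q) = poly_mult P (poly_power P q)"

definition poly_var :: "nat \<Rightarrow> star_poly" where
  "poly_var l = [(1, [(l, False)])]"

lemma poly_ok_Nil [simp]: "poly_ok n []" by (simp add: poly_ok_def)
lemma poly_ok_Cons: "poly_ok n ((c, w) # P) \<longleftrightarrow> (\<forall>(i, b)\<in>set w. i < n) \<and> poly_ok n P" by (simp add: poly_ok_def)
lemma poly_ok_append [simp]: "poly_ok n (P @ Q) \<longleftrightarrow> poly_ok n P \<and> poly_ok n Q" by (simp add: poly_ok_def ball_Un)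
lemma poly_ok_scale [simp]: "poly_ok n P \<Longrightarrow> poly_ok n (poly_scale d P)" by (fastforce simp: poly_ok_def poly_scale_def)
lemma poly_ok_adj [simp]: "poly_ok n P \<Longrightarrow> poly_ok n (poly_adj P)" by (fastforce simp: poly_ok_def poly_adj_def word_adj_def)
lemma poly_ok_mult [simp]: "poly_ok n P \<Longrightarrow> poly_ok n Q \<Longrightarrow> poly_ok n (poly_mult P Q)"
  by (fastforce simp: poly_ok_def poly_mult_def)
lemma poly_ok_power [simp]: "poly_ok n P \<Longrightarrow> poly_ok n (poly_power P q)"
  by (induction q) (simp_all add: poly_ok_Cons)
lemma poly_ok_var [simp]: "l < n \<Longrightarrow> poly_ok n (poly_var l)" by (simp add: poly_var_def poly_ok_Cons)

lemma poly_mult_Nil [simp]: "poly_mult [] Q = []" by (simp add: poly_mult_def)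
lemma poly_mult_Cons: "poly_mult ((c, v) # P) Q = map (\<lambda>(d, w). (c * d, v @ w)) Q @ poly_mult P Q" by (simp add: poly_mult_def)

subsection \<open>Evaluation at operators\<close>

definition bop_word :: "'h::complex_hilbert_space bop list \<Rightarrow> (nat \<times> bool) list \<Rightarrow> 'h bop" where
  "bop_word ys w = foldr (\<lambda>(i, b) a. (if b then adj (ys ! i) else ys ! i) * a) w 1"

definition bop_poly :: "'h::complex_hilbert_space bop list \<Rightarrow> star_poly \<Rightarrow> 'h bop" where
  "bop_poly ys P = (\<Sum>(c, w)\<leftarrow>P. scal c * bop_word ys w)"

lemma bop_word_Nil [simp]: "bop_word ys [] = 1" by (simp add: bop_word_def)
lemma bop_word_Cons: "bop_word ys ((i, b) # w) = (if b then adj (ys ! i) else ys ! i) * bop_word ys w" by (simp add: bop_word_def)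

lemma bop_word_append: "bop_word ys (v @ w) = bop_word ys v * bop_word ys w"
proof (induction v)
  case (Cons x v) thus ?case by (cases x) (simp add: bop_word_Cons mult.assoc)
qed simp

lemma bop_word_adj: "bop_word ys (word_adj w) = adj (bop_word ys w)"
proof (induction w)
  case (Cons x w) thus ?case by (cases x) (simp add: word_adj_def bop_word_append bop_word_Cons adj_mult)
qed (simp add: word_adj_def)

lemma bop_poly_Nil [simp]: "bop_poly ys [] = 0" by (simp add: bop_poly_def)
lemma bop_poly_Cons: "bop_poly ys ((c, w) # P) = scal c * bop_word ys w + bop_poly ys P" by (simp add: bop_poly_def)
lemma bop_poly_append [simp]: "bop_poly ys (P @ Q) = bop_poly ys P + bop_poly ys Q" by (simp add: bop_poly_def)

lemma bop_poly_scale [simp]: "bop_poly ys (poly_scale d P) = scal d * bop_poly ys P"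
proof (induction P)
  case (Cons x P) thus ?case by (cases x) (simp add: poly_scale_def bop_poly_Cons distrib_left scal_mult_left)
qed (simp add: poly_scale_def)

lemma bop_poly_adj [simp]: "bop_poly ys (poly_adj P) = adj (bop_poly ys P)"
proof (induction P)
  case (Cons x P) thus ?case by (cases x) (simp add: poly_adj_def bop_poly_Cons adj_add adj_scal_mult bop_word_adj)
qed (simp add: poly_adj_def)

lemma bop_poly_mult [simp]: "bop_poly ys (poly_mult P Q) = bop_poly ys P * bop_poly ys Q"
proof (induction P)
  case (Cons x P)
  obtain c v where x: "x = (c, v)" by (cases x)
  have assoc: "scal (c * d) * (a * b) = scal c * a * (scal d * b)" for d and a b :: "'a bop"
    by (rule bop_eqI) (simp add: app_scaleC_right scaleC_scaleC mult.commute)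
  have "bop_poly ys (map (\<lambda>(d, w). (c * d, v @ w)) Q) = scal c * bop_word ys v * bop_poly ys Q"
  proof (induction Q)
    case (Cons y Q)
    thus ?case by (cases y) (simp add: bop_poly_Cons bop_word_append distrib_left assoc)
  qed simp
  thus ?case using Cons by (simp add: x poly_mult_Cons bop_poly_Cons distrib_right)
qed simp

lemma bop_poly_power [simp]: "bop_poly ys (poly_power P q) = bop_poly ys P ^ q"
  by (induction q) (simp_all add: bop_poly_Cons)

lemma bop_poly_var [simp]: "bop_poly ys (poly_var l) = ys ! l"
  by (simp add: poly_var_def bop_poly_Cons bop_word_Cons)

lemma star_algebra_bop_polys: "star_algebra {bop_poly ys P | P. poly_ok n P}"
proof -
  have one: "bop_poly ys [(1, [])] = 1" "poly_ok n [(1, [])]" by (simp_all add: bop_poly_Cons poly_ok_Cons)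
  show ?thesis
    unfolding star_algebra_def
  proof (intro conjI ballI allI)
    show "1 \<in> {bop_poly ys P | P. poly_ok n P}" using one by (metis (mono_tags, lifting) mem_Collect_eq)
  next
    fix a b assume "a \<in> {bop_poly ys P | P. poly_ok n P}" "b \<in> {bop_poly ys P | P. poly_ok n P}"
    then obtain P Q where PQ: "a = bop_poly ys P" "poly_ok n P" "b = bop_poly ys Q" "poly_ok n Q" by blast
    show "a + b \<in> {bop_poly ys P | P. poly_ok n P}"
      using PQ by (intro CollectI exI[of _ "P @ Q"]) simp
    show "a * b \<in> {bop_poly ys P | P. poly_ok n P}"
      using PQ by (intro CollectI exI[of _ "poly_mult P Q"]) simp
  next
    fix c a assume "a \<in> {bop_poly ys P | P. poly_ok n P}"
    then obtain P where P: "a = bop_poly ys P" "poly_ok n P" by blast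
    show "scal c * a \<in> {bop_poly ys P | P. poly_ok n P}"
      using P by (intro CollectI exI[of _ "poly_scale c P"]) simp
    show "adj a \<in> {bop_poly ys P | P. poly_ok n P}"
      using P by (intro CollectI exI[of _ "poly_adj P"]) simp
  qed
qed

lemma op_word_eq_bop_word:
  assumes "\<forall>(i, b)\<in>set w. i < length ys"
  shows "op_word (map op_of ys) w = op_of (bop_word ys w)"
  using assms
proof (induction w)
  case Nil show ?case by (simp add: op_word_def one_bop.rep_eq)
next
  case (Cons x w)
  thus ?case by (cases x) (auto simp: op_word_def bop_word_Cons times_bop.rep_eq adj.rep_eq)
qed

subsection \<open>Evaluation at matrices\<close>

lemma smult_smult_mat: "a \<cdot>\<^sub>m (b \<cdot>\<^sub>m A) = (a * b :: complex) \<cdot>\<^sub>m A"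
  by (rule eq_matI) (auto simp: mult.assoc)

definition mat_poly :: "nat \<Rightarrow> complex mat list \<Rightarrow> star_poly \<Rightarrow> complex mat" where
  "mat_poly k As P = foldr (\<lambda>(c, w) B. c \<cdot>\<^sub>m mat_word k As w + B) P (0\<^sub>m k k)"

context
  fixes k n :: nat and As :: "complex mat list"
  assumes As: "As \<in> mat_tuples k n"
begin

lemma mat_tuple_nth: "i < n \<Longrightarrow> As ! i \<in> carrier_mat k k"
  using As unfolding mat_tuples_def by auto

lemma mat_word_Nil [simp]: "mat_word k As [] = 1\<^sub>m k" by (simp add: mat_word_def)
lemma mat_word_Cons: "mat_word k As ((i, b) # w) = (if b then mat_adjoint (As ! i) else As ! i) * mat_word k As w"
  by (simp add: mat_word_def)

lemma mat_word_carrier [simp]: "\<forall>(i, b)\<in>set w. i < n \<Longrightarrow> mat_word k As w \<in> carrier_mat k k"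
proof (induction w)
  case (Cons x w) thus ?case by (cases x) (auto simp: mat_word_Cons mat_tuple_nth)
qed simp

lemma mat_word_append:
  "\<forall>(i, b)\<in>set v. i < n \<Longrightarrow> \<forall>(i, b)\<in>set w. i < n \<Longrightarrow> mat_word k As (v @ w) = mat_word k As v * mat_word k As w"
proof (induction v)
  case Nil thus ?case using left_mult_one_mat[OF mat_word_carrier[of w]] by simp
next
  case (Cons x v)
  obtain i b where x: "x = (i, b)" by (cases x)
  have l: "(if b then mat_adjoint (As ! i) else As ! i) \<in> carrier_mat k k" using Cons x by (simp add: mat_tuple_nth)
  have v: "\<forall>(i, b)\<in>set v. i < n" using Cons by simp
  show ?case
    using Cons.IH[OF v Cons.prems(2)] assoc_mult_square[OF l mat_word_carrier[OF v] mat_word_carrier[OF Cons.prems(2)]]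
    by (simp add: x mat_word_Cons)
qed

lemma word_adj_ok: "\<forall>(i, b)\<in>set w. i < n \<Longrightarrow> \<forall>(i, b)\<in>set (word_adj w). i < n"
  by (auto simp: word_adj_def)

lemma mat_word_adj: "\<forall>(i, b)\<in>set w. i < n \<Longrightarrow> mat_word k As (word_adj w) = mat_adjoint (mat_word k As w)"
proof (induction w)
  case Nil show ?case by (simp add: word_adj_def)
next
  case (Cons x w)
  obtain i b where x: "x = (i, b)" by (cases x)
  have i: "As ! i \<in> carrier_mat k k" using Cons x by (simp add: mat_tuple_nth)
  have w: "\<forall>(i, b)\<in>set w. i < n" using Cons by simp
  have l: "(if b then mat_adjoint (As ! i) else As ! i) \<in> carrier_mat k k" using i by simp
  have xi: "\<forall>(i, b)\<in>set [(i, \<not> b)]. i < n" using Cons x by simp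
  have "word_adj (x # w) = word_adj w @ [(i, \<not> b)]" by (simp add: x word_adj_def)
  hence "mat_word k As (word_adj (x # w)) = mat_adjoint (mat_word k As w) * mat_word k As [(i, \<not> b)]"
    using Cons.IH[OF w] mat_word_append[OF word_adj_ok[OF w] xi] by simp
  also have "mat_word k As [(i, \<not> b)] = mat_adjoint (if b then mat_adjoint (As ! i) else As ! i)"
    using i mat_adjoint_carrier[OF i] by (simp add: mat_word_Cons right_mult_one_mat[of _ k k] mat_adjoint_adjoint[OF i])
  finally show ?case
    by (simp add: x mat_word_Cons mat_adjoint_mult[OF l mat_word_carrier[OF w]])
qed

lemma mat_poly_Nil [simp]: "mat_poly k As [] = 0\<^sub>m k k" by (simp add: mat_poly_def)
lemma mat_poly_Cons: "mat_poly k As ((c, w) # P) = c \<cdot>\<^sub>m mat_word k As w + mat_poly k As P" by (simp add: mat_poly_def)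

lemma mat_poly_carrier [simp]: "poly_ok n P \<Longrightarrow> mat_poly k As P \<in> carrier_mat k k"
proof (induction P)
  case (Cons x P) thus ?case by (cases x) (simp add: mat_poly_Cons poly_ok_Cons)
qed simp

lemma mat_poly_append: "poly_ok n P \<Longrightarrow> poly_ok n Q \<Longrightarrow> mat_poly k As (P @ Q) = mat_poly k As P + mat_poly k As Q"
proof (induction P)
  case Nil thus ?case using left_add_zero_mat[OF mat_poly_carrier[of Q]] by simp
next
  case (Cons x P)
  thus ?case by (cases x) (simp add: mat_poly_Cons poly_ok_Cons assoc_add_mat[of _ k k])
qed

lemma mat_poly_scale: "poly_ok n P \<Longrightarrow> mat_poly k As (poly_scale d P) = d \<cdot>\<^sub>m mat_poly k As P"
proof (induction P)
  case Nil show ?case by (simp add: poly_scale_def)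
next
  case (Cons x P)
  thus ?case by (cases x) (simp add: poly_scale_def mat_poly_Cons poly_ok_Cons add_smult_distrib_left_mat[of _ k k] smult_smult_mat)
qed

lemma mat_adjoint_zero [simp]: "mat_adjoint (0\<^sub>m k k :: complex mat) = 0\<^sub>m k k"
  by (rule eq_matI) (auto simp: mat_adjoint_index[OF zero_carrier_mat])

lemma mat_poly_adj: "poly_ok n P \<Longrightarrow> mat_poly k As (poly_adj P) = mat_adjoint (mat_poly k As P)"
proof (induction P)
  case Nil show ?case by (simp add: poly_adj_def)
next
  case (Cons x P)
  thus ?case by (cases x) (simp add: poly_adj_def mat_poly_Cons poly_ok_Cons mat_adjoint_add[of _ k k] mat_adjoint_smult[of _ k k] mat_word_adj)
qed

lemma mat_poly_mult: "poly_ok n P \<Longrightarrow> poly_ok n Q \<Longrightarrow> mat_poly k As (poly_mult P Q) = mat_poly k As P * mat_poly k As Q"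
proof (induction P)
  case Nil thus ?case using left_mult_zero_mat[OF mat_poly_carrier[of Q]] by simp
next
  case (Cons x P)
  obtain c v where x: "x = (c, v)" by (cases x)
  have v: "\<forall>(i, b)\<in>set v. i < n" and P: "poly_ok n P" using Cons.prems by (simp_all add: x poly_ok_Cons)
  note vc = mat_word_carrier[OF v]
  have ok: "poly_ok n Q \<Longrightarrow> poly_ok n (map (\<lambda>(d, w). (c * d, v @ w)) Q)" for Q
    using v by (fastforce simp: poly_ok_def)
  have "mat_poly k As (map (\<lambda>(d, w). (c * d, v @ w)) Q) = (c \<cdot>\<^sub>m mat_word k As v) * mat_poly k As Q"
    using Cons.prems(2)
  proof (induction Q)
    case Nil show ?case using right_mult_zero_mat[OF smult_carrier_mat[OF vc]] by simp
  next
    case (Cons y Q)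
    obtain d w where y: "y = (d, w)" by (cases y)
    have w: "\<forall>(i, b)\<in>set w. i < n" and Q: "poly_ok n Q" using Cons.prems by (simp_all add: y poly_ok_Cons)
    note wc = mat_word_carrier[OF w] and Qc = mat_poly_carrier[OF Q]
    have "(c \<cdot>\<^sub>m mat_word k As v) * (d \<cdot>\<^sub>m mat_word k As w + mat_poly k As Q) =
        (c \<cdot>\<^sub>m mat_word k As v) * (d \<cdot>\<^sub>m mat_word k As w) + (c \<cdot>\<^sub>m mat_word k As v) * mat_poly k As Q"
      by (rule mult_add_distrib_mat[OF smult_carrier_mat[OF vc] smult_carrier_mat[OF wc] Qc])
    also have "(c \<cdot>\<^sub>m mat_word k As v) * (d \<cdot>\<^sub>m mat_word k As w) = (c * d) \<cdot>\<^sub>m (mat_word k As v * mat_word k As w)"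
      using mult_smult_assoc_mat[OF vc smult_carrier_mat[OF wc]] mult_smult_distrib[OF vc wc] by (simp add: smult_smult_mat)
    finally show ?case using Cons.IH[OF Q] by (simp add: y mat_poly_Cons mat_word_append[OF v w])
  qed
  thus ?case
    using Cons.IH[OF P Cons.prems(2)] mat_poly_append[OF ok[OF Cons.prems(2)] poly_ok_mult[OF P Cons.prems(2)]]
      add_mult_distrib_mat[OF smult_carrier_mat[OF vc] mat_poly_carrier[OF P] mat_poly_carrier[OF Cons.prems(2)]]
    by (simp add: x poly_mult_Cons mat_poly_Cons)
qed

lemma mat_poly_one: "mat_poly k As [(1, [])] = 1\<^sub>m k"
  by (rule eq_matI) (auto simp: mat_poly_Cons)

lemma mat_poly_var: assumes "l < n" shows "mat_poly k As (poly_var l) = As ! l"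
proof -
  note c = mat_tuple_nth[OF assms]
  have "mat_poly k As (poly_var l) = 1 \<cdot>\<^sub>m (As ! l * 1\<^sub>m k) + 0\<^sub>m k k"
    unfolding poly_var_def by (simp add: mat_poly_Cons mat_word_Cons)
  thus ?thesis using c by (intro eq_matI) auto
qed

lemma tau_mat_poly: "poly_ok n P \<Longrightarrow> tau_mat k (mat_poly k As P) = (\<Sum>(c, w)\<leftarrow>P. c * tau_mat k (mat_word k As w))"
proof (induction P)
  case Nil show ?case by (simp add: tau_mat_def)
next
  case (Cons x P)
  thus ?case by (cases x) (simp add: mat_poly_Cons poly_ok_Cons tau_mat_add tau_mat_smult)
qed

end

subsection \<open>Microstates evaluate star polynomials\<close>

lemma microstates_mono:
  assumes "m \<le> m'" "\<epsilon>' \<le> \<epsilon>"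
  shows "microstates \<tau> xs R m' k \<epsilon>' \<subseteq> microstates \<tau> xs R m k \<epsilon>"
proof -
  have "star_words n m \<subseteq> star_words n m'" for n using assms unfolding star_words_def by auto
  thus ?thesis using assms unfolding microstates_def by fastforce
qed

context tracial_algebra
begin

lemma bop_word_M: "\<forall>(i, b)\<in>set w. i < length ys \<Longrightarrow> set ys \<subseteq> M \<Longrightarrow> bop_word ys w \<in> M"
proof (induction w)
  case (Cons x w)
  obtain i b where x: "x = (i, b)" by (cases x)
  have "ys ! i \<in> M" using Cons x by (metis (no_types, lifting) case_prodD list.set_intros(1) nth_mem subsetD)
  thus ?case using Cons by (simp add: x bop_word_Cons)
qed simp

lemma bop_poly_M: "poly_ok (length ys) P \<Longrightarrow> set ys \<subseteq> M \<Longrightarrow> bop_poly ys P \<in> M"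
proof (induction P)
  case (Cons x P) thus ?case by (cases x) (simp add: bop_poly_Cons poly_ok_Cons bop_word_M)
qed simp

lemma tr_bop_poly:
  "poly_ok (length ys) P \<Longrightarrow> set ys \<subseteq> M \<Longrightarrow> tr (bop_poly ys P) = (\<Sum>(c, w)\<leftarrow>P. c * tr (bop_word ys w))"
proof (induction P)
  case (Cons x P)
  thus ?case by (cases x) (simp add: bop_poly_Cons poly_ok_Cons tr_add tr_scal bop_word_M bop_poly_M)
qed simp

text \<open>The trace of a polynomial is a fixed combination of traces of its words. So
  \<open>m\<close> is the largest word length, and \<epsilon> is \<open>e\<close> divided by the
  total size of the coefficients.\<close>

lemma microstates_poly:
  assumes \<tau>: "\<And>a. \<tau> (op_of a) = tr a" and ys: "set ys \<subseteq> M" and P: "poly_ok (length ys) P" and e: "e > 0"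
  shows "\<exists>m \<epsilon>. \<epsilon> > 0 \<and> (\<forall>k>0. \<forall>As\<in>microstates \<tau> (map op_of ys) R m k \<epsilon>.
     cmod (tau_mat k (mat_poly k As P) - tr (bop_poly ys P)) < e)"
proof -
  define S where "S = 1 + (\<Sum>(c, w)\<leftarrow>P. cmod c)"
  have S: "S > 0" unfolding S_def by (intro add_pos_nonneg sum_list_nonneg) auto
  define \<epsilon> where "\<epsilon> = e / S"
  have \<epsilon>: "\<epsilon> > 0" unfolding \<epsilon>_def using e S by simp
  define m where "m = Max (insert 0 (length ` snd ` set P))"
  have len: "length w \<le> m" if "(c, w) \<in> set P" for c w
    unfolding m_def by (rule Max_ge) (use that in force)+
  show ?thesis
  proof (rule exI[of _ m], rule exI[of _ \<epsilon>], intro conjI allI impI ballI \<epsilon>)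
    fix k As assume k: "k > (0::nat)" and As: "As \<in> microstates \<tau> (map op_of ys) R m k \<epsilon>"
    have At: "As \<in> mat_tuples k (length ys)" using As unfolding microstates_def by simp
    have word: "cmod (tau_mat k (mat_word k As w) - tr (bop_word ys w)) \<le> \<epsilon>" if cw: "(c, w) \<in> set P" for c w
    proof (cases "w = []")
      \<comment> \<open>\<open>star_words\<close> omits the empty word; its trace is 1 on both sides
        since \<open>k > 0\<close>.\<close>
      case True thus ?thesis using k \<epsilon> by (simp add: mat_word_def tau_mat_one tr_one)
    next
      case False
      have ok: "\<forall>(i, b)\<in>set w. i < length ys" using P cw unfolding poly_ok_def by fastforce
      have "w \<in> star_words (length (map op_of ys)) m"
        using False len[OF cw] ok unfolding star_words_def by (cases w) auto
      hence "cmod (tau_mat k (mat_word k As w) - \<tau> (op_word (map op_of ys) w)) < \<epsilon>"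
        using As unfolding microstates_def by blast
      thus ?thesis by (simp add: op_word_eq_bop_word[OF ok] \<tau>)
    qed
    have "tau_mat k (mat_poly k As P) - tr (bop_poly ys P) =
        (\<Sum>(c, w)\<leftarrow>P. c * (tau_mat k (mat_word k As w) - tr (bop_word ys w)))"
      unfolding tau_mat_poly[OF At P] tr_bop_poly[OF P ys]
      by (simp add: sum_list_subtractf[symmetric] split_def right_diff_distrib)
    also have "cmod \<dots> \<le> (\<Sum>(c, w)\<leftarrow>P. cmod c * \<epsilon>)"
      using word
    proof (induction P)
      case (Cons x P)
      obtain c w where x: "x = (c, w)" by (cases x)
      have "cmod (c * (tau_mat k (mat_word k As w) - tr (bop_word ys w))) \<le> cmod c * \<epsilon>"
        unfolding norm_mult using Cons.prems[of c w] by (intro mult_left_mono) (auto simp: x)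
      moreover have "cmod (\<Sum>(c, w)\<leftarrow>P. c * (tau_mat k (mat_word k As w) - tr (bop_word ys w))) \<le> (\<Sum>(c, w)\<leftarrow>P. cmod c * \<epsilon>)"
        by (rule Cons.IH) (use Cons.prems in auto)
      ultimately show ?case by (simp add: x norm_triangle_mono)
    qed simp
    also have "\<dots> = (\<Sum>(c, w)\<leftarrow>P. cmod c) * \<epsilon>" by (simp add: sum_list_mult_const split_def)
    also have "\<dots> < S * \<epsilon>" unfolding S_def using \<epsilon> by simp
    also have "\<dots> = e" unfolding \<epsilon>_def using S by simp
    finally show "cmod (tau_mat k (mat_poly k As P) - tr (bop_poly ys P)) < e" .
  qed
qed

lemma microstates_polys:
  assumes \<tau>: "\<And>a. \<tau> (op_of a) = tr a" and ys: "set ys \<subseteq> M" and e: "e > 0"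
  shows "\<forall>P\<in>set Ps. poly_ok (length ys) P \<Longrightarrow> \<exists>m \<epsilon>. \<epsilon> > 0 \<and> (\<forall>k>0. \<forall>As\<in>microstates \<tau> (map op_of ys) R m k \<epsilon>. \<forall>P\<in>set Ps.
     cmod (tau_mat k (mat_poly k As P) - tr (bop_poly ys P)) < e)"
proof (induction Ps)
  case Nil show ?case by (auto intro: exI[of _ 1])
next
  case (Cons P Ps)
  from Cons obtain m1 \<epsilon>1 where 1: "\<epsilon>1 > 0" "\<forall>k>0. \<forall>As\<in>microstates \<tau> (map op_of ys) R m1 k \<epsilon>1. \<forall>P\<in>set Ps.
     cmod (tau_mat k (mat_poly k As P) - tr (bop_poly ys P)) < e" by auto
  have "poly_ok (length ys) P" using Cons by simp
  from microstates_poly[OF \<tau> ys this e, of R] obtain m2 \<epsilon>2 where 2: "\<epsilon>2 > 0" "\<forall>k>0. \<forall>As\<in>microstates \<tau> (map op_of ys) R m2 k \<epsilon>2.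
     cmod (tau_mat k (mat_poly k As P) - tr (bop_poly ys P)) < e" by (elim exE conjE)
  have sub: "microstates \<tau> (map op_of ys) R (max m1 m2) k (min \<epsilon>1 \<epsilon>2) \<subseteq>
      microstates \<tau> (map op_of ys) R m1 k \<epsilon>1 \<inter> microstates \<tau> (map op_of ys) R m2 k \<epsilon>2" for k
    by (intro Int_greatest microstates_mono) simp_all
  show ?case
  proof (intro exI[of _ "max m1 m2"] exI[of _ "min \<epsilon>1 \<epsilon>2"] conjI allI impI ballI)
    show "min \<epsilon>1 \<epsilon>2 > 0" using 1 2 by simp
    fix k As P' assume k: "k > (0::nat)" and As: "As \<in> microstates \<tau> (map op_of ys) R (max m1 m2) k (min \<epsilon>1 \<epsilon>2)"
      and P': "P' \<in> set (P # Ps)"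
    have "As \<in> microstates \<tau> (map op_of ys) R m1 k \<epsilon>1" "As \<in> microstates \<tau> (map op_of ys) R m2 k \<epsilon>2"
      using As sub by blast+
    thus "cmod (tau_mat k (mat_poly k As P') - tr (bop_poly ys P')) < e"
      using 1(2) 2(2) k P' by (cases "P' = P") auto
  qed
qed

end


section \<open>Covering the microstate spaces\<close>

lemma diag_real_mult: "diag_real k f * diag_real k g = diag_real k (\<lambda>i. f i * g i)"
proof (rule eq_matI)
  fix i j assume "i < dim_row (diag_real k (\<lambda>i. f i * g i))" "j < dim_col (diag_real k (\<lambda>i. f i * g i))"
  hence ij: "i < k" "j < k" unfolding diag_real_def by auto
  have "(diag_real k f * diag_real k g) $$ (i, j) = (\<Sum>a<k. diag_real k f $$ (i, a) * diag_real k g $$ (a, j))"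
    by (rule mult_mat_index[OF diag_real_carrier diag_real_carrier ij])
  also have "\<dots> = (\<Sum>a<k. if a = i then (if i = j then complex_of_real (f i * g i) else 0) else 0)"
    using ij by (intro sum.cong) (auto simp: diag_real_def)
  finally show "(diag_real k f * diag_real k g) $$ (i, j) = diag_real k (\<lambda>i. f i * g i) $$ (i, j)"
    using ij by (simp add: diag_real_def)
qed (auto simp: diag_real_def)

lemma diag_real_commutator_index:
  assumes Y: "Y \<in> carrier_mat k k" and ij: "i < k" "j < k"
  shows "(diag_real k d * Y - Y * diag_real k d) $$ (i, j) = complex_of_real (d i - d j) * Y $$ (i, j)"
proof -
  have "(diag_real k d * Y) $$ (i, j) = (\<Sum>a<k. diag_real k d $$ (i, a) * Y $$ (a, j))"
    by (rule mult_mat_index[OF diag_real_carrier Y ij])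
  also have "\<dots> = (\<Sum>a<k. if a = i then complex_of_real (d i) * Y $$ (i, j) else 0)"
    using ij by (intro sum.cong) (auto simp: diag_real_def)
  finally have 1: "(diag_real k d * Y) $$ (i, j) = complex_of_real (d i) * Y $$ (i, j)" using ij by simp
  have "(Y * diag_real k d) $$ (i, j) = (\<Sum>a<k. Y $$ (i, a) * diag_real k d $$ (a, j))"
    by (rule mult_mat_index[OF Y diag_real_carrier ij])
  also have "\<dots> = (\<Sum>a<k. if a = j then complex_of_real (d j) * Y $$ (i, j) else 0)"
    using ij by (intro sum.cong) (auto simp: diag_real_def)
  finally have 2: "(Y * diag_real k d) $$ (i, j) = complex_of_real (d j) * Y $$ (i, j)" using ij by simp
  have "diag_real k d * Y \<in> carrier_mat k k" "Y * diag_real k d \<in> carrier_mat k k" using Y by simp_all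
  hence "(diag_real k d * Y - Y * diag_real k d) $$ (i, j) = (diag_real k d * Y) $$ (i, j) - (Y * diag_real k d) $$ (i, j)"
    using ij by (subst index_minus_mat) auto
  thus ?thesis unfolding 1 2 by (simp add: left_diff_distrib)
qed

lemma unitary_conj_mult:
  assumes W: "W \<in> unitary_group k" and A: "A \<in> carrier_mat k k" and B: "B \<in> carrier_mat k k"
  shows "mat_adjoint W * (A * B) * W = (mat_adjoint W * A * W) * (mat_adjoint W * B * W)"
proof -
  note c = unitary_group_carrier[OF W]
  show ?thesis using c A B W by (simp add: assoc_mult_square[of _ k] unitary_cancel)
qed

text \<open>In the eigenbasis of \<open>H\<close> the commutator has entries (d_i - d_j) Y_ij, and
  \<open>fro\<close> is unitarily invariant. The right-hand side is the weighted sum that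
  \<open>ln_orbit_covering_number_le\<close> asks to be at most \<delta>.\<close>

lemma fro_commutator_diag:
  assumes W: "W \<in> unitary_group k" and H: "H \<in> carrier_mat k k" and A: "A \<in> carrier_mat k k"
    and d: "mat_adjoint W * H * W = diag_real k d"
  shows "fro k (H * A - A * H) =
    (\<Sum>i<k. \<Sum>j<k. (d i - d j)\<^sup>2 * (cmod ((mat_adjoint W * A * W) $$ (i, j)))\<^sup>2) / real k"
proof -
  note c = unitary_group_carrier[OF W]
  define Y where "Y = mat_adjoint W * A * W"
  have Y: "Y \<in> carrier_mat k k" unfolding Y_def using c A by auto
  have HA: "H * A \<in> carrier_mat k k" and AH: "A * H \<in> carrier_mat k k" using H A by auto
  have "mat_adjoint W * (H * A - A * H) * W = mat_adjoint W * (H * A) * W - mat_adjoint W * (A * H) * W"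
    using mult_minus_distrib_mat[of "mat_adjoint W" k k "H * A" k "A * H"] c HA AH
      minus_mult_distrib_mat[of "mat_adjoint W * (H * A)" k k "mat_adjoint W * (A * H)" W k] by simp
  also have "\<dots> = diag_real k d * Y - Y * diag_real k d"
    unfolding unitary_conj_mult[OF W H A] unitary_conj_mult[OF W A H] d Y_def ..
  finally have eq: "mat_adjoint W * (H * A - A * H) * W = diag_real k d * Y - Y * diag_real k d" .
  have "fro k (H * A - A * H) = fro k (diag_real k d * Y - Y * diag_real k d)"
    using fro_conj[OF W minus_carrier_mat[OF AH, of "H * A"]] unfolding eq by simp
  thus ?thesis unfolding fro_def Y_def[symmetric]
    by (simp add: diag_real_commutator_index[OF Y] norm_mult power_mult_distrib del: index_minus_mat)
       (simp flip: of_real_diff)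
qed

context tracial_algebra
begin

text \<open>\<open>m\<close> and \<epsilon> are chosen last and absorb everything that depends on
  \<open>H\<close>, \<eta> and \<open>R\<close>. The constant \<open>R2\<close> depends on the
  generators only, so the factor in front of \<eta> stays fixed when \<eta> shrinks.\<close>

lemma microstates_covering:
  assumes \<tau>: "\<And>a. \<tau> (op_of a) = tr a" and ys: "set ys \<subseteq> M"
    and dense: "M \<subseteq> bcomm (bcomm {bop_poly ys P | P. poly_ok (length ys) P})"
    and factor: "M \<inter> bcomm M = range scal"
    and gamma: "\<And>X e. finite X \<Longrightarrow> X \<subseteq> M \<Longrightarrow> e > 0 \<Longrightarrow>
      \<exists>u\<in>M. adj u * u = 1 \<and> u * adj u = 1 \<and> tr u = 0 \<and> (\<forall>x\<in>X. n2 (u * x - x * u) < e)"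
    and \<omega>: "\<omega> > 0" and \<eta>: "\<eta> > 0"
  defines "n \<equiv> length ys"
  defines "R2 \<equiv> 1 + (\<Sum>l<n. (n2 (ys ! l))\<^sup>2)"
  shows "\<exists>m \<epsilon>. m \<ge> 1 \<and> \<epsilon> > 0 \<and> (\<forall>k>0.
    ln (real (orbit_covering_number k (microstates \<tau> (map op_of ys) R m k \<epsilon>) \<omega>)) \<le>
    real k * ln (real k) + (16 * R2 / \<omega>\<^sup>2 * ln 2 + ln 3) * (6 * (real n + 1) * \<eta> * (real k)\<^sup>2))"
proof -
  define A where "A = {bop_poly ys P | P. poly_ok n P}"
  have A: "star_algebra A" "A \<subseteq> M" "M \<subseteq> bcomm (bcomm A)"
    unfolding A_def using star_algebra_bop_polys bop_poly_M ys dense unfolding n_def by auto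
  define \<delta> where "\<delta> = \<omega>\<^sup>2 / 16"
  have \<delta>: "\<delta> > 0" unfolding \<delta>_def using \<omega> by simp
  obtain s Q e0 where e0: "e0 > 0" and close: "\<forall>k d \<mu>. k > 0 \<longrightarrow> spread_moments s \<mu> \<longrightarrow>
    (\<forall>q\<le>Q. cmod (complex_of_real (moment k d q) - \<mu> q) < e0) \<longrightarrow>
    real (card {(i, j). i < k \<and> j < k \<and> \<bar>d i - d j\<bar> < 1}) \<le> \<eta> * (real k)\<^sup>2"
    using close_pairs_of_moments[OF \<eta>] by (elim exE conjE)
  \<comment> \<open>Half of the moment tolerance, the other half being left to the microstates. The
    square of the second entry is half of the share of \<delta> allotted to one generator.\<close>
  define e1 where "e1 = min (e0 / 2) (sqrt (\<delta> / (2 * (real n + 1))))"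
  have e1: "e1 > 0" unfolding e1_def using e0 \<delta> by simp
  obtain H \<mu> where H: "H \<in> A" "adj H = H" "\<forall>x\<in>set ys. n2 (H * x - x * H) < e1"
    "spread_moments s \<mu>" "\<forall>q\<le>Q. cmod (tr (H ^ q) - \<mu> q) < e1"
    using spread_element[OF A factor gamma finite_set ys e1, of s Q] by blast
  obtain P0 where P0: "poly_ok n P0" "H = bop_poly ys P0" using H(1) unfolding A_def by blast
  \<comment> \<open>\<open>P0\<close> has a self-adjoint value at \<open>ys\<close> but need not be
    formally self-adjoint. Symmetrising keeps the value \<open>H\<close> at \<open>ys\<close> and
    makes the value at every matrix tuple exactly hermitian, as diagonalisation requires.\<close>
  define P where "P = poly_scale (1/2) (P0 @ poly_adj P0)"
  have P: "poly_ok n P" unfolding P_def using P0 by simp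
  have bP: "bop_poly ys P = H"
  proof -
    have "bop_poly ys P = scal (complex_of_real (1/2)) * (H + H)" unfolding P_def using P0 H(2) by simp
    also have "\<dots> = (1/2) *\<^sub>R (2 *\<^sub>R H)" unfolding scal_of_real_mult scaleR_2 ..
    finally show ?thesis by simp
  qed
  define C where "C l = poly_mult P (poly_var l) @ poly_scale (- 1) (poly_mult (poly_var l) P)" for l
  have C: "poly_ok n (C l)" if "l < n" for l unfolding C_def using that P by simp
  have bC: "bop_poly ys (C l) = H * ys ! l - ys ! l * H" for l unfolding C_def by (simp add: bP)
  define sq where "sq P = poly_mult (poly_adj P) P" for P
  \<comment> \<open>The finitely many traces to be matched: powers of \<open>P\<close> for the
    moments of the eigenvalues, \<open>sq (C l)\<close> for the 2-norms of the commutators, and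
    \<open>sq (poly_var l)\<close> for the bound \<open>R2\<close>.\<close>
  define Ps where "Ps = map (poly_power P) [0..<Suc Q] @ map (\<lambda>l. sq (C l)) [0..<n] @ map (\<lambda>l. sq (poly_var l)) [0..<n]"
  have Ps: "\<forall>P\<in>set Ps. poly_ok (length ys) P"
    unfolding Ps_def sq_def using P C unfolding n_def[symmetric] by auto
  define e2 where "e2 = min (e0 / 2) (min (\<delta> / (2 * (real n + 1))) (1 / (real n + 1)))"
  have e2: "e2 > 0" unfolding e2_def using e0 \<delta> by simp
  from microstates_polys[OF \<tau> ys e2 Ps, of R] obtain m \<epsilon> where \<epsilon>: "\<epsilon> > 0" and
    ms: "\<forall>k>0. \<forall>As\<in>microstates \<tau> (map op_of ys) R m k \<epsilon>. \<forall>P\<in>set Ps. cmod (tau_mat k (mat_poly k As P) - tr (bop_poly ys P)) < e2"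
    by (elim exE conjE)
  show ?thesis
  proof (rule exI[of _ "max 1 m"], rule exI[of _ \<epsilon>], intro conjI allI impI \<epsilon>)
    fix k :: nat assume k: "k > 0"
    define G where "G = microstates \<tau> (map op_of ys) R (max 1 m) k \<epsilon>"
    have Gt: "G \<subseteq> mat_tuples k n" unfolding G_def microstates_def n_def by auto
    show "ln (real (orbit_covering_number k (microstates \<tau> (map op_of ys) R (max 1 m) k \<epsilon>) \<omega>)) \<le>
      real k * ln (real k) + (16 * R2 / \<omega>\<^sup>2 * ln 2 + ln 3) * (6 * (real n + 1) * \<eta> * (real k)\<^sup>2)"
      unfolding G_def[symmetric]
    proof (rule ln_orbit_covering_number_le[OF k \<omega> \<eta> _ Gt, where \<delta> = \<delta>])
      show "0 \<le> R2" unfolding R2_def by (intro add_nonneg_nonneg sum_nonneg) auto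
      show "16 * \<delta> \<le> \<omega>\<^sup>2" unfolding \<delta>_def by simp
      fix As assume As: "As \<in> G"
      have At: "As \<in> mat_tuples k n" using As Gt by blast
      note Al = mat_tuple_nth[OF At]
      have "As \<in> microstates \<tau> (map op_of ys) R m k \<epsilon>"
        by (rule subsetD[OF microstates_mono[of m "max 1 m" \<epsilon> \<epsilon>]]) (use As in \<open>simp_all add: G_def\<close>)
      hence approx: "cmod (tau_mat k (mat_poly k As P) - tr (bop_poly ys P)) < e2" if "P \<in> set Ps" for P
        using ms k that by blast
      have sq_fro: "tau_mat k (mat_poly k As (sq P)) = complex_of_real (fro k (mat_poly k As P))"
        "tr (bop_poly ys (sq P)) = complex_of_real ((n2 (bop_poly ys P))\<^sup>2)" if "poly_ok n P" for P
        unfolding sq_def using that bop_poly_M[OF _ ys] unfolding n_def[symmetric]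
        by (simp_all add: mat_poly_mult[OF At] mat_poly_adj[OF At] mat_poly_carrier[OF At] tau_mat_adjoint_mult tr_adj_self)
      have sq_le: "fro k (mat_poly k As P) \<le> (n2 (bop_poly ys P))\<^sup>2 + e2" if "sq P \<in> set Ps" "poly_ok n P" for P
      proof -
        have "cmod (complex_of_real (fro k (mat_poly k As P) - (n2 (bop_poly ys P))\<^sup>2)) < e2"
          using approx[OF that(1)] unfolding sq_fro[OF that(2)] by (simp only: of_real_diff)
        thus ?thesis unfolding norm_of_real by linarith
      qed
      define Hm where "Hm = mat_poly k As P"
      have Hm: "Hm \<in> carrier_mat k k" unfolding Hm_def by (rule mat_poly_carrier[OF At P])
      have Hm_adj: "mat_adjoint Hm = Hm"
      proof -
        note c0 = mat_poly_carrier[OF At P0(1)]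
        have "Hm = (1/2) \<cdot>\<^sub>m (mat_poly k As P0 + mat_adjoint (mat_poly k As P0))"
          unfolding Hm_def P_def using P0
          by (simp add: mat_poly_scale[OF At] mat_poly_append[OF At] mat_poly_adj[OF At])
        thus ?thesis using c0 mat_adjoint_carrier[OF c0]
          by (simp add: mat_adjoint_smult[of _ k k] mat_adjoint_add[of _ k k] mat_adjoint_adjoint[OF c0] comm_add_mat[of _ k k])
      qed
      obtain W d where W: "W \<in> unitary_group k" and d: "mat_adjoint W * Hm * W = diag_real k d"
        using hermitian_diagonalization[OF Hm Hm_adj] by blast
      note Wc = unitary_group_carrier[OF W]
      have pow: "mat_adjoint W * mat_poly k As (poly_power P q) * W = diag_real k (\<lambda>i. d i ^ q)" for q
      proof (induction q)
        case 0
        have "mat_adjoint W * 1\<^sub>m k * W = 1\<^sub>m k" using W Wc right_mult_one_mat[of "mat_adjoint W" k k] unfolding unitary_group_def by simp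
        also have "1\<^sub>m k = diag_real k (\<lambda>i. d i ^ 0)" by (rule eq_matI) (auto simp: diag_real_def)
        finally show ?case by (simp add: mat_poly_one[OF At])
      next
        case (Suc q)
        thus ?case
          using unitary_conj_mult[OF W Hm mat_poly_carrier[OF At poly_ok_power[OF P, of q]]] d
          by (simp add: mat_poly_mult[OF At] P Hm_def diag_real_mult)
      qed
      have mom: "\<forall>q\<le>Q. cmod (complex_of_real (moment k d q) - \<mu> q) < e0"
      proof (intro allI impI)
        fix q assume q: "q \<le> Q"
        have "poly_power P q \<in> poly_power P ` {0..<Suc Q}" using q by (intro imageI) auto
        hence mem: "poly_power P q \<in> set Ps" unfolding Ps_def by (simp only: set_append set_map set_upt Un_iff simp_thms)
        have e2_le: "e2 \<le> e0 / 2" unfolding e2_def by (rule min.cobounded1)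
        have "complex_of_real (moment k d q) = tau_mat k (diag_real k (\<lambda>i. d i ^ q))"
          unfolding tau_mat_def diag_real_def moment_def by simp
        also have "\<dots> = tau_mat k (mat_poly k As (poly_power P q))"
          unfolding pow[symmetric] by (rule tau_mat_conj[OF W mat_poly_carrier[OF At poly_ok_power[OF P]]])
        finally have "cmod (complex_of_real (moment k d q) - tr (H ^ q)) < e0 / 2"
          using approx[OF mem] e2_le by (simp add: bP)
        moreover have "cmod (tr (H ^ q) - \<mu> q) < e0 / 2" using H(5) q unfolding e1_def by simp
        ultimately show "cmod (complex_of_real (moment k d q) - \<mu> q) < e0"
          using norm_triangle_ineq[of "complex_of_real (moment k d q) - tr (H ^ q)" "tr (H ^ q) - \<mu> q"] by simp
      qed
      have "real (card {(i, j). i < k \<and> j < k \<and> \<bar>d i - d j\<bar> < 1}) \<le> \<eta> * (real k)\<^sup>2"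
        using close k H(4) mom by blast
      moreover have "(\<Sum>l<n. fro k (As ! l)) \<le> R2"
      proof -
        have "(\<Sum>l<n. fro k (As ! l)) \<le> (\<Sum>l<n. (n2 (ys ! l))\<^sup>2 + 1 / (real n + 1))"
        proof (rule sum_mono)
          fix l assume l: "l \<in> {..<n}"
          have "fro k (mat_poly k As (poly_var l)) \<le> (n2 (bop_poly ys (poly_var l)))\<^sup>2 + e2"
            using l by (intro sq_le) (auto simp: Ps_def)
          also have "e2 \<le> 1 / (real n + 1)" unfolding e2_def by simp
          finally show "fro k (As ! l) \<le> (n2 (ys ! l))\<^sup>2 + 1 / (real n + 1)"
            using l by (simp add: mat_poly_var[OF At])
        qed
        also have "\<dots> = (\<Sum>l<n. (n2 (ys ! l))\<^sup>2) + real n / (real n + 1)" by (simp add: sum.distrib)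
        also have "real n / (real n + 1) \<le> 1" by simp
        finally show ?thesis unfolding R2_def by simp
      qed
      moreover have "(\<Sum>l<n. (\<Sum>i<k. \<Sum>j<k. (d i - d j)\<^sup>2 * (cmod ((mat_adjoint W * (As ! l) * W) $$ (i, j)))\<^sup>2) / real k) \<le> \<delta>"
      proof -
        have "(\<Sum>l<n. (\<Sum>i<k. \<Sum>j<k. (d i - d j)\<^sup>2 * (cmod ((mat_adjoint W * (As ! l) * W) $$ (i, j)))\<^sup>2) / real k)
          \<le> (\<Sum>l<n. \<delta> / (real n + 1))"
        proof (rule sum_mono)
          fix l assume l: "l \<in> {..<n}"
          hence Alc: "As ! l \<in> carrier_mat k k" and v: "poly_ok n (poly_var l)" using Al by auto
          have "mat_poly k As (C l) = Hm * As ! l + (- 1) \<cdot>\<^sub>m (As ! l * Hm)"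
            unfolding C_def Hm_def using P v l
            by (simp add: mat_poly_append[OF At] mat_poly_scale[OF At] mat_poly_mult[OF At] mat_poly_var[OF At])
          also have "\<dots> = Hm * As ! l - As ! l * Hm"
            using Hm Alc by (intro eq_matI) auto
          finally have "mat_poly k As (C l) = Hm * As ! l - As ! l * Hm" .
          hence "(\<Sum>i<k. \<Sum>j<k. (d i - d j)\<^sup>2 * (cmod ((mat_adjoint W * (As ! l) * W) $$ (i, j)))\<^sup>2) / real k
            = fro k (mat_poly k As (C l))"
            using fro_commutator_diag[OF W Hm Alc d] by simp
          also have "\<dots> \<le> (n2 (bop_poly ys (C l)))\<^sup>2 + e2"
            using l C by (intro sq_le) (auto simp: Ps_def)
          also have "(n2 (bop_poly ys (C l)))\<^sup>2 \<le> (sqrt (\<delta> / (2 * (real n + 1))))\<^sup>2"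
          proof (rule power_mono)
            have "ys ! l \<in> set ys" using l unfolding n_def by simp
            moreover have "H \<in> M" using H(1) A by blast
            ultimately show "0 \<le> n2 (bop_poly ys (C l))" "n2 (bop_poly ys (C l)) \<le> sqrt (\<delta> / (2 * (real n + 1)))"
              using H(3) ys unfolding bC e1_def by (auto intro: less_imp_le)
          qed
          also have "(sqrt (\<delta> / (2 * (real n + 1))))\<^sup>2 = \<delta> / (2 * (real n + 1))" using \<delta> by simp
          also have "e2 \<le> \<delta> / (2 * (real n + 1))" unfolding e2_def by simp
          also have "\<delta> / (2 * (real n + 1)) + \<delta> / (2 * (real n + 1)) = \<delta> / (real n + 1)"
          proof -
            have "x / (2 * y) + x / (2 * y) = x / y" for x y :: real by (cases "y = 0") (simp_all add: field_simps)
            thus ?thesis .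
          qed
          finally show "(\<Sum>i<k. \<Sum>j<k. (d i - d j)\<^sup>2 * (cmod ((mat_adjoint W * (As ! l) * W) $$ (i, j)))\<^sup>2) / real k
            \<le> \<delta> / (real n + 1)" by simp
        qed
        also have "\<dots> = \<delta> * (real n / (real n + 1))" by simp
        also have "\<dots> \<le> \<delta>" using \<delta> by (intro mult_left_le) auto
        finally show ?thesis .
      qed
      ultimately show "\<exists>W\<in>unitary_group k. \<exists>d :: nat \<Rightarrow> real. (\<Sum>l<n. fro k (As ! l)) \<le> R2 \<and>
         (\<Sum>l<n. (\<Sum>i<k. \<Sum>j<k. (d i - d j)\<^sup>2 * (cmod ((mat_adjoint W * (As ! l) * W) $$ (i, j)))\<^sup>2) / real k) \<le> \<delta> \<and>
         real (card {(i, j). i < k \<and> j < k \<and> \<bar>d i - d j\<bar> < 1}) \<le> \<eta> * (real k)\<^sup>2"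
        using W by blast
    qed
  qed simp
qed

lemma orbit_dim_R_le_0:
  assumes \<tau>: "\<And>a. \<tau> (op_of a) = tr a" and ys: "set ys \<subseteq> M"
    and dense: "M \<subseteq> bcomm (bcomm {bop_poly ys P | P. poly_ok (length ys) P})"
    and factor: "M \<inter> bcomm M = range scal"
    and gamma: "\<And>X e. finite X \<Longrightarrow> X \<subseteq> M \<Longrightarrow> e > 0 \<Longrightarrow>
      \<exists>u\<in>M. adj u * u = 1 \<and> u * adj u = 1 \<and> tr u = 0 \<and> (\<forall>x\<in>X. n2 (u * x - x * u) < e)"
    and \<omega>: "0 < \<omega>" "\<omega> < 1"
  shows "orbit_dim_R \<tau> (map op_of ys) \<omega> R \<le> 0"
proof (rule ereal_le_epsilon2)
  fix g :: real assume g: "0 < g"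
  define n where "n = length ys"
  define R2 where "R2 = 1 + (\<Sum>l<n. (n2 (ys ! l))\<^sup>2)"
  define B where "B = (16 * R2 / \<omega>\<^sup>2 * ln 2 + ln 3) * (6 * (real n + 1))"
  have "0 \<le> R2" unfolding R2_def by (intro add_nonneg_nonneg sum_nonneg) auto
  hence B: "B > 0" unfolding B_def by (intro mult_pos_pos add_nonneg_pos mult_nonneg_nonneg divide_nonneg_nonneg) auto
  define t where "t = - ln \<omega>"
  have t: "t > 0" unfolding t_def using \<omega> by simp
  \<comment> \<open>Half of \<open>g\<close> goes to the \<eta> term; the other half covers k ln k,
    which is eventually negligible against k^2.\<close>
  define \<eta> where "\<eta> = g * t / (2 * B)"
  have \<eta>: "\<eta> > 0" unfolding \<eta>_def using g t B by simp
  have "\<exists>m \<epsilon>. m \<ge> 1 \<and> \<epsilon> > 0 \<and> (\<forall>k>0.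
    ln (real (orbit_covering_number k (microstates \<tau> (map op_of ys) R m k \<epsilon>) \<omega>)) \<le>
    real k * ln (real k) + (16 * R2 / \<omega>\<^sup>2 * ln 2 + ln 3) * (6 * (real n + 1) * \<eta> * (real k)\<^sup>2))"
    unfolding n_def R2_def by (rule microstates_covering[OF \<tau> ys dense factor gamma \<omega>(1) \<eta>])
  then obtain m \<epsilon> where m: "m \<ge> 1" "\<epsilon> > 0" and cov: "\<forall>k>0.
    ln (real (orbit_covering_number k (microstates \<tau> (map op_of ys) R m k \<epsilon>) \<omega>)) \<le>
    real k * ln (real k) + (16 * R2 / \<omega>\<^sup>2 * ln 2 + ln 3) * (6 * (real n + 1) * \<eta> * (real k)\<^sup>2)"
    by (elim exE conjE)
  define f where "f k = ln (real (orbit_covering_number k (microstates \<tau> (map op_of ys) R m k \<epsilon>) \<omega>)) / (- ((real k)\<^sup>2 * ln \<omega>))" for k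
  have "eventually (\<lambda>k. ln (real k) / real k < g * t / 2) sequentially"
    using order_tendstoD(2)[OF lim_ln_over_n, of "g * t / 2"] g t by simp
  hence "eventually (\<lambda>k. ereal (f k) \<le> ereal g) sequentially"
    using eventually_gt_at_top[of 0]
  proof eventually_elim
    case (elim k)
    have "ln (real (orbit_covering_number k (microstates \<tau> (map op_of ys) R m k \<epsilon>) \<omega>)) \<le>
        real k * ln (real k) + (16 * R2 / \<omega>\<^sup>2 * ln 2 + ln 3) * (6 * (real n + 1) * \<eta> * (real k)\<^sup>2)"
      using cov elim(2) by blast
    also have "real k * ln (real k) = (real k)\<^sup>2 * (ln (real k) / real k)"
      using elim(2) by (simp add: power2_eq_square)
    also have "(16 * R2 / \<omega>\<^sup>2 * ln 2 + ln 3) * (6 * (real n + 1) * \<eta> * (real k)\<^sup>2) = (real k)\<^sup>2 * (B * \<eta>)"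
      unfolding B_def by (simp only: mult_ac)
    also have "B * \<eta> = g * t / 2" unfolding \<eta>_def using B by simp
    also have "(real k)\<^sup>2 * (ln (real k) / real k) + (real k)\<^sup>2 * (g * t / 2) \<le> (real k)\<^sup>2 * (g * t / 2) + (real k)\<^sup>2 * (g * t / 2)"
      using elim(1) by (intro add_right_mono mult_left_mono) auto
    also have "\<dots> = g * ((real k)\<^sup>2 * t)" by (simp add: field_simps)
    finally have le: "ln (real (orbit_covering_number k (microstates \<tau> (map op_of ys) R m k \<epsilon>) \<omega>)) \<le> g * ((real k)\<^sup>2 * t)" .
    have kt: "0 < (real k)\<^sup>2 * t" using t elim(2) by (intro mult_pos_pos) auto
    have eq: "- ((real k)\<^sup>2 * ln \<omega>) = (real k)\<^sup>2 * t" by (simp add: t_def)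
    have "f k \<le> g" unfolding f_def eq pos_divide_le_eq[OF kt] by (rule le)
    thus ?case by simp
  qed
  hence "limsup (\<lambda>k. ereal (f k)) \<le> ereal g" by (rule Limsup_bounded)
  moreover have "orbit_dim_R \<tau> (map op_of ys) \<omega> R \<le> limsup (\<lambda>k. ereal (f k))"
    unfolding orbit_dim_R_def f_def using m by (intro INF_lower2[of "(m, \<epsilon>)"]) auto
  ultimately show "orbit_dim_R \<tau> (map op_of ys) \<omega> R \<le> 0 + ereal g" by simp
qed

end

section \<open>Von Neumann algebras as tracial algebras\<close>

text \<open>Induction over the generated topology: a subbasic set comes from one pair of vectors in
  \<open>ell2\<close>, and intersecting two sets concatenates their lists. The result is the form of
  normality used in \<open>tr_normal\<close>.\<close>

lemma ultraweak_nhd_0: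
  fixes M :: "('h::complex_hilbert_space \<Rightarrow>\<^sub>L 'h) set"
  assumes "openin (ultraweak_topology M) U" "0 \<in> U"
  shows "\<exists>L d. d > 0 \<and> (\<forall>a. op_of a \<in> M \<longrightarrow> (\<forall>(x, y)\<in>set L. cmod (cinner (app (amp a) x) y) < d) \<longrightarrow> op_of a \<in> U)"
proof -
  have "generate_topology_on {{a \<in> M. f a \<in> V} | f V. f \<in> ultraweak_functionals \<and> open V} U"
    using assms(1) unfolding ultraweak_topology_def openin_topology_generated_by_iff .
  thus ?thesis
    using assms(2)
  proof (induction rule: generate_topology_on.induct)
    case Empty thus ?case by simp
  next
    case (Int a b)
    then obtain L d L' d' where "d > 0" "d' > 0"
      and L: "\<forall>c. op_of c \<in> M \<longrightarrow> (\<forall>(x, y)\<in>set L. cmod (cinner (app (amp c) x) y) < d) \<longrightarrow> op_of c \<in> a"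
      and L': "\<forall>c. op_of c \<in> M \<longrightarrow> (\<forall>(x, y)\<in>set L'. cmod (cinner (app (amp c) x) y) < d') \<longrightarrow> op_of c \<in> b"
      by blast
    show ?case
    proof (rule exI[of _ "L @ L'"], rule exI[of _ "min d d'"], intro conjI allI impI)
      show "min d d' > 0" using \<open>d > 0\<close> \<open>d' > 0\<close> by simp
      fix c assume c: "op_of c \<in> M" "\<forall>(x, y)\<in>set (L @ L'). cmod (cinner (app (amp c) x) y) < min d d'"
      have "\<forall>(x, y)\<in>set L. cmod (cinner (app (amp c) x) y) < d" "\<forall>(x, y)\<in>set L'. cmod (cinner (app (amp c) x) y) < d'"
        using c(2) by auto
      thus "op_of c \<in> a \<inter> b" using L L' c(1) by blast
    qed
  next
    case (UN K)
    then obtain k where k: "k \<in> K" "0 \<in> k" by blast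
    from UN.IH[OF k] obtain L d where "d > 0"
      "\<forall>a. op_of a \<in> M \<longrightarrow> (\<forall>(x, y)\<in>set L. cmod (cinner (app (amp a) x) y) < d) \<longrightarrow> op_of a \<in> k" by blast
    thus ?case using k(1) by (intro exI[of _ L] exI[of _ d]) blast
  next
    case (Basis s)
    then obtain f V where s: "s = {a \<in> M. f a \<in> V}" "f \<in> ultraweak_functionals" "open V" by blast
    obtain \<xi> \<eta> :: "nat \<Rightarrow> 'h" where f: "f = (\<lambda>a. \<Sum>n. cinner (blinfun_apply a (\<xi> n)) (\<eta> n))"
      and sq: "sqsum \<xi>" "sqsum \<eta>"
      using s(2) unfolding ultraweak_functionals_def sqsum_def by blast
    have fa: "cinner (app (amp a) (Ell2 \<xi>)) (Ell2 \<eta>) = f (op_of a)" for a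
      unfolding f cinner_ell2.rep_eq nth2_amp using sq by (simp add: Ell2_inverse app.rep_eq)
    have "f 0 = 0" unfolding f by simp
    hence "0 \<in> V" using Basis s by simp
    then obtain d where d: "d > 0" "ball 0 d \<subseteq> V" using s(3) open_contains_ball by blast
    show ?case
    proof (rule exI[of _ "[(Ell2 \<xi>, Ell2 \<eta>)]"], rule exI[of _ d], intro conjI allI impI d)
      fix a assume "op_of a \<in> M" "\<forall>(x, y)\<in>set [(Ell2 \<xi>, Ell2 \<eta>)]. cmod (cinner (app (amp a) x) y) < d"
      thus "op_of a \<in> s" using d(2) unfolding s(1) by (auto simp: fa)
    qed
  qed
qed

text \<open>The zero functional with target \<open>UNIV\<close> makes \<open>M\<close> itself a
  subbasic set.\<close>

lemma topspace_ultraweak: "M \<subseteq> topspace (ultraweak_topology (M :: ('h::complex_hilbert_space \<Rightarrow>\<^sub>L 'h) set))"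
proof -
  have "(\<lambda>a. \<Sum>n. cinner (blinfun_apply a ((\<lambda>_. 0) n)) ((\<lambda>_. 0 :: 'h) n)) \<in> ultraweak_functionals"
    unfolding ultraweak_functionals_def by (intro CollectI exI[of _ "\<lambda>_. 0"]) simp
  thus ?thesis
    unfolding ultraweak_topology_def topology_generated_by_topspace
    by (intro Union_upper CollectI exI[of _ "\<lambda>a. \<Sum>n. cinner (blinfun_apply a ((\<lambda>_. 0) n)) ((\<lambda>_. 0 :: 'h) n)"] exI[of _ UNIV]) auto
qed

lemma tracial_algebra_of_tracial_state:
  fixes M :: "('h::complex_hilbert_space \<Rightarrow>\<^sub>L 'h) set"
  assumes vn: "von_neumann_algebra M" and \<tau>: "tracial_state M \<tau>"
  shows "tracial_algebra {a. op_of a \<in> M} (\<lambda>a. \<tau> (op_of a))"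
proof
  define B where "B = {a. op_of a \<in> M}"
  note B = vn_algebra_bops[OF vn, folded B_def]
  have mem: "x \<in> B \<Longrightarrow> op_of x \<in> M" for x unfolding B_def by simp
  \<comment> \<open>By the bicommutant property, membership means commuting with
    \<open>bcomm B\<close>, and the algebraic operations preserve this.\<close>
  have bi: "\<And>a. a \<in> B \<longleftrightarrow> (\<forall>s\<in>bcomm B. a * s = s * a)" using B(1) unfolding bcomm_def by blast
  show bic: "bcomm (bcomm {a. op_of a \<in> M}) = {a. op_of a \<in> M}" using B(1) unfolding B_def .
  show star: "star_algebra {a. op_of a \<in> M}"
    unfolding star_algebra_def B_def[symmetric]
  proof (intro conjI ballI allI)
    show "1 \<in> B" unfolding bi by simp
    fix a b assume ab: "a \<in> B" "b \<in> B"
    show "a + b \<in> B" using ab unfolding bi by (simp add: distrib_left distrib_right)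
    show "a * b \<in> B"
      unfolding bi
    proof
      fix s assume "s \<in> bcomm B"
      hence "a * s = s * a" "b * s = s * b" using ab bi by blast+
      hence "a * (b * s) = (s * a) * b" by (simp add: mult.assoc[symmetric])
      thus "a * b * s = s * (a * b)" by (simp only: mult.assoc)
    qed
  next
    fix c a assume "a \<in> B"
    thus "scal c * a \<in> B" unfolding bi by (simp add: mult_scal_left mult.assoc)
  next
    fix a assume "a \<in> B" thus "adj a \<in> B" by (rule B(2))
  qed
  note T = \<tau>[unfolded tracial_state_def]
  fix a b :: "'h bop" and c
  show "a \<in> {a. op_of a \<in> M} \<Longrightarrow> b \<in> {a. op_of a \<in> M} \<Longrightarrow> \<tau> (op_of (a + b)) = \<tau> (op_of a) + \<tau> (op_of b)"
    using T by (simp add: plus_bop.rep_eq)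
  show "a \<in> {a. op_of a \<in> M} \<Longrightarrow> \<tau> (op_of (scal c * a)) = c * \<tau> (op_of a)"
    using T by (simp add: times_bop.rep_eq scal.rep_eq)
  show "a \<in> {a. op_of a \<in> M} \<Longrightarrow> Im (\<tau> (op_of (adj a * a))) = 0 \<and> 0 \<le> Re (\<tau> (op_of (adj a * a)))"
    using T by (simp add: times_bop.rep_eq adj.rep_eq)
  show "\<tau> (op_of 1) = 1" using T by (simp add: one_bop.rep_eq)
  show "a \<in> {a. op_of a \<in> M} \<Longrightarrow> b \<in> {a. op_of a \<in> M} \<Longrightarrow> \<tau> (op_of (a * b)) = \<tau> (op_of (b * a))"
    using T by (simp add: times_bop.rep_eq)
  show "a \<in> {a. op_of a \<in> M} \<Longrightarrow> \<tau> (op_of (adj a * a)) = 0 \<Longrightarrow> a = 0"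
    using T by (simp add: times_bop.rep_eq adj.rep_eq zero_bop.rep_eq flip: op_of_inject)
  fix e :: real assume e: "e > 0"
  define U where "U = {a \<in> topspace (ultraweak_topology M). \<tau> a \<in> ball 0 e}"
  have "openin (ultraweak_topology M) U"
    unfolding U_def using T by (intro openin_continuous_map_preimage[of _ euclidean]) auto
  moreover have "0 \<in> U"
  proof -
    have "scal 0 * 1 \<in> B" using star unfolding star_algebra_def B_def by blast
    hence z: "0 \<in> M" unfolding B_def by (simp add: zero_bop.rep_eq)
    hence "\<tau> (0 + 0) = \<tau> 0 + \<tau> 0" using T[THEN conjunct1] by blast
    thus ?thesis unfolding U_def using z topspace_ultraweak[of M] e by auto
  qed
  ultimately obtain L d where d: "d > 0"
    and L: "\<forall>a. op_of a \<in> M \<longrightarrow> (\<forall>(x, y)\<in>set L. cmod (cinner (app (amp a) x) y) < d) \<longrightarrow> op_of a \<in> U"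
    using ultraweak_nhd_0 by blast
  show "\<exists>L d. 0 < d \<and> (\<forall>a\<in>{a. op_of a \<in> M}. (\<forall>(x, y)\<in>set L. cmod (cinner (app (amp a) x) y) < d) \<longrightarrow> cmod (\<tau> (op_of a)) < e)"
  proof (rule exI[of _ L], rule exI[of _ d], intro conjI ballI impI d)
    fix a assume "a \<in> {a. op_of a \<in> M}" "\<forall>(x, y)\<in>set L. cmod (cinner (app (amp a) x) y) < d"
    hence "op_of a \<in> U" using L by blast
    thus "cmod (\<tau> (op_of a)) < e" unfolding U_def by simp
  qed
qed

text \<open>Finite generation makes the outer supremum run over a nonempty set; over the empty set
  it would be \<open>-\<infinity>\<close>. The values 1/2 for \<omega> and 1 for \<open>R\<close>
  are arbitrary.\<close>

lemma K2_algebra_nonneg: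
  assumes "finitely_generated_vn M"
  shows "0 \<le> K2_algebra M \<tau>"
proof -
  obtain xs where xs: "generates_vn xs M" using assms unfolding finitely_generated_vn_def by blast
  have "0 \<le> orbit_dim_R \<tau> xs (1/2) 1"
    unfolding orbit_dim_R_def
  proof (rule INF_greatest, clarify)
    fix m \<epsilon>
    have ln0: "0 \<le> ln (real N)" for N :: nat by (cases "N = 0") auto
    show "0 \<le> limsup (\<lambda>k. ereal (ln (real (orbit_covering_number k (microstates \<tau> xs 1 m k \<epsilon>) (1/2))) / (- ((real k)\<^sup>2 * ln (1/2)))))"
    proof (rule le_Limsup)
      show "\<forall>\<^sub>F k in sequentially. 0 \<le> ereal (ln (real (orbit_covering_number k (microstates \<tau> xs 1 m k \<epsilon>) (1/2))) / (- ((real k)\<^sup>2 * ln (1/2))))"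
        by (intro always_eventually allI) (simp add: ln0 ln_div zero_le_divide_iff mult_nonneg_nonpos)
    qed simp
  qed
  also have "\<dots> \<le> orbit_dim \<tau> xs (1/2)" unfolding orbit_dim_def by (rule SUP_upper) simp
  also have "\<dots> \<le> K2_tuple \<tau> xs" unfolding K2_tuple_def by (rule SUP_upper) simp
  also have "\<dots> \<le> K2_algebra M \<tau>" unfolding K2_algebra_def using xs by (intro SUP_upper) simp
  finally show ?thesis .
qed

theorem corollary1:
  fixes M :: "('h::complex_hilbert_space \<Rightarrow>\<^sub>L 'h) set"
    and \<tau> :: "('h \<Rightarrow>\<^sub>L 'h) \<Rightarrow> complex"
  assumes "II1_factor M"
    and "tracial_state M \<tau>"
    and "finitely_generated_vn M"
    and "property_Gamma M \<tau>"
  shows "K2_algebra M \<tau> = 0"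
proof (rule antisym)
  show "0 \<le> K2_algebra M \<tau>" by (rule K2_algebra_nonneg[OF assms(3)])
  have vn: "von_neumann_algebra M" and fac: "M \<inter> commutant M = range scalar_op"
    using assms(1) unfolding II1_factor_def vn_factor_def by blast+
  define B where "B = {a. op_of a \<in> M}"
  define tr where "tr a = \<tau> (op_of a)" for a
  interpret tracial_algebra B tr
    unfolding B_def tr_def by (rule tracial_algebra_of_tracial_state[OF vn assms(2)])
  note MB = vn_algebra_bops(3,4)[OF vn, folded B_def]
  have factor: "B \<inter> bcomm B = range scal"
  proof -
    have "op_of ` (B \<inter> bcomm B) = op_of ` range scal"
      using MB(2) fac by (simp add: image_image scal.rep_eq)
    moreover have "inj (op_of :: 'h bop \<Rightarrow> _)" by (rule injI) (simp add: op_of_inject)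
    ultimately show ?thesis by (simp only: inj_image_eq_iff)
  qed
  have n2: "norm2 \<tau> (op_of a) = n2 a" for a
    unfolding norm2_def n2_def tr_def by (simp add: times_bop.rep_eq adj.rep_eq)
  have gamma: "\<exists>u\<in>B. adj u * u = 1 \<and> u * adj u = 1 \<and> tr u = 0 \<and> (\<forall>x\<in>X. n2 (u * x - x * u) < e)"
    if X: "finite X" "X \<subseteq> B" and e: "e > 0" for X e
  proof -
    obtain ys where ys: "set ys = X" using finite_list[OF X(1)] by blast
    have "set (map op_of ys) \<subseteq> M" using ys X unfolding B_def by auto
    then obtain v where v: "v \<in> unitaries M" "\<tau> v = 0" "\<forall>x\<in>set (map op_of ys). norm2 \<tau> ((v o\<^sub>L x) - (x o\<^sub>L v)) < e"
      using assms(4) e unfolding property_Gamma_def by blast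
    have "v \<in> M" using v(1) unfolding unitaries_def by blast
    then obtain u where u: "v = op_of u" "u \<in> B" using MB(1) by blast
    have "op_of (adj u * u) = op_of 1" "op_of (u * adj u) = op_of 1"
      using v(1) unfolding unitaries_def u(1) by (simp_all add: times_bop.rep_eq adj.rep_eq one_bop.rep_eq)
    hence un: "adj u * u = 1" "u * adj u = 1" by (simp_all add: op_of_inject)
    have "n2 (u * x - x * u) < e" if "x \<in> X" for x
    proof -
      have "norm2 \<tau> ((v o\<^sub>L op_of x) - (op_of x o\<^sub>L v)) < e" using v(3) that ys by auto
      thus ?thesis unfolding u(1) n2[symmetric] by (simp add: minus_bop.rep_eq times_bop.rep_eq)
    qed
    thus ?thesis using u(2) un v(2) unfolding u(1) tr_def by blast
  qed
  have "K2_tuple \<tau> xs \<le> 0" if gen: "generates_vn xs M" for xs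
  proof -
    have "set xs \<subseteq> op_of ` B" using gen MB(1) unfolding generates_vn_def by blast
    hence "xs \<in> lists (op_of ` B)" by auto
    then obtain ys where ys: "set ys \<subseteq> B" "xs = map op_of ys"
      unfolding lists_image by (auto simp: in_lists_conv_set)
    \<comment> \<open>\<open>A\<close> is formed from the generating tuple at hand. Its bicommutant
      is a von Neumann algebra containing the tuple, so it contains \<open>M\<close>, which is the
      density hypothesis of \<open>orbit_dim_R_le_0\<close>.\<close>
    define A where "A = {bop_poly ys P | P. poly_ok (length ys) P}"
    have A: "star_algebra A" unfolding A_def by (rule star_algebra_bop_polys)
    have ysA: "set ys \<subseteq> A"
    proof
      fix y assume "y \<in> set ys"
      then obtain l where "l < length ys" "y = ys ! l" by (metis in_set_conv_nth)
      thus "y \<in> A" unfolding A_def by (intro CollectI exI[of _ "poly_var l"]) simp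
    qed
    have "A \<subseteq> bcomm (bcomm A)" unfolding bcomm_def by auto
    hence "set xs \<subseteq> op_of ` bcomm (bcomm A)" using ysA unfolding ys(2) by auto
    moreover have "von_neumann_algebra (op_of ` bcomm (bcomm A))"
      using A unfolding star_algebra_def by (intro von_neumann_algebra_bcomm) blast
    ultimately have "vn_generated (set xs) \<subseteq> op_of ` bcomm (bcomm A)" unfolding vn_generated_def by blast
    hence "M \<subseteq> op_of ` bcomm (bcomm A)" using gen unfolding generates_vn_def by simp
    hence dense: "B \<subseteq> bcomm (bcomm A)" unfolding B_def using op_of_mem_image by blast
    have "orbit_dim_R \<tau> xs \<omega> R \<le> 0" if "0 < \<omega>" "\<omega> < 1" for \<omega> R
      unfolding ys(2)
      by (rule orbit_dim_R_le_0[OF _ ys(1) dense[unfolded A_def] factor gamma that]) (simp_all add: tr_def)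
    thus ?thesis unfolding K2_tuple_def orbit_dim_def by (auto intro!: SUP_least)
  qed
  thus "K2_algebra M \<tau> \<le> 0" unfolding K2_algebra_def by (auto intro!: SUP_least)
qed

end
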